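(* Let $\mathbb{F}$ be a field of characteristic $2$ equipped with a non-identity involution $x\mapsto x^\bullet$, and let $\mathbb{K}:=\{x\in\mathbb{F}: x^\bullet=x\}$. Let $b$ be a non-degenerate Hermitian form on a finite-dimensional vector space $V$ over $\mathbb{F}$, and let $u$ be a $b$-selfadjoint automorphism of $V$. For there to exist $b$-selfadjoint endomorphisms $a_1,a_2$ of $V$ with $a_1^2=a_2^2=0$ and $u=a_1+a_2$, it is necessary and sufficient that all the following conditions hold: (i) for all $p\in\mathrm{Irr}(\mathbb{F})\setminus\mathrm{Irr}_0(\mathbb{F})$ and all odd $r\ge1$, one has $n_{p,r}(u)=0$; (ii) for all $p\in\mathrm{Irr}_0(\mathbb{F})\cap\mathbb{K}[t]$ and all $r\ge1$, the Hermitian invariant $(b,u)_{p,r}$ is odd-representable.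
   Context: Here an involution is a field automorphism of order $2$. Hermitian forms are linear in the right variable and semilinear in the left one, with $b(y,x)=b(x,y)^\bullet$. $u$ is $b$-selfadjoint if $b(u(x),y)=b(x,u(y))$ for all $x,y$. $\mathrm{Irr}(\mathbb{F})$ is the set of monic irreducible polynomials of $\mathbb{F}[t]$ and $\mathrm{Irr}_0(\mathbb{F})=\mathrm{Irr}(\mathbb{F})\cap\mathbb{F}[t^2]$. For $p\in\mathrm{Irr}(\mathbb{F})$ and $r\ge1$, set $V_{p,r}:=\mathrm{Ker}\,p(u)^r/\bigl(\mathrm{Ker}\,p(u)^{r-1}+(\mathrm{Ker}\,p(u)^r\cap\mathrm{Im}\,p(u))\bigr)$, a vector space over $\mathbb{L}:=\mathbb{F}[t]/(p)$ (the class of $t$ acting through $u$), and $n_{p,r}(u):=\dim_{\mathbb{L}}V_{p,r}$ (the number of primary invariants of $u$ equal to $p^r$). Hermitian invariants. Let $p\in\mathrm{Irr}(\mathbb{F})\cap\mathbb{K}[t]$ have degree $d$. Applying $\bullet$ coefficientwise induces an involution, still denoted $\bullet$, of $\mathbb{L}=\mathbb{F}[t]/(p)$. Let $e_p:\mathbb{L}\to\mathbb{F}$ be the $\mathbb{F}$-linear form with $e_p(\overline{1})=1$ and $e_p(\overline{t^i})=0$ for $1\le i\le d-1$. The Hermitian form $(x,y)\mapsto b(x,p(u)^{r-1}(y))$ induces a non-degenerate Hermitian form $B$ on the $\mathbb{F}$-vector space $V_{p,r}$, and $(b,u)_{p,r}$ is the unique map $B^{\mathbb{L}}:V_{p,r}^2\to\mathbb{L}$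 such that $B(x,\lambda y)=e_p(\lambda B^{\mathbb{L}}(x,y))$ for all $\lambda\in\mathbb{L}$ and all $x,y$; it is a non-degenerate Hermitian form over $(\mathbb{L},\bullet)$. Odd-representability. For $p\in\mathrm{Irr}_0(\mathbb{F})\cap\mathbb{K}[t]$, a Hermitian form $h$ over $\mathbb{L}=\mathbb{F}[t]/(p)$ is odd-representable if there is an $h$-orthogonal basis $(e_1,\dots,e_n)$ such that for each $i$ there exists $s_i\in\mathbb{K}[t]$ with $h(e_i,e_i)$ equal to the class of $t\,s_i(t^2)$ modulo $p$. *)

theory Defs
  imports "HOL-Algebra.QuotRing" "Jordan_Normal_Form.VS_Connect"
begin

section \<open>Hermitian forms and selfadjoint maps\<close>

definition field_involution :: "('f::field \<Rightarrow> 'f) \<Rightarrow> bool" where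
  "field_involution bul \<longleftrightarrow>
     bul 1 = 1 \<and> (\<forall>x y. bul (x + y) = bul x + bul y) \<and> (\<forall>x y. bul (x * y) = bul x * bul y) \<and>
     (\<forall>x. bul (bul x) = x) \<and> bul \<noteq> id"

definition hermitian_form ::
    "('f::field \<Rightarrow> 'v::ab_group_add \<Rightarrow> 'v) \<Rightarrow> ('f \<Rightarrow> 'f) \<Rightarrow> ('v \<Rightarrow> 'v \<Rightarrow> 'f) \<Rightarrow> bool" where
  "hermitian_form scale bul b \<longleftrightarrow>
     (\<forall>x y z. b x (y + z) = b x y + b x z) \<and> (\<forall>c x y. b x (scale c y) = c * b x y) \<and>
     (\<forall>x y z. b (x + y) z = b x z + b y z) \<and> (\<forall>c x y. b (scale c x) y = bul c * b x y) \<and>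
     (\<forall>x y. b y x = bul (b x y))"

definition nondegenerate :: "('v::zero \<Rightarrow> 'v \<Rightarrow> 'f::zero) \<Rightarrow> bool" where
  "nondegenerate b \<longleftrightarrow> (\<forall>x. (\<forall>y. b x y = 0) \<longrightarrow> x = 0)"

definition selfadjoint :: "('v \<Rightarrow> 'v \<Rightarrow> 'f) \<Rightarrow> ('v \<Rightarrow> 'v) \<Rightarrow> bool" where
  "selfadjoint b u \<longleftrightarrow> (\<forall>x y. b (u x) y = b x (u y))"


section \<open>Polynomials\<close>

definition Irr :: "'f::field poly set" where
  "Irr = {p. irreducible p \<and> lead_coeff p = 1}"

text \<open>The polynomial $s(t^2)$.\<close>
definition at_t2 :: "'f::field poly \<Rightarrow> 'f poly" where
  "at_t2 s = pcompose s (monom 1 2)"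

definition Irr0 :: "'f::field poly set" where
  "Irr0 = Irr \<inter> range at_t2"

text \<open>The subring $K[t]$ of $F[t]$, where $K$ is the fixed field of the involution.\<close>
definition fixed_polys :: "('f::field \<Rightarrow> 'f) \<Rightarrow> 'f poly set" where
  "fixed_polys bul = {q. \<forall>i. bul (coeff q i) = coeff q i}"


section \<open>The residue field $L = F[t]/(p)$\<close>

abbreviation residue_field :: "'f::field poly \<Rightarrow> 'f poly set ring" where
  "residue_field p \<equiv> class_ring Quot (PIdl\<^bsub>class_ring\<^esub> p)"

definition residue_class :: "'f::field poly \<Rightarrow> 'f poly \<Rightarrow> 'f poly set" where
  "residue_class p q = PIdl\<^bsub>class_ring\<^esub> p +>\<^bsub>class_ring\<^esub> q"

text \<open>The linear form $e_p$ on $L$ sending the class of $1$ to $1$ and the classes of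
  $t, \dots, t^{d-1}$ to $0$, where $d$ is the degree of $p$: it is the constant coefficient of
  the representative of degree less than $d$.\<close>
definition residue_form :: "'f::field poly \<Rightarrow> 'f poly set \<Rightarrow> 'f" where
  "residue_form p \<Lambda> = (THE c. \<exists>q\<in>\<Lambda>. degree q < degree p \<and> c = coeff q 0)"


section \<open>The spaces $V_{p,r}$\<close>

text \<open>The endomorphism $p(u)$.\<close>
definition poly_map ::
    "('f::field \<Rightarrow> 'v::ab_group_add \<Rightarrow> 'v) \<Rightarrow> ('v \<Rightarrow> 'v) \<Rightarrow> 'f poly \<Rightarrow> 'v \<Rightarrow> 'v" where
  "poly_map scale u p x = (\<Sum>i\<le>degree p. scale (coeff p i) ((u ^^ i) x))"

definition ker_pow ::
    "('f::field \<Rightarrow> 'v::ab_group_add \<Rightarrow> 'v) \<Rightarrow> ('v \<Rightarrow> 'v) \<Rightarrow> 'f poly \<Rightarrow> nat \<Rightarrow> 'v set" where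
  "ker_pow scale u p r = {x. (poly_map scale u p ^^ r) x = 0}"

definition primary_denom ::
    "('f::field \<Rightarrow> 'v::ab_group_add \<Rightarrow> 'v) \<Rightarrow> ('v \<Rightarrow> 'v) \<Rightarrow> 'f poly \<Rightarrow> nat \<Rightarrow> 'v set" where
  "primary_denom scale u p r =
     {y + z | y z. y \<in> ker_pow scale u p (r - 1) \<and>
                   z \<in> ker_pow scale u p r \<inter> range (poly_map scale u p)}"

definition vec_coset :: "'v::ab_group_add set \<Rightarrow> 'v \<Rightarrow> 'v set" where
  "vec_coset W x = {x + w | w. w \<in> W}"

text \<open>$V_{p,r}$ as a vector space over \<^term>\<open>residue_field p\<close>; its vectors are cosets. The fields
  \<open>mult\<close> and \<open>one\<close> of the record play no role for modules.\<close>
definition primary_space ::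
    "('f::field \<Rightarrow> 'v::ab_group_add \<Rightarrow> 'v) \<Rightarrow> ('v \<Rightarrow> 'v) \<Rightarrow> 'f poly \<Rightarrow> nat
      \<Rightarrow> ('f poly set, 'v set) module" where
  "primary_space scale u p r =
     \<lparr>carrier = vec_coset (primary_denom scale u p r) ` ker_pow scale u p r,
      mult = undefined, one = undefined,
      zero = primary_denom scale u p r,
      add = (\<lambda>X Y. {x + y | x y. x \<in> X \<and> y \<in> Y}),
      smult = (\<lambda>\<Lambda> X. \<Union>q\<in>\<Lambda>. \<Union>x\<in>X. vec_coset (primary_denom scale u p r) (poly_map scale u q x))\<rparr>"

definition primary_number ::
    "('f::field \<Rightarrow> 'v::ab_group_add \<Rightarrow> 'v) \<Rightarrow> ('v \<Rightarrow> 'v) \<Rightarrow> 'f poly \<Rightarrow> nat \<Rightarrow> nat" where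
  "primary_number scale u p r = vectorspace.dim (residue_field p) (primary_space scale u p r)"


section \<open>Hermitian invariants\<close>

text \<open>The form $B$ on $V_{p,r}$: the common value of $b(x, p(u)^{r-1}(y))$ over all representatives
  $x, y$ of the two cosets.\<close>
definition induced_form ::
    "('f::field \<Rightarrow> 'v::ab_group_add \<Rightarrow> 'v) \<Rightarrow> ('v \<Rightarrow> 'v \<Rightarrow> 'f) \<Rightarrow> ('v \<Rightarrow> 'v) \<Rightarrow> 'f poly \<Rightarrow> nat
      \<Rightarrow> 'v set \<Rightarrow> 'v set \<Rightarrow> 'f" where
  "induced_form scale b u p r X Y =
     (THE c. \<forall>x\<in>X. \<forall>y\<in>Y. b x ((poly_map scale u p ^^ (r - 1)) y) = c)"

text \<open>The Hermitian invariant $(b,u)_{p,r}$. Its defining property involves each pair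
  of arguments separately, so it is defined pointwise.\<close>
definition hermitian_invariant ::
    "('f::field \<Rightarrow> 'v::ab_group_add \<Rightarrow> 'v) \<Rightarrow> ('v \<Rightarrow> 'v \<Rightarrow> 'f) \<Rightarrow> ('v \<Rightarrow> 'v) \<Rightarrow> 'f poly \<Rightarrow> nat
      \<Rightarrow> 'v set \<Rightarrow> 'v set \<Rightarrow> 'f poly set" where
  "hermitian_invariant scale b u p r X Y =
     (THE \<beta>. \<beta> \<in> carrier (residue_field p) \<and>
        (\<forall>\<Lambda>\<in>carrier (residue_field p).
           induced_form scale b u p r X (\<Lambda> \<odot>\<^bsub>primary_space scale u p r\<^esub> Y)
             = residue_form p (\<Lambda> \<otimes>\<^bsub>residue_field p\<^esub> \<beta>)))"

definition odd_representable ::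
    "('f::field \<Rightarrow> 'f) \<Rightarrow> 'f poly \<Rightarrow> ('f poly set, 'w) module \<Rightarrow> ('w \<Rightarrow> 'w \<Rightarrow> 'f poly set) \<Rightarrow> bool" where
  "odd_representable bul p M h \<longleftrightarrow>
     (\<exists>E. finite E \<and> vectorspace.basis (residue_field p) M E \<and>
        (\<forall>x\<in>E. \<forall>y\<in>E. x \<noteq> y \<longrightarrow> h x y = \<zero>\<^bsub>residue_field p\<^esub>) \<and>
        (\<forall>x\<in>E. \<exists>s\<in>fixed_polys bul. h x x = residue_class p (monom 1 1 * at_t2 s)))"

end

theory Submission
  imports Defs "HOL-Computational_Algebra.Polynomial_Factorial"
begin

text \<open>
  Write $F$ for the field. Call a polynomial even if
  it lies in $F[t^2]$; in characteristic 2 this means that its derivative is 0, and every $f$ is the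
  sum of its even part $f - tf'$ and its odd part $tf'$.

  If $u = a_1 + a_2$ with both squares 0, then $a = a_1$ satisfies $au + ua = u^2$, so that
  $a f(u) = f(u) a + u^2 f'(u)$: the map $a$ behaves like the derivation $u^2 d/du$. Its kernel $V_0$ is
  stable under $u^2$, totally isotropic, and $V = V_0 \<oplus> u V_0$. Conversely, from such a subspace one gets
  back $a_1$ by $a_1(x + uy) = u^2 y$. A subspace $V_0$ of this kind is in turn the $F[t^2]$-span of a
  set $X$ that generates $V$ over $F[t]$ and satisfies $b(x, f(u)y) = 0$ for all $x, y \<in> X$ and all even $f$.
  So the problem is to find \<^emph>\<open>even-isotropic generators\<close>.

  Necessity. Let $p$ be irreducible. If $p$ is not even then $p'$ is prime to $p$, and applying $a$ to
  $p(u)^r x = 0$ with $r$ odd shows that $p(u)^{r-1} x$ is in the image of $p(u)^r$, which is (i). If $p$ is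
  even, then $p(u)$ commutes with $a$, and $Z = V_0 \<inter> ker p(u)^r$ satisfies $ker p(u)^r = Z + uZ$. On $Z$ the
  form $b(x, f(u)p(u)^{r-1}y)$ vanishes for even $f$. Gram-Schmidt orthogonalization with coefficients
  in $F[t^2]$ stays inside $Z$ and gives orthogonal generators of $V_{p,r}$. Since
  $e_p$ kills $t$ times every even polynomial, the vanishing on even $f$ says exactly that the value
  $h(x,x)$ is the class of some $t s(t^2)$; this is (ii).

  Sufficiency is an induction on the dimension: nondegenerate $u$-stable pieces with even-isotropic
  generators are split off orthogonally, and the conditions pass to the orthogonal complement.
  Let $p$ be an irreducible polynomial with nontrivial kernel and $r$ the largest exponent that
  occurs. If $p$ is not fixed by the involution, a piece is generated by two vectors $x, y$ in
  the kernels of $p^r$ and of its conjugate, where $y$ is chosen so that $b(y, f(u)x)$ is the top coefficient of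
  $f$ mod $p^r$; that vanishes for even $f$ as $p^r$ is even of even degree. If $p$ is fixed, the piece is
  cyclic, generated by some $x$. The functional $\<phi>(f) = b(x, f(u)x)$ on $F[t]/(p^r)$ has to
  be made to vanish on even polynomials by passing to another generator $g(u)x$, which replaces $\<phi>$
  by $\<phi>(g g^* \<cdot>)$. The functional $\<psi>(f) = \<phi>(kf')$ vanishes on even polynomials, and for
  a suitable $k$ it agrees with $\<phi>$ on the multiples of $p^{r-1}$: for even $p$ take $k = t$ and use that
  $x$ represents a member of the orthogonal basis in (ii); otherwise (i) makes $r$ even and $k = p k_0$
  with $k_0 p'$ congruent to 1 modulo $p$ will do. Duality (lemma \<open>functional_duality\<close>) gives
  $\<psi> = \<phi>(h \<cdot>)$ with $h$ symmetric and congruent to 1 modulo $p$, and such an $h$ has the form $g g^*$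
  modulo $p^r$ by a Hensel argument (lemma \<open>hensel\<close>), since every symmetric element is a trace.

  The spaces $V_{p,r}$ and the invariants enter only at the end, where (i) and (ii) are
  translated into statements about vectors of $V$.
\<close>


section \<open>Bezout identities and linear functionals on $F[t]$\<close>

abbreviation psm :: "'f::field \<Rightarrow> 'f poly \<Rightarrow> 'f poly" where "psm \<equiv> Polynomial.smult"

lemma poly_bezout:
  fixes p a :: "'f::field poly"
  shows "\<exists>s t. (s * a + t * p) dvd a \<and> (s * a + t * p) dvd p"
proof (induction p arbitrary: a rule: measure_induct_rule[where f="\<lambda>p. if p = 0 then 0 else Suc (degree p)"])
  case (less p)
  show ?case
  proof (cases "p = 0")
    case True
    then show ?thesis by (intro exI[of _ 1]) auto
  next
    case False
    have "(if a mod p = 0 then 0 else Suc (degree (a mod p))) < (if p = 0 then 0 else Suc (degree p))"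
      using False degree_mod_less[of p a] by auto
    from less.IH[OF this, of p] obtain s t where st:
      "(s * p + t * (a mod p)) dvd p" "(s * p + t * (a mod p)) dvd (a mod p)"
      by blast
    have e: "s * p + t * (a mod p) = t * a + (s - t * (a div p)) * p"
      by (simp add: minus_div_mult_eq_mod[symmetric] algebra_simps)
    have "(s * p + t * (a mod p)) dvd a"
      using dvd_add[OF dvd_mult[OF st(1), of "a div p"] st(2)] by simp
    then show ?thesis using st(1) unfolding e by blast
  qed
qed

lemma poly_bezout_irreducible:
  fixes p a :: "'f::field poly"
  assumes "irreducible p" "\<not> p dvd a"
  shows "\<exists>s t. s * a + t * p = 1"
proof -
  obtain s t where st: "(s * a + t * p) dvd a" "(s * a + t * p) dvd p"
    using poly_bezout by blast
  define g where "g = s * a + t * p"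
  obtain h where h: "p = g * h" using st unfolding g_def dvd_def by blast
  have "is_unit g \<or> is_unit h" using assms(1) h irreducibleD by blast
  moreover have "\<not> is_unit h"
  proof
    assume "is_unit h"
    then have "p dvd g" unfolding h by (simp add: mult_unit_dvd_iff)
    then show False using st(1) assms(2) g_def dvd_trans by blast
  qed
  ultimately obtain g' where "1 = g * g'" unfolding dvd_def by blast
  then have "(g' * s) * a + (g' * t) * p = 1" unfolding g_def by (simp add: algebra_simps)
  then show ?thesis by blast
qed

text \<open>From $sa + tp = 1$ one gets $(tp)^r = (1 - sa)^r$, which is congruent to 1 modulo $a$.\<close>

lemma poly_inverse_mod_prime_power:
  fixes p a :: "'f::field poly"
  assumes "irreducible p" "\<not> p dvd a"
  shows "\<exists>s. p ^ r dvd s * a - 1"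
proof -
  obtain s t where st: "s * a + t * p = 1" using poly_bezout_irreducible[OF assms] by blast
  have "t * p = 1 - s * a" using st by (simp add: algebra_simps)
  then have p: "p ^ r dvd (1 - s * a) ^ r" by (intro dvd_power_same) (metis dvd_triv_right)
  have "a dvd 1 - (1 - s * a)" by simp
  also have "1 - (1 - s * a) dvd 1 - (1 - s * a) ^ r"
    unfolding one_diff_power_eq by simp
  finally obtain c where "1 - (1 - s * a) ^ r = a * c" unfolding dvd_def by blast
  then have "c * a - 1 = - ((1 - s * a) ^ r)" by (simp add: algebra_simps)
  then have "p ^ r dvd c * a - 1" using p by simp
  then show ?thesis by blast
qed

text \<open>Linear forms on $F[t]$. Those that vanish on the multiples of $q$ are the linear forms on $F[t]/(q)$.\<close>

definition functional :: "('f::field poly \<Rightarrow> 'f) \<Rightarrow> bool" where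
  "functional \<phi> \<longleftrightarrow> (\<forall>f g. \<phi> (f + g) = \<phi> f + \<phi> g) \<and> (\<forall>c f. \<phi> (psm c f) = c * \<phi> f)"

lemma functional_add: "functional \<phi> \<Longrightarrow> \<phi> (f + g) = \<phi> f + \<phi> g"
  and functional_smult: "functional \<phi> \<Longrightarrow> \<phi> (psm c f) = c * \<phi> f"
  unfolding functional_def by auto

lemma functional_0: "functional \<phi> \<Longrightarrow> \<phi> 0 = 0"
  using functional_smult[of \<phi> 0 0] by simp

lemma functional_minus: "functional \<phi> \<Longrightarrow> \<phi> (- f) = - \<phi> f"
  using functional_smult[of \<phi> "-1" f] by simp

lemma functional_diff: "functional \<phi> \<Longrightarrow> \<phi> (f - g) = \<phi> f - \<phi> g"
  using functional_add[of \<phi> f "-g"] functional_minus[of \<phi> g] by simp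

lemma functional_sum: "functional \<phi> \<Longrightarrow> \<phi> (sum F A) = (\<Sum>i\<in>A. \<phi> (F i))"
  by (induction A rule: infinite_finite_induct) (auto simp: functional_0 functional_add)

lemma functional_mult_left: "functional \<phi> \<Longrightarrow> functional (\<lambda>f. \<phi> (h * f))"
  unfolding functional_def by (auto simp: algebra_simps)

lemma functional_eqI:
  fixes \<phi> \<psi> :: "'f::field poly \<Rightarrow> 'f"
  assumes "functional \<phi>" "functional \<psi>" "\<And>f. \<phi> (q * f) = 0" "\<And>f. \<psi> (q * f) = 0" "q \<noteq> 0"
    and eq: "\<And>i. i < degree q \<Longrightarrow> \<phi> (monom 1 i) = \<psi> (monom 1 i)"
  shows "\<phi> f = \<psi> f"
proof -
  let ?g = "f mod q"
  have f: "f = q * (f div q) + ?g" by simp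
  have "\<phi> ?g = \<psi> ?g"
  proof (cases "?g = 0")
    case True
    then show ?thesis using assms by (simp add: functional_0)
  next
    case False
    then have d: "degree ?g < degree q" using degree_mod_less[OF \<open>q \<noteq> 0\<close>] by auto
    have g: "?g = (\<Sum>i\<le>degree ?g. psm (coeff ?g i) (monom 1 i))"
      by (simp add: smult_monom poly_as_sum_of_monoms)
    have *: "\<And>\<chi>. functional \<chi> \<Longrightarrow> \<chi> ?g = (\<Sum>i\<le>degree ?g. coeff ?g i * \<chi> (monom 1 i))"
      by (subst g) (simp add: functional_sum functional_smult)
    show ?thesis using d by (simp add: * assms(1,2) eq)
  qed
  moreover have *: "\<chi> f = \<chi> ?g" if "functional \<chi>" "\<And>f. \<chi> (q * f) = 0" for \<chi> :: "'f poly \<Rightarrow> 'f"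
    using functional_add[OF that(1), of "q * (f div q)" ?g] that(2) by simp
  ultimately show ?thesis using *[OF assms(1,3)] *[OF assms(2,4)] by metis
qed

definition top_coeff :: "'f::field poly \<Rightarrow> 'f poly \<Rightarrow> 'f" where
  "top_coeff q f = coeff (f mod q) (degree q - 1)"

lemma functional_top_coeff: "functional (top_coeff q)"
  unfolding functional_def top_coeff_def by (simp add: poly_mod_add_left mod_smult_left)

lemma top_coeff_mult: "top_coeff q (q * f) = 0"
  unfolding top_coeff_def by simp

text \<open>The top coefficient of the remainder modulo $q$ generates the dual of $F[t]/(q)$: the coefficients
  of $h$ are found one at a time, because $t^{d-1-n}$ pairs to 1 with $t^n$ and to 0 with every lower power.\<close>

lemma top_coeff_represents:
  fixes \<psi> :: "'f::field poly \<Rightarrow> 'f"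
  assumes "functional \<psi>" "\<And>f. \<psi> (q * f) = 0" "q \<noteq> 0"
  shows "\<exists>h. \<forall>f. \<psi> f = top_coeff q (h * f)"
proof -
  have "\<exists>h. \<forall>i<n. top_coeff q (h * monom 1 i) = \<psi> (monom 1 i)" if "n \<le> degree q" for n
    using that
  proof (induction n)
    case 0
    then show ?case by simp
  next
    case (Suc n)
    then obtain h where h: "\<forall>i<n. top_coeff q (h * monom 1 i) = \<psi> (monom 1 i)" by auto
    define c where "c = \<psi> (monom 1 n) - top_coeff q (h * monom 1 n)"
    have m: "top_coeff q (monom c (degree q - 1 - n) * monom 1 i) = (if i = n then c else 0)" if "i \<le> n" for i
    proof -
      have "degree q - 1 - n + i < degree q" using that Suc.prems by simp
      then have d: "degree (monom c (degree q - 1 - n + i)) < degree q"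
        using le_less_trans[OF degree_monom_le] by blast
      have "top_coeff q (monom c (degree q - 1 - n) * monom 1 i) = coeff (monom c (degree q - 1 - n + i)) (degree q - 1)"
        unfolding top_coeff_def mult_monom mult_1_right mod_poly_less[OF d] ..
      also have "\<dots> = (if i = n then c else 0)" using that Suc.prems by auto
      finally show ?thesis .
    qed
    have "top_coeff q ((h + monom c (degree q - 1 - n)) * monom 1 i) = \<psi> (monom 1 i)" if "i < Suc n" for i
      using h m[of i] that functional_top_coeff[of q]
      by (auto simp: distrib_right functional_add less_Suc_eq c_def)
    then show ?case by blast
  qed
  from this[OF order_refl] obtain h where h: "\<forall>i<degree q. top_coeff q (h * monom 1 i) = \<psi> (monom 1 i)" by blast
  have "\<psi> f = top_coeff q (h * f)" for f
  proof (rule functional_eqI[of \<psi> "\<lambda>f. top_coeff q (h * f)" q])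
    show "top_coeff q (h * (q * f)) = 0" for f
      unfolding mult.left_commute[of h q] by (rule top_coeff_mult)
    show "\<psi> (monom 1 i) = top_coeff q (h * monom 1 i)" if "i < degree q" for i
      using h that by simp
  qed (use assms in \<open>simp_all add: functional_mult_left functional_top_coeff\<close>)
  then show ?thesis by blast
qed

text \<open>Both functionals are top-coefficient functionals twisted by polynomials $a$ and $c$. A functional
  that is nonzero on the multiples of $p^{r-1}$ has $a$ prime to $p$, so $a$ can be inverted modulo $p^r$.\<close>

lemma functional_duality:
  fixes \<phi> \<psi> :: "'f::field poly \<Rightarrow> 'f"
  assumes p: "irreducible p"
    and \<phi>: "functional \<phi>" "\<And>f. \<phi> (p ^ r * f) = 0" "\<phi> (p ^ (r - 1) * f0) \<noteq> 0"
    and \<psi>: "functional \<psi>" "\<And>f. \<psi> (p ^ r * f) = 0"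
  shows "\<exists>h. \<forall>f. \<phi> (h * f) = \<psi> f"
proof -
  have q0: "p ^ r \<noteq> 0" using p by auto
  obtain a where a: "\<And>f. \<phi> f = top_coeff (p ^ r) (a * f)"
    using top_coeff_represents[OF \<phi>(1,2) q0] by blast
  obtain c where c: "\<And>f. \<psi> f = top_coeff (p ^ r) (c * f)"
    using top_coeff_represents[OF \<psi>(1,2) q0] by blast
  have r: "r > 0" using \<phi>(2)[of f0] \<phi>(3) by (cases r) auto
  have "\<not> p dvd a"
  proof
    assume "p dvd a"
    then obtain a1 where "a = p * a1" unfolding dvd_def by blast
    then have "a * (p ^ (r - 1) * f0) = p ^ r * (a1 * f0)" using r by (cases r) auto
    then have "\<phi> (p ^ (r - 1) * f0) = 0" by (simp only: a top_coeff_mult)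
    then show False using \<phi>(3) by simp
  qed
  from poly_inverse_mod_prime_power[OF p this, of r]
  obtain s k where s: "s * a - 1 = p ^ r * k" unfolding dvd_def by blast
  have "\<phi> (c * s * f) = \<psi> f" for f
  proof -
    have "a * (c * s * f) = c * f + p ^ r * (k * c * f)"
    proof -
      have "s * a = 1 + p ^ r * k" using s by (simp add: algebra_simps)
      moreover have "a * (c * s * f) = c * f * (s * a)" by (simp add: algebra_simps)
      ultimately show ?thesis by (simp add: algebra_simps)
    qed
    then show ?thesis unfolding a c
      by (simp add: functional_add[OF functional_top_coeff] top_coeff_mult)
  qed
  then show ?thesis by blast
qed

lemma dvd_if_functional_vanishes:
  fixes \<phi> :: "'f::field poly \<Rightarrow> 'f"
  assumes p: "irreducible p"
    and \<phi>: "functional \<phi>" "\<And>f. \<phi> (p * f) = 0" "\<phi> f0 \<noteq> 0" "\<And>f. \<phi> (h * f) = 0"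
  shows "p dvd h"
proof (rule ccontr)
  assume "\<not> p dvd h"
  then obtain s t where "s * h + t * p = 1" using poly_bezout_irreducible[OF p] by blast
  then have "f0 = (s * h + t * p) * f0" by simp
  also have "\<dots> = h * (s * f0) + p * (t * f0)" by (simp add: algebra_simps)
  finally have "\<phi> f0 = \<phi> (h * (s * f0) + p * (t * f0))" by (rule arg_cong)
  also have "\<dots> = 0" by (simp only: functional_add[OF \<phi>(1)] \<phi>(2,4) add_0)
  finally show False using \<phi>(3) by simp
qed

lemma functional_eq_0I:
  assumes "functional \<phi>" "\<And>i. \<phi> (monom 1 i) = (0 :: 'f::field)"
  shows "\<phi> f = 0"
proof -
  have "f = (\<Sum>i\<le>degree f. psm (coeff f i) (monom 1 i))"
    by (simp add: smult_monom poly_as_sum_of_monoms)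
  then have "\<phi> f = \<phi> (\<Sum>i\<le>degree f. psm (coeff f i) (monom 1 i))" by (rule arg_cong)
  also have "\<dots> = 0" by (simp only: functional_sum[OF assms(1)] functional_smult[OF assms(1)] assms(2) mult_zero_right sum.neutral_const)
  finally show ?thesis .
qed

lemma irreducible_degree_pos: "irreducible (p::'f::field poly) \<Longrightarrow> degree p > 0"
  using is_unit_iff_degree[of p] irreducible_not_unit[of p] by (cases "p = 0") auto

lemma factor_out_irreducible:
  fixes p m :: "'f::field poly"
  assumes "irreducible p" "m \<noteq> 0"
  shows "\<exists>k c. m = p ^ k * c \<and> \<not> p dvd c"
  using assms(2)
proof (induction "degree m" arbitrary: m rule: less_induct)
  case less
  show ?case
  proof (cases "p dvd m")
    case True
    then obtain m' where m': "m = p * m'" unfolding dvd_def by blast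
    then have "m' \<noteq> 0" "p \<noteq> 0" using less.prems by auto
    then have "degree m' < degree m" using irreducible_degree_pos[OF assms(1)] by (simp add: m' degree_mult_eq)
    then obtain k c where "m' = p ^ k * c" "\<not> p dvd c" using less.hyps \<open>m' \<noteq> 0\<close> by blast
    then have "m = p ^ Suc k * c \<and> \<not> p dvd c" using m' by simp
    then show ?thesis by blast
  next
    case False
    then show ?thesis by (intro exI[of _ 0] exI[of _ m]) simp
  qed
qed

lemma irreducible_dvd_power:
  fixes p a :: "'f::field poly"
  shows "irreducible p \<Longrightarrow> p dvd a ^ n \<Longrightarrow> p dvd a"
  by (rule prime_elem_dvd_power[OF field_poly_irreducible_imp_prime])

lemma irreducible_not_dvd_pderiv:
  fixes p :: "'f::field poly"
  assumes "irreducible p" "pderiv p \<noteq> 0"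
  shows "\<not> p dvd pderiv p"
proof -
  have "degree (pderiv p) \<le> degree p - 1"
  proof (rule degree_le, intro allI impI)
    fix i assume "degree p - 1 < i"
    then have "degree p < Suc i" by linarith
    then show "coeff (pderiv p) i = 0" by (simp add: coeff_pderiv coeff_eq_0)
  qed
  then show ?thesis
    using dvd_imp_degree_le[of p "pderiv p"] irreducible_degree_pos[OF assms(1)] assms(2) by linarith
qed

lemma Irr_dvd_imp_eq:
  assumes "p \<in> Irr" "p' \<in> Irr" "p dvd (p' :: 'f::field poly)"
  shows "p = p'"
proof -
  obtain c where c: "p' = p * c" using assms(3) unfolding dvd_def by blast
  have "\<not> is_unit p" using assms(1) by (simp add: Irr_def irreducible_not_unit)
  then have "is_unit c" using assms(2) c irreducibleD unfolding Irr_def by blast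
  then obtain k where k: "c = [:k:]" unfolding is_unit_poly_iff by blast
  have "lead_coeff p' = lead_coeff p * k" unfolding c k by (simp add: lead_coeff_mult)
  then have "k = 1" using assms(1,2) unfolding Irr_def by simp
  then show ?thesis using c k by simp
qed

text \<open>The top-coefficient functional is nonzero on the multiples of $p^{r-1}$, hence it
  describes a perfect pairing.\<close>

lemma top_coeff_prime_power:
  assumes "p \<in> Irr" "r \<ge> 1"
  shows "top_coeff (p ^ r) (p ^ (r - 1) * monom 1 (degree p - 1)) = 1"
proof -
  have p: "irreducible p" "lead_coeff p = 1" using assms(1) unfolding Irr_def by auto
  have dp: "degree p > 0" by (rule irreducible_degree_pos[OF p(1)])
  have p0: "p \<noteq> 0" using p(1) by auto
  let ?f = "p ^ (r - 1) * monom 1 (degree p - 1)"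
  have d: "degree ?f = degree (p ^ r) - 1"
    using p0 dp assms(2) by (subst degree_mult_eq) (auto simp: degree_power_eq degree_monom_eq algebra_simps diff_mult_distrib)
  have "degree (p ^ r) > 0" using p0 dp assms(2) by (simp add: degree_power_eq)
  then have "?f mod p ^ r = ?f" using d by (intro mod_poly_less) linarith
  then have "top_coeff (p ^ r) ?f = lead_coeff ?f" unfolding top_coeff_def d by simp
  also have "\<dots> = 1" unfolding lead_coeff_mult lead_coeff_power p(2) by (simp add: degree_monom_eq)
  finally show ?thesis .
qed

section \<open>Even polynomials and the involution in characteristic 2\<close>

locale char2_involution =
  fixes bul :: "'f::field \<Rightarrow> 'f"
  assumes two: "(1::'f) + 1 = 0" and involution: "field_involution bul"
begin

lemma bul_simps [simp]: "bul 1 = 1" "bul (x + y) = bul x + bul y" "bul (x * y) = bul x * bul y"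
    "bul (bul x) = x"
  using involution unfolding field_involution_def by auto

lemma bul_0 [simp]: "bul 0 = 0"
  using bul_simps(2)[of 0 0] by (metis add.right_neutral add_left_cancel)

lemma bul_minus [simp]: "bul (- x) = - bul x"
  using bul_simps(2)[of x "-x"] by (metis add.right_inverse bul_0 minus_unique)

lemma bul_diff [simp]: "bul (x - y) = bul x - bul y"
  using bul_simps(2)[of x "-y"] by simp

lemma bul_sum: "bul (sum F A) = (\<Sum>i\<in>A. bul (F i))"
  by (induction A rule: infinite_finite_induct) auto

lemma bul_eq_0 [simp]: "bul x = 0 \<longleftrightarrow> x = 0"
  by (metis bul_0 bul_simps(4))

lemma double [simp]: "(x::'f) + x = 0"
proof -
  have "x + x = (1 + 1) * x" by (simp add: distrib_right)
  then show ?thesis using two by simp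
qed

lemma two_eq_0 [simp]: "(2::'f) = 0"
  using two unfolding one_add_one .

lemma uminus_id [simp]: "- (x::'f) = x"
  by (rule minus_unique) simp

lemma of_nat_parity: "(of_nat n :: 'f) = (if even n then 0 else 1)"
  by (induction n) (auto simp: two)

lemma poly_double: "(f::'f poly) + f = 0"
  by (rule poly_eqI) (simp only: coeff_add double coeff_0)

lemma poly_two_eq_0 [simp]: "(2::'f poly) = 0"
  using poly_double[of 1] by simp

lemma poly_uminus_id [simp]: "- (f::'f poly) = f"
  by (rule minus_unique) (rule poly_double)

lemma ex_trace: "\<exists>z. z + bul z \<noteq> 0"
proof -
  obtain z where "bul z \<noteq> z" using involution unfolding field_involution_def by (auto simp: fun_eq_iff)
  then have "z + bul z \<noteq> 0" by (metis minus_unique uminus_id)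
  then show ?thesis by blast
qed

text \<open>The extension of the fixed field is separable, even in characteristic 2, so its trace is onto.\<close>

lemma ex_trace_one: "\<exists>e. e + bul e = 1"
proof -
  obtain z where z: "z + bul z \<noteq> 0" using ex_trace by blast
  define t where "t = z + bul z"
  have t: "bul t = t" by (simp add: t_def add.commute)
  have "bul (inverse t) * t = 1" using z t
    by (metis bul_simps(1,3) left_inverse t_def)
  then have "bul (inverse t) = inverse t" using z unfolding t_def[symmetric]
    by (metis inverse_unique mult.commute)
  then have "z * inverse t + bul (z * inverse t) = 1" using z unfolding t_def
    by (metis bul_simps(3) distrib_right right_inverse)
  then show ?thesis by blast
qed

text \<open>The conjugate $f^*$ of a polynomial.\<close>

definition star :: "'f poly \<Rightarrow> 'f poly" where "star = map_poly bul"

lemma coeff_star [simp]: "coeff (star f) i = bul (coeff f i)"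
  unfolding star_def by (simp add: coeff_map_poly)

lemma star_star [simp]: "star (star f) = f" by (rule poly_eqI) simp
lemma star_add [simp]: "star (f + g) = star f + star g" by (rule poly_eqI) simp
lemma star_diff [simp]: "star (f - g) = star f - star g" by (rule poly_eqI) (simp del: uminus_id)
lemma star_0 [simp]: "star 0 = 0" by (rule poly_eqI) simp
lemma star_1 [simp]: "star 1 = 1" by (rule poly_eqI) (simp add: coeff_1)
lemma star_smult [simp]: "star (psm c f) = psm (bul c) (star f)" by (rule poly_eqI) simp
lemma star_monom [simp]: "star (monom c n) = monom (bul c) n" by (rule poly_eqI) simp
lemma star_mult [simp]: "star (f * g) = star f * star g"
  by (rule poly_eqI) (simp add: coeff_mult bul_sum)
lemma star_power [simp]: "star (f ^ n) = star f ^ n" by (induction n) auto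
lemma star_pCons [simp]: "star (pCons a f) = pCons (bul a) (star f)"
  by (rule poly_eqI) (simp add: coeff_pCons split: nat.split)
lemma star_eq_0 [simp]: "star f = 0 \<longleftrightarrow> f = 0" by (metis star_0 star_star)
lemma degree_star [simp]: "degree (star f) = degree f"
proof -
  have "degree (star f) \<le> degree f" for f by (rule degree_le) (simp add: coeff_eq_0)
  from this[of f] this[of "star f"] show ?thesis by simp
qed
lemma star_dvd_star: "star f dvd star g \<longleftrightarrow> f dvd g"
  by (metis dvd_def star_mult star_star)

lemma pderiv_star [simp]: "pderiv (star f) = star (pderiv f)"
  by (rule poly_eqI) (simp add: coeff_pderiv of_nat_parity del: of_nat_Suc)

lemma fixed_polys_iff: "f \<in> fixed_polys bul \<longleftrightarrow> star f = f"
  unfolding fixed_polys_def poly_eq_iff by simp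

lemma is_unit_star: "is_unit (star f) \<longleftrightarrow> is_unit f"
  using star_dvd_star[of f 1] by simp

lemma irreducible_star:
  assumes "irreducible p"
  shows "irreducible (star p)"
proof (rule irreducibleI)
  show "star p \<noteq> 0" using assms by auto
  show "\<not> is_unit (star p)" using assms by (simp add: is_unit_star irreducible_not_unit)
  fix a b assume "star p = a * b"
  then have "p = star a * star b" by (metis star_mult star_star)
  then show "is_unit a \<or> is_unit b" using irreducibleD[OF assms] is_unit_star by blast
qed

lemma Irr_star: "p \<in> Irr \<Longrightarrow> star p \<in> Irr"
  unfolding Irr_def by (simp add: irreducible_star)

lemma pderiv_pderiv [simp]: "pderiv (pderiv (f::'f poly)) = 0"
proof (rule poly_eqI)
  fix n
  have "(of_nat (Suc n) * of_nat (Suc (Suc n)) :: 'f) = 0"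
    unfolding of_nat_parity by simp
  then show "coeff (pderiv (pderiv f)) n = coeff 0 n"
    by (simp add: coeff_pderiv mult.assoc[symmetric] del: of_nat_Suc)
qed

lemma pderiv_power_char2: "pderiv ((f::'f poly) ^ r) = (if odd r then f ^ (r - 1) * pderiv f else 0)"
proof (induction r)
  case (Suc r)
  then show ?case
    by (cases r) (auto simp: pderiv_mult poly_double mult.assoc mult.commute mult.left_commute)
qed auto

lemma pderiv_at_t2 [simp]: "pderiv (at_t2 (s::'f poly)) = 0"
proof -
  have "pderiv (monom (1::'f) 2) = 0" by (simp add: pderiv_monom two numeral_2_eq_2)
  then show ?thesis unfolding at_t2_def pderiv_pcompose by simp
qed

text \<open>A polynomial whose derivative is 0 is a constant plus $t^2$ times another such polynomial.\<close>

lemma pderiv_eq_0_iff_at_t2: "pderiv (f::'f poly) = 0 \<longleftrightarrow> f \<in> range at_t2"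
proof
  assume "pderiv f = 0"
  then show "f \<in> range at_t2"
  proof (induction "degree f" arbitrary: f rule: less_induct)
    case less
    obtain a f1 where f1: "f = pCons a f1" by (cases f)
    obtain b g where g: "f1 = pCons b g" by (cases f1)
    have b: "b = 0" using less.prems unfolding f1 g by (simp add: pderiv_pCons)
    have dg: "pderiv g = 0"
      using less.prems unfolding f1 g b
      by (simp add: pderiv_pCons)
    have fg: "f = pCons a (pCons 0 g)" using f1 g b by simp
    have "g \<in> range at_t2"
    proof (cases "g = 0")
      case True
      then show ?thesis by (intro image_eqI[of _ _ 0]) (auto simp: at_t2_def)
    next
      case False
      then have "degree g < degree f" unfolding fg by simp
      then show ?thesis using less.hyps dg by blast
    qed
    then obtain s where s: "g = at_t2 s" by blast
    have "at_t2 (pCons a s) = pCons a (pCons 0 g)"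
      unfolding s at_t2_def by (simp add: pcompose_pCons monom_altdef power2_eq_square)
    then show ?case unfolding fg by (metis rangeI)
  qed
qed auto

lemma at_t2_eq_iff: "at_t2 (s::'f poly) = at_t2 s' \<longleftrightarrow> s = s'"
proof
  assume "at_t2 s = at_t2 s'"
  then have "pcompose (s - s') (monom 1 2) = 0" unfolding at_t2_def by (simp add: pcompose_diff)
  then show "s = s'" using pcompose_eq_0[of "s - s'" "monom 1 2"] by (simp add: degree_monom_eq)
qed simp

lemma star_at_t2: "star (at_t2 s) = at_t2 (star s)"
  by (induction s) (auto simp: at_t2_def pcompose_pCons)

lemma Irr0_iff: "p \<in> Irr0 \<longleftrightarrow> p \<in> Irr \<and> pderiv (p::'f poly) = 0"
  unfolding Irr0_def pderiv_eq_0_iff_at_t2 by auto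

text \<open>Successive approximation. If $h - gg^* = p^n k$ then $k$ is symmetric, hence $k = ek + (ek)^*$ for
  an element $e$ of trace 1, and $g + p^n ek$ is a solution modulo $p^{n+1}$ because $g$ is congruent to 1.\<close>

lemma hensel:
  assumes p: "star p = p" "p \<noteq> 0" and h: "star h = h" "p dvd h - 1"
  shows "\<exists>g. p dvd g - 1 \<and> p ^ Suc r dvd h - g * star g"
proof (induction r)
  case 0
  show ?case using h by (intro exI[of _ 1]) auto
next
  case (Suc r)
  then obtain g where g: "p dvd g - 1" "p ^ Suc r dvd h - g * star g" by blast
  obtain k where k: "h - g * star g = p ^ Suc r * k" using g(2) unfolding dvd_def by blast
  have "star (h - g * star g) = h - g * star g" using h(1) by (simp add: mult.commute)
  then have "p ^ Suc r * star k = p ^ Suc r * k" unfolding k using p(1) by simp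
  then have k': "star k = k" using p(2) by simp
  obtain e where e: "e + bul e = 1" using ex_trace_one by blast
  define g' where "g' = g + p ^ Suc r * psm e k"
  have sg: "p dvd star g - 1" using g(1) p(1) star_dvd_star[of p "g - 1"] by simp
  have "psm (e + bul e) k = k" using e by simp
  then have ek: "k = psm e k + psm (bul e) k" by (simp add: smult_add_left)
  have sg': "star g' = star g + p ^ Suc r * psm (bul e) k"
    unfolding g'_def by (simp only: star_add star_mult star_smult star_power p k')
  have ring: "x - (y + P * a) * (z + P * c) = P * (- ((y - 1) * c + (z - 1) * a)) - P * P * (a * c)"
    if "x - y * z = P * (a + c)" for x y z P a c :: "'f poly"
  proof -
    have "x = y * z + P * (a + c)" using that by (simp add: algebra_simps del: poly_uminus_id)
    then show ?thesis by (simp add: algebra_simps del: poly_uminus_id)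
  qed
  have "h - g * star g = p ^ Suc r * (psm e k + psm (bul e) k)" using k ek by simp
  from ring[OF this] have *: "h - g' * star g' = p ^ Suc r * (- ((g - 1) * psm (bul e) k + (star g - 1) * psm e k))
       - p ^ Suc r * p ^ Suc r * (psm e k * psm (bul e) k)"
    unfolding sg' unfolding g'_def .
  have PP: "p ^ Suc (Suc r) = p ^ Suc r * p" by (simp add: mult.commute)
  have "p dvd - ((g - 1) * psm (bul e) k + (star g - 1) * psm e k)"
    using g(1) sg by (simp del: mult_smult_right poly_uminus_id)
  then have "p ^ Suc (Suc r) dvd p ^ Suc r * (- ((g - 1) * psm (bul e) k + (star g - 1) * psm e k))"
    unfolding PP by (rule mult_dvd_mono[OF dvd_refl])
  moreover have "p ^ Suc (Suc r) dvd p ^ Suc r * p ^ Suc r * (psm e k * psm (bul e) k)"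
    unfolding PP by (intro dvd_mult2 mult_dvd_mono dvd_refl) simp
  ultimately have "p ^ Suc (Suc r) dvd h - g' * star g'" unfolding * by (rule dvd_diff)
  moreover have "p dvd g' - 1"
  proof -
    have "g' - 1 = (g - 1) + p * (p ^ r * psm e k)" unfolding g'_def by (simp add: algebra_simps)
    then show ?thesis using g(1) by (metis dvd_add dvd_triv_left)
  qed
  ultimately show ?case by blast
qed

lemma even_part: "pderiv ((f :: 'f poly) - monom 1 1 * pderiv f) = 0"
  unfolding pderiv_diff pderiv_mult pderiv_pderiv by (simp add: pderiv_monom monom_0 one_pCons[symmetric] del: poly_uminus_id)

lemma odd_coeff_0:
  assumes "pderiv (f :: 'f poly) = 0" "odd n"
  shows "coeff f n = 0"
proof -
  obtain m where m: "n = Suc m" "even m" using assms(2) by (cases n) auto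
  have "coeff (pderiv f) m = coeff f n" unfolding coeff_pderiv m(1) of_nat_parity using m(2) by simp
  then show ?thesis using assms(1) by simp
qed

lemma pderiv_mod_0:
  fixes q f :: "'f poly"
  assumes q: "pderiv q = 0" "q \<noteq> 0" "degree q > 0" and f: "pderiv f = 0"
  shows "pderiv (f mod q) = 0"
proof -
  have "f = q * (f div q) + f mod q" by simp
  then have "pderiv f = pderiv (q * (f div q) + f mod q)" by (rule arg_cong)
  also have "\<dots> = q * pderiv (f div q) + pderiv (f mod q)"
    unfolding pderiv_add pderiv_mult q(1) mult_zero_right add_0_right ..
  finally have "pderiv (f mod q) = - (q * pderiv (f div q))"
    unfolding f by (simp only: eq_neg_iff_add_eq_0 add.commute)
  then have "q dvd pderiv (f mod q)" by simp
  moreover have "degree (pderiv (f mod q)) < degree q"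
  proof -
    have "degree (pderiv (f mod q)) \<le> degree (f mod q)"
      by (rule degree_le) (simp add: coeff_pderiv coeff_eq_0)
    then show ?thesis using degree_mod_less[OF q(2), of f] q(3) by auto
  qed
  ultimately show ?thesis using dvd_imp_degree_le[of q "pderiv (f mod q)"] by linarith
qed

text \<open>An even polynomial has no odd coefficients; reduction modulo an even $q$ preserves this, and the
  degree $d - 1$ is odd.\<close>

lemma top_coeff_even:
  fixes q f :: "'f poly"
  assumes q: "pderiv q = 0" "q \<noteq> 0" "degree q > 0" and f: "pderiv f = 0"
  shows "top_coeff q f = 0"
proof -
  have "even (degree q)" using odd_coeff_0[OF q(1), of "degree q"] q(2) by auto
  then have "odd (degree q - 1)" using q(3) by simp
  then show ?thesis unfolding top_coeff_def using odd_coeff_0[OF pderiv_mod_0[OF q f]] by blast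
qed

text \<open>If two functionals vanish on even polynomials and one is a multiple of the other, then only the
  even part of the multiplier matters, since an odd multiplier would exchange even and odd arguments.\<close>

lemma even_representative:
  fixes h f :: "'f poly"
  assumes \<phi>: "functional \<phi>" "\<And>f. pderiv f = 0 \<Longrightarrow> \<phi> f = 0"
    and \<psi>: "\<And>f. pderiv f = 0 \<Longrightarrow> \<psi> f = 0" and h: "\<And>f. \<phi> (h * f) = \<psi> f"
  shows "\<phi> ((h - monom 1 1 * pderiv h) * f) = \<psi> f"
proof -
  let ?X = "monom 1 1 :: 'f poly"
  let ?h0 = "h - ?X * pderiv h" and ?f0 = "f - ?X * pderiv f"
  have pX: "pderiv (?X * pderiv g) = pderiv g" for g
    unfolding pderiv_mult pderiv_pderiv by (simp add: pderiv_monom monom_0 one_pCons[symmetric])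
  have "pderiv (?X * pderiv h * (?X * pderiv f)) = ?X * (pderiv h * pderiv f) + ?X * (pderiv h * pderiv f)"
    unfolding pderiv_mult[of "?X * pderiv h"] pX by (simp only: mult_ac)
  then have 1: "\<phi> (?X * pderiv h * (?X * pderiv f)) = 0" unfolding poly_double by (rule \<phi>(2))
  have ev: "pderiv ?f0 = 0" by (rule even_part)
  have "pderiv (?h0 * ?f0) = 0" unfolding pderiv_mult even_part by simp
  then have "\<phi> (?h0 * ?f0) = 0" by (rule \<phi>(2))
  moreover have "\<phi> (h * ?f0) = 0" unfolding h by (rule \<psi>[OF ev])
  moreover have "?X * pderiv h * ?f0 = h * ?f0 - ?h0 * ?f0" by (simp add: algebra_simps del: poly_uminus_id)
  ultimately have 2: "\<phi> (?X * pderiv h * ?f0) = 0" by (simp only: functional_diff[OF \<phi>(1)] diff_zero)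
  have "?X * pderiv h * f = ?X * pderiv h * ?f0 + ?X * pderiv h * (?X * pderiv f)"
    by (simp add: algebra_simps del: poly_uminus_id)
  then have "\<phi> (?X * pderiv h * f) = 0" by (simp only: functional_add[OF \<phi>(1)] 1 2 add_0)
  moreover have "?h0 * f = h * f - ?X * pderiv h * f" by (simp only: left_diff_distrib)
  ultimately show ?thesis by (simp only: functional_diff[OF \<phi>(1)] h diff_zero)
qed

end

section \<open>The $F[t]$-module defined by $u$\<close>

locale hermitian_pair = finite_dimensional_vector_space scale Basis + char2_involution bul
  for scale :: "'f::field \<Rightarrow> 'v::ab_group_add \<Rightarrow> 'v" and Basis :: "'v set" and bul :: "'f \<Rightarrow> 'f" +
  fixes b :: "'v \<Rightarrow> 'v \<Rightarrow> 'f" and u :: "'v \<Rightarrow> 'v"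
  assumes hermitian: "hermitian_form scale bul b" and nondeg: "nondegenerate b"
    and linear_u: "Vector_Spaces.linear scale scale u" and bij_u: "bij u"
    and selfadjoint_u: "selfadjoint b u"
begin

lemma u_add [simp]: "u (x + y) = u x + u y"
  and u_scale [simp]: "u (scale c x) = scale c (u x)"
  using linear_u by (simp_all add: module_hom.add module_hom.scale linear_iff_module_hom)

lemma u_0 [simp]: "u 0 = 0"
  using u_scale[of 0 0] by simp

lemma u_sum: "u (sum F A) = (\<Sum>i\<in>A. u (F i))"
  by (induction A rule: infinite_finite_induct) auto

lemma vec_double: "(x::'v) + x = 0"
proof -
  have "scale (1 + 1) x = x + x" unfolding scale_left_distrib by simp
  then show ?thesis using two by simp
qed

lemma vec_uminus [simp]: "- (x::'v) = x"
  by (rule minus_unique) (rule vec_double)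

lemma vec_diff: "(x::'v) - y = x + y"
  unfolding diff_conv_add_uminus vec_uminus ..

lemma b_simps [simp]:
  "b x (y + z) = b x y + b x z" "b x (scale c y) = c * b x y"
  "b (x + y) z = b x z + b y z" "b (scale c x) y = bul c * b x y"
  using hermitian unfolding hermitian_form_def by blast+

lemma b_sym: "b y x = bul (b x y)"
  using hermitian unfolding hermitian_form_def by blast+

lemma b_0 [simp]: "b x 0 = 0" "b 0 x = 0"
  using b_simps(2)[of x 0 0] b_simps(4)[of 0 0 x] by auto

lemma b_diff [simp]: "b x (y - z) = b x y - b x z" "b (x - y) z = b x z - b y z"
  using b_simps(1)[of x "y - z" z] b_simps(3)[of "x - y" y z] by (simp_all only: diff_add_cancel eq_diff_eq)

lemma b_sym_0: "b y x = 0 \<longleftrightarrow> b x y = 0"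
  by (subst b_sym) simp

lemma b_u: "b (u x) y = b x (u y)"
  using selfadjoint_u unfolding selfadjoint_def by auto

lemma nondegD: "(\<And>y. b x y = 0) \<Longrightarrow> x = 0"
  using nondeg unfolding nondegenerate_def by auto

abbreviation act :: "'f poly \<Rightarrow> 'v \<Rightarrow> 'v" where "act \<equiv> poly_map scale u"

lemma act_bound:
  assumes "degree f \<le> n"
  shows "act f x = (\<Sum>i\<le>n. scale (coeff f i) ((u ^^ i) x))"
  unfolding poly_map_def using assms
  by (intro sum.mono_neutral_left) (auto simp: coeff_eq_0)

lemma act_0 [simp]: "act 0 x = 0"
  unfolding poly_map_def by simp

lemma act_pCons [simp]: "act (pCons a f) x = scale a x + u (act f x)"
proof -
  have "act (pCons a f) x = (\<Sum>i\<le>Suc (degree f). scale (coeff (pCons a f) i) ((u ^^ i) x))"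
    by (rule act_bound) (simp add: degree_pCons_le)
  also have "\<dots> = scale a x + u (act f x)"
    unfolding sum.atMost_Suc_shift poly_map_def u_sum by simp
  finally show ?thesis .
qed

lemma act_add [simp]: "act (f + g) x = act f x + act g x"
proof -
  let ?n = "max (degree f) (degree g)"
  have "degree (f + g) \<le> ?n" "degree f \<le> ?n" "degree g \<le> ?n" by (auto simp: degree_add_le)
  from this[THEN act_bound] show ?thesis by (simp add: scale_left_distrib sum.distrib)
qed

lemma act_smult [simp]: "act (psm c f) x = scale c (act f x)"
  using act_bound[OF degree_smult_le[of c f]]
  by (simp add: poly_map_def scale_sum_right)

lemma act_1 [simp]: "act 1 x = x"
  unfolding one_pCons act_pCons by simp

lemma act_vadd [simp]: "act f (x + y) = act f x + act f y"
  by (induction f) (auto simp: scale_right_distrib)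

lemma act_vscale [simp]: "act f (scale c x) = scale c (act f x)"
  by (induction f) (auto simp: scale_right_distrib mult.commute)

lemma act_v0 [simp]: "act f 0 = 0"
  by (induction f) auto

lemma act_mult: "act (f * g) x = act f (act g x)"
  by (induction f) auto

lemma act_commute: "act f (act g x) = act g (act f x)"
  by (metis act_mult mult.commute)

lemma act_mult': "act (f * g) x = act g (act f x)"
  by (metis act_mult mult.commute)

lemma act_diff [simp]: "act (f - g) x = act f x - act g x"
  using act_add[of "f - g" g x] by (simp only: diff_add_cancel eq_diff_eq)

lemma act_vdiff [simp]: "act f (x - y) = act f x - act f y"
  using act_vadd[of f "x - y" y] by (simp only: diff_add_cancel eq_diff_eq)

lemma act_X: "act (monom 1 1) x = u x"
  by (simp add: monom_altdef)

lemma act_u: "act f (u x) = u (act f x)"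
  by (metis act_X act_commute)

lemma act_power: "(act p ^^ n) x = act (p ^ n) x"
  by (induction n) (auto simp: act_mult)

lemma b_act: "b (act f x) y = b x (act (star f) y)"
proof (induction f arbitrary: y)
  case (pCons a f)
  then show ?case by (simp add: b_u act_u)
qed simp

lemma b_act': "b x (act f y) = b (act (star f) x) y"
  by (simp add: b_act)

lemma functional_b_act: "functional (\<lambda>f. b x (act f y))"
  unfolding functional_def by simp

lemma b_act_sym: "b y (act f x) = bul (b x (act (star f) y))"
  by (metis b_act b_sym)

definition invariant :: "'v set \<Rightarrow> bool" where
  "invariant S \<longleftrightarrow> subspace S \<and> (\<forall>x\<in>S. u x \<in> S)"

lemma invariant_act: "invariant S \<Longrightarrow> x \<in> S \<Longrightarrow> act f x \<in> S"
  unfolding invariant_def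
  by (induction f) (auto intro: subspace_add subspace_scale subspace_0)

lemma invariant_UNIV: "invariant UNIV"
  unfolding invariant_def by simp

text \<open>The $F[t]$-submodule generated by a set.\<close>

definition mspan :: "'v set \<Rightarrow> 'v set" where
  "mspan X = span {act f x | f x. x \<in> X}"

lemma subspace_mspan: "subspace (mspan X)"
  unfolding mspan_def by simp

lemma act_in_mspan: "x \<in> X \<Longrightarrow> act f x \<in> mspan X"
  unfolding mspan_def by (rule span_base) auto

lemma subset_mspan: "X \<subseteq> mspan X"
  using act_in_mspan[of _ X 1] by auto

lemma mspan_minimal:
  assumes "X \<subseteq> S" "invariant S"
  shows "mspan X \<subseteq> S"
  unfolding mspan_def
proof (rule span_minimal)
  show "{act f x |f x. x \<in> X} \<subseteq> S" using assms invariant_act by auto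
  show "subspace S" using assms(2) invariant_def by simp
qed

lemma mspan_induct:
  assumes "v \<in> mspan X" "subspace {v. P v}" "\<And>f x. x \<in> X \<Longrightarrow> P (act f x)"
  shows "P v"
proof -
  have "mspan X \<subseteq> {v. P v}" unfolding mspan_def
    using assms(2,3) by (intro span_minimal) auto
  then show ?thesis using assms(1) by auto
qed

lemma invariant_mspan: "invariant (mspan X)"
  unfolding invariant_def
proof (intro conjI ballI subspace_mspan)
  fix v assume "v \<in> mspan X"
  then show "u v \<in> mspan X"
  proof (rule mspan_induct)
    show "subspace {v. u v \<in> mspan X}"
      using subspace_mspan[of X] unfolding subspace_def by simp
    show "u (act f x) \<in> mspan X" if "x \<in> X" for f x
      using act_in_mspan[OF that, of "monom 1 1 * f"] unfolding act_mult act_X .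
  qed
qed

lemma mspan_mono: "X \<subseteq> Y \<Longrightarrow> mspan X \<subseteq> mspan Y"
  by (meson invariant_mspan mspan_minimal order_trans subset_mspan)

lemma mspan_singleton: "mspan {x} = range (\<lambda>f. act f x)"
proof
  have "invariant (range (\<lambda>f. act f x))"
    unfolding invariant_def
  proof
    show "subspace (range (\<lambda>f. act f x))"
    proof (rule subspaceI)
      show "0 \<in> range (\<lambda>f. act f x)" by (rule image_eqI[of _ _ 0]) auto
      show "v + w \<in> range (\<lambda>f. act f x)" if "v \<in> range (\<lambda>f. act f x)" "w \<in> range (\<lambda>f. act f x)" for v w
        using that by (auto simp: act_add[symmetric] simp del: act_add)
      show "scale c v \<in> range (\<lambda>f. act f x)" if "v \<in> range (\<lambda>f. act f x)" for c v
        using that by (auto simp: act_smult[symmetric] simp del: act_smult)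
    qed
    show "\<forall>v\<in>range (\<lambda>f. act f x). u v \<in> range (\<lambda>f. act f x)"
      by (auto simp: act_X[symmetric] act_mult[symmetric])
  qed
  moreover have "x \<in> range (\<lambda>f. act f x)" by (rule image_eqI[of _ _ 1]) auto
  ultimately show "mspan {x} \<subseteq> range (\<lambda>f. act f x)" by (intro mspan_minimal) auto
qed (auto intro: act_in_mspan)

lemma ex_annihilator_vector: "\<exists>m. m \<noteq> 0 \<and> act m x = 0"
proof (cases "inj_on (\<lambda>i. (u ^^ i) x) {..dimension}")
  case False
  then obtain i j where ij: "i \<noteq> j" "(u ^^ i) x = (u ^^ j) x" unfolding inj_on_def by blast
  have a: "act (monom 1 i) x = (u ^^ i) x" for i
    by (induction i) (auto simp: monom_Suc monom_0)
  have "coeff (monom (1::'f) i - monom 1 j) i = 1" using ij by simp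
  then have "monom (1::'f) i - monom 1 j \<noteq> 0" by (metis coeff_0 zero_neq_one)
  moreover have "act (monom 1 i - monom 1 j) x = 0" unfolding act_diff a ij by simp
  ultimately show ?thesis by blast
next
  case True
  define T where "T = (\<lambda>i. (u ^^ i) x) ` {..dimension}"
  have fT: "finite T" "card T = Suc dimension" unfolding T_def by (auto simp: card_image True)
  have "dependent T"
  proof (rule ccontr)
    assume "\<not> dependent T"
    then have "card T \<le> dim (UNIV::'v set)" by (intro independent_card_le_dim) auto
    then show False using fT by (simp add: dimension_def)
  qed
  then obtain c where c: "\<exists>v\<in>T. c v \<noteq> 0" "(\<Sum>v\<in>T. scale (c v) v) = 0"
    unfolding dependent_finite[OF fT(1)] by blast
  define m where "m = (\<Sum>i\<le>dimension. monom (c ((u ^^ i) x)) i)"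
  have cm: "coeff m i = (if i \<le> dimension then c ((u ^^ i) x) else 0)" for i
    unfolding m_def coeff_sum by (simp add: coeff_monom)
  have "m \<noteq> 0"
  proof
    assume "m = 0"
    then have "c ((u ^^ i) x) = 0" if "i \<le> dimension" for i using cm[of i] that by simp
    then show False using c(1) unfolding T_def by auto
  qed
  moreover have "act m x = 0"
  proof -
    have "degree m \<le> dimension" by (rule degree_le) (simp add: cm)
    then have "act m x = (\<Sum>i\<le>dimension. scale (c ((u ^^ i) x)) ((u ^^ i) x))"
      by (simp add: act_bound cm)
    also have "\<dots> = (\<Sum>v\<in>T. scale (c v) v)" unfolding T_def by (simp add: sum.reindex True)
    finally show ?thesis using c by simp
  qed
  ultimately show ?thesis by blast
qed

lemma ex_annihilator: "\<exists>m. m \<noteq> 0 \<and> (\<forall>x. act m x = 0)"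
proof -
  obtain m where m: "\<And>x. m x \<noteq> 0 \<and> act (m x) x = 0" using ex_annihilator_vector by metis
  let ?m = "\<Prod>v\<in>Basis. m v"
  have "?m \<noteq> 0" using m finite_Basis by simp
  moreover have "act ?m x = 0" for x
  proof -
    have "x \<in> span Basis" using span_Basis by simp
    then show ?thesis
    proof (induction x rule: span_induct_alt)
      case base
      then show ?case by simp
    next
      case (step c v y)
      have "?m = (\<Prod>w\<in>Basis - {v}. m w) * m v"
        using prod.remove[OF finite_Basis step(1)] by (simp add: mult.commute)
      then have "act ?m v = 0" using m[of v] by (simp add: act_mult)
      then show ?case using step by simp
    qed
  qed
  ultimately show ?thesis by blast
qed

lemma act_coprime_torsion:
  assumes "irreducible p" "\<not> p dvd a" "act (p ^ r) x = 0" "act a x = 0"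
  shows "x = 0"
proof -
  obtain s k where "s * a - 1 = p ^ r * k"
    using poly_inverse_mod_prime_power[OF assms(1,2), of r] unfolding dvd_def by blast
  then have "1 = s * a - k * p ^ r" by (simp add: algebra_simps)
  then have "act 1 x = act (s * a - k * p ^ r) x" by (rule arg_cong)
  also have "\<dots> = 0" unfolding act_diff act_mult assms(3,4) by simp
  finally show ?thesis by simp
qed

text \<open>Some nonzero polynomial $p^K c$, with $c$ prime to $p$, annihilates $V$. A multiple of $c$ that is congruent to 1
  modulo a high power of $p$ acts as the projection onto the $p$-primary component. The exponent $N$ stays
  free, because the conjugate of such a projector is needed on torsion for the conjugate of $p$, whose
  exponent may differ from $K$.\<close>

lemma primary_projection:
  assumes "irreducible p"
  shows "\<exists>K. (\<forall>N. \<exists>e. p ^ N dvd e - 1 \<and> (\<forall>x. act (p ^ K) (act e x) = 0)) \<and>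
    (\<forall>r x. act (p ^ r) x = 0 \<longrightarrow> act (p ^ K) x = 0)"
proof -
  obtain m where m: "m \<noteq> 0" "\<And>x. act m x = 0" using ex_annihilator by blast
  obtain K c where c: "m = p ^ K * c" "\<not> p dvd c" using factor_out_irreducible[OF assms m(1)] by blast
  have "act (p ^ K) x = 0" if "act (p ^ r) x = 0" for r x
  proof (rule act_coprime_torsion[OF assms c(2)])
    show "act (p ^ r) (act (p ^ K) x) = 0" using that by (simp add: act_commute[of "p ^ r"])
    show "act c (act (p ^ K) x) = 0" using m(2)[of x] unfolding c(1) by (simp add: act_mult act_commute)
  qed
  moreover have "\<exists>e. p ^ N dvd e - 1 \<and> (\<forall>x. act (p ^ K) (act e x) = 0)" for N
  proof -
    obtain s where s: "p ^ N dvd s * c - 1"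
      using poly_inverse_mod_prime_power[OF assms c(2)] by blast
    have "act (p ^ K) (act (s * c) x) = 0" for x
    proof -
      have "act (p ^ K) (act (s * c) x) = act s (act m x)"
        unfolding c(1) act_mult[symmetric] by (simp add: mult_ac)
      then show ?thesis by (simp add: m)
    qed
    then show ?thesis using s by blast
  qed
  ultimately show ?thesis by blast
qed

lemma act_cong_torsion:
  assumes "q dvd e - 1" "act q x = 0"
  shows "act e x = x"
proof -
  obtain k where "e - 1 = k * q" using assms(1) unfolding dvd_def by (auto simp: mult.commute)
  then have "act (e - 1) x = 0" using assms(2) by (simp add: act_mult)
  then show ?thesis unfolding act_diff by simp
qed

text \<open>A polynomial of least degree that kills some nonzero vector of $S$ is irreducible.\<close>

lemma ex_irreducible_torsion:
  assumes "invariant S" "x \<in> S" "x \<noteq> 0"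
  shows "\<exists>p\<in>Irr. \<exists>x\<in>S. x \<noteq> 0 \<and> act p x = 0"
proof -
  let ?P = "\<lambda>m. m \<noteq> 0 \<and> (\<exists>x\<in>S. x \<noteq> 0 \<and> act m x = 0)"
  have "\<exists>m. ?P m" using ex_annihilator assms by blast
  then obtain m0 where "?P m0" ..
  from ex_has_least_nat[of ?P, OF this, of degree]
  obtain m where m: "?P m" and le: "\<forall>m'. ?P m' \<longrightarrow> degree m \<le> degree m'" by blast
  have min: "\<not> ?P m'" if "degree m' < degree m" for m'
    using le that by (meson leD)
  obtain x where x: "x \<in> S" "x \<noteq> 0" "act m x = 0" using m by blast
  have "irreducible m"
  proof (rule irreducibleI)
    show "m \<noteq> 0" using m by blast
    show "\<not> is_unit m"
    proof
      assume "is_unit m"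
      then obtain k where "1 = m * k" unfolding dvd_def by blast
      then have "act 1 x = act (k * m) x" by (simp add: mult.commute)
      then show False using x by (simp add: act_mult)
    qed
    fix a c assume ac: "m = a * c"
    show "is_unit a \<or> is_unit c"
    proof (rule ccontr)
      assume "\<not> (is_unit a \<or> is_unit c)"
      moreover have "a \<noteq> 0" "c \<noteq> 0" using ac m by auto
      ultimately have "degree a > 0" "degree c > 0" by (simp_all add: is_unit_iff_degree)
      then have "degree a < degree m" "degree c < degree m"
        unfolding ac by (simp_all add: degree_mult_eq \<open>a \<noteq> 0\<close> \<open>c \<noteq> 0\<close>)
      then have "\<not> ?P a" "\<not> ?P c" using min by blast+
      moreover have "act a (act c x) = 0" using x unfolding ac act_mult by simp
      ultimately show False using x \<open>a \<noteq> 0\<close> \<open>c \<noteq> 0\<close> invariant_act[OF assms(1)] by blast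
    qed
  qed
  define p where "p = psm (inverse (lead_coeff m)) m"
  have lc: "lead_coeff m \<noteq> 0" using m by simp
  have "is_unit [:inverse (lead_coeff m):]" using lc by (simp add: is_unit_iff_degree)
  then have "irreducible ([:inverse (lead_coeff m):] * m)"
    using \<open>irreducible m\<close> irreducible_mult_unit_left by blast
  then have "p \<in> Irr" unfolding Irr_def p_def using lc by simp
  moreover have "act p x = 0" using x unfolding p_def by simp
  ultimately show ?thesis using x by blast
qed

lemma ex_max_exponent:
  assumes "irreducible p" "x \<in> S" "x \<noteq> 0" "act p x = 0"
  shows "\<exists>r\<ge>1. (\<exists>x\<in>S. act (p ^ r) x = 0 \<and> act (p ^ (r - 1)) x \<noteq> 0) \<and>
    (\<forall>k. \<forall>x\<in>S. act (p ^ k) x = 0 \<longrightarrow> act (p ^ r) x = 0)"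
proof -
  obtain K e where K: "\<And>r x. act (p ^ r) x = 0 \<Longrightarrow> act (p ^ K) x = 0"
    using primary_projection[OF assms(1)] by blast
  let ?P = "\<lambda>r. \<forall>k. \<forall>x\<in>S. act (p ^ k) x = 0 \<longrightarrow> act (p ^ r) x = 0"
  define r where "r = (LEAST r. ?P r)"
  have P: "?P r" unfolding r_def using LeastI[of ?P K] K by blast
  have "r \<noteq> 0"
  proof
    assume "r = 0"
    then have "act (p ^ 0) x = 0" using P assms by (metis power_one_right)
    then show False using assms by simp
  qed
  then have "\<not> ?P (r - 1)" using not_less_Least[of "r - 1" ?P] unfolding r_def[symmetric] by simp
  then show ?thesis using P \<open>r \<noteq> 0\<close> by (intro exI[of _ r]) auto
qed

section \<open>Orthogonal splittings\<close>

definition regular :: "'v set \<Rightarrow> bool" where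
  "regular S \<longleftrightarrow> (\<forall>x\<in>S. (\<forall>y\<in>S. b x y = 0) \<longrightarrow> x = 0)"

definition even_isotropic :: "'v set \<Rightarrow> bool" where
  "even_isotropic X \<longleftrightarrow> (\<forall>x\<in>X. \<forall>y\<in>X. \<forall>f. pderiv f = 0 \<longrightarrow> b x (act f y) = 0)"

text \<open>The condition that $n_{p,r} = 0$ for odd $r$ and $p$ not even, in terms of vectors: a vector of
  $ker p(u)^r$ is zero in $V_{p,r}$ iff $p(u)^{r-1}$ maps it into the image of $p(u)^r$.\<close>

definition no_odd_invariants :: "'v set \<Rightarrow> bool" where
  "no_odd_invariants S \<longleftrightarrow> (\<forall>p\<in>Irr - Irr0. \<forall>r. odd r \<longrightarrow>
     (\<forall>x\<in>S. act (p ^ r) x = 0 \<longrightarrow> (\<exists>z\<in>S. act (p ^ (r - 1)) x = act (p ^ r) z)))"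

text \<open>Lifts to $S$ of a generating family of $V_{p,r}$ that is orthogonal for the Hermitian invariant and
  has odd values on the diagonal. Dependent families and zero vectors are allowed, so
  that projecting a frame to an orthogonal complement yields a frame again.\<close>

definition odd_frame :: "'f poly \<Rightarrow> nat \<Rightarrow> 'v set \<Rightarrow> 'v set \<Rightarrow> bool" where
  "odd_frame p r S E \<longleftrightarrow> finite E \<and> E \<subseteq> S \<and> (\<forall>x\<in>E. act (p ^ r) x = 0) \<and>
     (\<forall>x\<in>E. \<forall>y\<in>E. x \<noteq> y \<longrightarrow> (\<forall>f. b x (act (p ^ (r - 1) * f) y) = 0)) \<and>
     (\<forall>x\<in>E. \<forall>f. pderiv f = 0 \<longrightarrow> b x (act (p ^ (r - 1) * f) x) = 0) \<and>
     (\<forall>v\<in>S. act (p ^ r) v = 0 \<longrightarrow>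
        (\<exists>w\<in>mspan E. \<exists>z\<in>S. act (p ^ (r - 1)) (v - w) = act (p ^ r) z))"

definition odd_framed :: "'v set \<Rightarrow> bool" where
  "odd_framed S \<longleftrightarrow> (\<forall>p\<in>Irr0 \<inter> fixed_polys bul. \<forall>r\<ge>1. \<exists>E. odd_frame p r S E)"

definition perp :: "'v set \<Rightarrow> 'v set \<Rightarrow> 'v set" where
  "perp S W = {v\<in>S. \<forall>w\<in>W. b w v = 0}"

lemma subspace_modulo:
  assumes A: "subspace A" and C: "subspace C"
    and g: "\<And>x y. g (x + y) = g x + g y" "\<And>c x. g (scale c x) = scale c (g x)"
  shows "subspace {v. \<exists>s\<in>A. v - g s \<in> C}"
proof (rule subspaceI)
  have "g 0 = 0" using g(2)[of 0 0] by simp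
  then have "0 - g 0 \<in> C" using subspace_0[OF C] by simp
  then show "0 \<in> {v. \<exists>s\<in>A. v - g s \<in> C}" using subspace_0[OF A] by blast
  fix v w c assume "v \<in> {v. \<exists>s\<in>A. v - g s \<in> C}"
  then obtain s where s: "s \<in> A" "v - g s \<in> C" by blast
  have "scale c v - g (scale c s) \<in> C"
    using subspace_scale[OF C s(2)] by (simp only: g scale_right_diff_distrib)
  then show "scale c v \<in> {v. \<exists>s\<in>A. v - g s \<in> C}" using subspace_scale[OF A s(1)] by blast
  assume "w \<in> {v. \<exists>s\<in>A. v - g s \<in> C}"
  then obtain s' where s': "s' \<in> A" "w - g s' \<in> C" by blast
  have "v + w - g (s + s') \<in> C"
    using subspace_add[OF C s(2) s'(2)] by (simp only: g add_diff_add)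
  then show "v + w \<in> {v. \<exists>s\<in>A. v - g s \<in> C}" using subspace_add[OF A s(1) s'(1)] by blast
qed

lemma dim_less:
  assumes "subspace A" "subspace C" "A \<subset> C"
  shows "dim A < dim C"
proof -
  have "span A = A" "span C = C" using assms(1,2) by (simp_all only: span_eq_iff)
  then have "span A \<subset> span C" using assms(3) by (simp only:)
  then show ?thesis by (rule dim_psubset)
qed

lemma invariant_perp:
  assumes "invariant S" "invariant W"
  shows "invariant (perp S W)"
  using assms unfolding invariant_def perp_def subspace_def
  by (auto simp: b_u[symmetric])

lemma b_eq_0_sym: "b x y = 0 \<Longrightarrow> b y x = 0"
  by (simp add: b_sym_0)

lemma regularD:
  assumes "regular S" "x \<in> S" "\<And>y. y \<in> S \<Longrightarrow> b y x = 0"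
  shows "x = 0"
  using assms(1,2) b_eq_0_sym[OF assms(3)] unfolding regular_def by simp

lemma perpD: "s \<in> perp S W \<Longrightarrow> w \<in> W \<Longrightarrow> b w s = 0" "s \<in> perp S W \<Longrightarrow> s \<in> S"
  unfolding perp_def by auto

lemma act_b_perp:
  assumes "invariant W" "w \<in> W" "s \<in> perp S W"
  shows "b w (act f s) = 0" "b s (act f w) = 0"
proof -
  show "b s (act f w) = 0"
    by (rule b_eq_0_sym, rule perpD(1)[OF assms(3) invariant_act[OF assms(1,2)]])
  show "b w (act f s) = 0"
    unfolding b_act' by (rule perpD(1)[OF assms(3) invariant_act[OF assms(1,2)]])
qed

lemma regular_splitting:
  assumes "invariant S" "invariant W" "W \<subseteq> S" "regular S"
    and split: "\<And>v. v \<in> S \<Longrightarrow> \<exists>w\<in>W. v - w \<in> perp S W"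
  shows "regular W" "regular (perp S W)" "W \<inter> perp S W = {0}"
proof -
  have *: "x = 0" if x: "x \<in> S" and W: "\<And>w. w \<in> W \<Longrightarrow> b w x = 0" and P: "\<And>s. s \<in> perp S W \<Longrightarrow> b s x = 0" for x
  proof (rule regularD[OF assms(4) x])
    fix v assume "v \<in> S"
    then obtain w where w: "w \<in> W" "v - w \<in> perp S W" using split by blast
    then show "b v x = 0" using W[OF w(1)] P[OF w(2)] by simp
  qed
  show rW: "regular W"
    unfolding regular_def
  proof (intro ballI impI)
    fix x assume x: "x \<in> W" "\<forall>y\<in>W. b x y = 0"
    show "x = 0"
    proof (rule *)
      show "b w x = 0" if "w \<in> W" for w using x(2) that by (simp add: b_eq_0_sym)
      show "b s x = 0" if "s \<in> perp S W" for s using perpD(1)[OF that x(1)] by (rule b_eq_0_sym)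
    qed (use x assms(3) in auto)
  qed
  show "regular (perp S W)"
    unfolding regular_def
  proof (intro ballI impI)
    fix x assume x: "x \<in> perp S W" "\<forall>y\<in>perp S W. b x y = 0"
    show "x = 0"
    proof (rule *)
      show "x \<in> S" using perpD(2)[OF x(1)] .
      show "b w x = 0" if "w \<in> W" for w using perpD(1)[OF x(1) that] .
      show "b s x = 0" if "s \<in> perp S W" for s using x(2) that by (simp add: b_eq_0_sym)
    qed
  qed
  have "x = 0" if "x \<in> W" "x \<in> perp S W" for x
    using regularD[OF rW that(1) perpD(1)[OF that(2)]] .
  moreover have "0 \<in> W" "0 \<in> perp S W"
    using assms(1,2) invariant_perp[OF assms(1,2)] by (auto simp: invariant_def subspace_0)
  ultimately show "W \<inter> perp S W = {0}" by blast
qed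

lemma split_zero:
  assumes "invariant S" "invariant W" "W \<inter> perp S W = {0}"
    and "w \<in> W" "s \<in> perp S W" "w + s = 0"
  shows "w = 0" "s = 0"
proof -
  have "s = - w" using assms(6) by (simp add: eq_neg_iff_add_eq_0 add.commute del: vec_uminus)
  then have "s = w" by simp
  then show "w = 0" "s = 0" using assms by auto
qed

lemma no_odd_invariants_perp:
  assumes "invariant S" "invariant W" "W \<inter> perp S W = {0}"
    and split: "\<And>v. v \<in> S \<Longrightarrow> \<exists>w\<in>W. v - w \<in> perp S W"
    and "no_odd_invariants S"
  shows "no_odd_invariants (perp S W)"
  unfolding no_odd_invariants_def
proof (intro ballI allI impI)
  fix p r x assume p: "p \<in> Irr - Irr0" "odd r" and x: "x \<in> perp S W" "act (p ^ r) x = 0"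
  have "x \<in> S" using x(1) unfolding perp_def by blast
  then obtain z where z: "z \<in> S" "act (p ^ (r - 1)) x = act (p ^ r) z"
    using assms(5) p x(2) unfolding no_odd_invariants_def by blast
  obtain w where w: "w \<in> W" "z - w \<in> perp S W" using split[OF z(1)] by blast
  note ip = invariant_perp[OF assms(1,2)]
  have m: "act (p ^ r) w \<in> W" "act (p ^ (r - 1)) x - act (p ^ r) (z - w) \<in> perp S W"
    using invariant_act[OF assms(2) w(1)] invariant_act[OF ip x(1)] invariant_act[OF ip w(2)] ip
    unfolding invariant_def by (auto intro: subspace_diff simp del: act_vdiff)
  have "act (p ^ r) w + (act (p ^ (r - 1)) x - act (p ^ r) (z - w)) = 0"
    unfolding z(2) act_vdiff by (simp only: diff_diff_eq2 add_diff_cancel_left' vec_double)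
  from split_zero(2)[OF assms(1-3) m this] have "act (p ^ (r - 1)) x = act (p ^ r) (z - w)" by simp
  then show "\<exists>z\<in>perp S W. act (p ^ (r - 1)) x = act (p ^ r) z" using w(2) by blast
qed

text \<open>The projection along $W$ maps a frame of $S$ to a frame of the complement, provided that the
  components in $W$ of the frame vectors contribute nothing to the form. Frame vectors
  that lie in $W$ are exempt, because they project to zero.\<close>

lemma odd_frame_perp:
  assumes "invariant S" "invariant W" "W \<inter> perp S W = {0}"
    and split: "\<And>v. v \<in> S \<Longrightarrow> \<exists>w\<in>W. v - w \<in> perp S W"
    and E: "odd_frame p r S E"
    and compat: "\<And>x y w w'. \<lbrakk>x \<in> E; y \<in> E; w \<in> W; w' \<in> W; x - w \<in> perp S W; y - w' \<in> perp S W;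
        x \<noteq> w; y \<noteq> w'\<rbrakk> \<Longrightarrow> \<forall>f. b w (act (p ^ (r - 1) * f) w') = 0"
  shows "\<exists>E'. odd_frame p r (perp S W) E'"
proof -
  note ip = invariant_perp[OF assms(1,2)]
  obtain \<pi> where \<pi>: "\<And>v. v \<in> S \<Longrightarrow> \<pi> v \<in> perp S W" "\<And>v. v \<in> S \<Longrightarrow> v - \<pi> v \<in> W"
  proof -
    have "\<forall>v\<in>S. \<exists>s. s \<in> perp S W \<and> v - s \<in> W"
    proof
      fix v assume "v \<in> S"
      then obtain w where "w \<in> W" "v - w \<in> perp S W" using split by blast
      then show "\<exists>s. s \<in> perp S W \<and> v - s \<in> W" by (intro exI[of _ "v - w"]) (simp only: diff_diff_eq2 add_diff_cancel_left' simp_thms)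
    qed
    from bchoice[OF this] obtain g where "\<forall>v\<in>S. g v \<in> perp S W \<and> v - g v \<in> W" ..
    then show ?thesis using that[of g] by blast
  qed
  have ES: "E \<subseteq> S" and Ek: "\<And>x. x \<in> E \<Longrightarrow> act (p ^ r) x = 0" using E unfolding odd_frame_def by auto
  have b\<pi>: "b (\<pi> x) (act g (\<pi> y)) = b x (act g y) - b (x - \<pi> x) (act g (y - \<pi> y))" if "x \<in> S" "y \<in> S" for x y g
  proof -
    have "b (x - \<pi> x) (act g (\<pi> y)) = 0" "b (\<pi> x) (act g (y - \<pi> y)) = 0"
      using act_b_perp[OF assms(2) \<pi>(2) \<pi>(1)] that by blast+
    then show ?thesis by simp
  qed
  have c\<pi>: "b (x - \<pi> x) (act (p ^ (r - 1) * f) (y - \<pi> y)) = 0"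
    if "x \<in> E" "y \<in> E" "\<pi> x \<noteq> 0" "\<pi> y \<noteq> 0" for x y f
  proof -
    have e: "z - (z - \<pi> z) = \<pi> z" for z by (simp only: diff_diff_eq2 add_diff_cancel_left')
    have n: "z \<noteq> z - \<pi> z" if "\<pi> z \<noteq> 0" for z
    proof
      assume "z = z - \<pi> z"
      then have "z - (z - \<pi> z) = 0" by (simp only: right_minus_eq)
      then show False using that unfolding e by simp
    qed
    have S: "x \<in> S" "y \<in> S" using that ES by auto
    have "\<forall>f. b (x - \<pi> x) (act (p ^ (r - 1) * f) (y - \<pi> y)) = 0"
      using \<pi>(1)[OF S(1)] \<pi>(1)[OF S(2)]
      by (intro compat[OF that(1,2) \<pi>(2)[OF S(1)] \<pi>(2)[OF S(2)] _ _ n[OF that(3)] n[OF that(4)]]) (simp_all only: e)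
    then show ?thesis by blast
  qed
  have mspan\<pi>: "\<exists>s\<in>mspan (\<pi> ` E). v - s \<in> W" if "v \<in> mspan E" for v
    using that
  proof (rule mspan_induct)
    show "subspace {v. \<exists>s\<in>mspan (\<pi> ` E). v - s \<in> W}"
      using assms(2) unfolding invariant_def
      by (intro subspace_modulo[where g = "\<lambda>s. s"] subspace_mspan) simp_all
    show "\<exists>s\<in>mspan (\<pi> ` E). act f x - s \<in> W" if "x \<in> E" for f x
    proof
      show "act f (\<pi> x) \<in> mspan (\<pi> ` E)" using that by (intro act_in_mspan) auto
      have "x - \<pi> x \<in> W" using \<pi>(2) that ES by blast
      then show "act f x - act f (\<pi> x) \<in> W" using invariant_act[OF assms(2)] unfolding act_vdiff[symmetric] by blast
    qed
  qed
  have "odd_frame p r (perp S W) (\<pi> ` E)"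
    unfolding odd_frame_def
  proof (intro conjI ballI allI impI)
    show "finite (\<pi> ` E)" using E unfolding odd_frame_def by auto
    show "\<pi> ` E \<subseteq> perp S W" using \<pi>(1) ES by auto
    show "act (p ^ r) y = 0" if "y \<in> \<pi> ` E" for y
    proof -
      obtain x where x: "x \<in> E" "y = \<pi> x" using \<open>y \<in> \<pi> ` E\<close> by blast
      have xS: "x \<in> S" using x(1) ES by blast
      have "act (p ^ r) (x - \<pi> x) + act (p ^ r) (\<pi> x) = 0"
        using Ek[OF x(1)] by (simp only: act_vadd[symmetric] diff_add_cancel)
      then show "act (p ^ r) y = 0"
        using split_zero(2)[OF assms(1-3) invariant_act[OF assms(2) \<pi>(2)[OF xS]] invariant_act[OF ip \<pi>(1)[OF xS]]] x(2)
        by blast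
    qed
    show "b x' (act (p ^ (r - 1) * f) y') = 0" if xy: "x' \<in> \<pi> ` E" "y' \<in> \<pi> ` E" "x' \<noteq> y'" for x' y' f
    proof -
      obtain x y where x: "x \<in> E" "x' = \<pi> x" and y: "y \<in> E" "y' = \<pi> y" using xy by blast
      have "x \<noteq> y" using x y \<open>x' \<noteq> y'\<close> by blast
      then have 0: "b x (act (p ^ (r - 1) * f) y) = 0" using E x y unfolding odd_frame_def by blast
      show ?thesis
      proof (cases "\<pi> x = 0 \<or> \<pi> y = 0")
        case True
        then show ?thesis using x y by auto
      next
        case False
        then have c: "b (x - \<pi> x) (act (p ^ (r - 1) * f) (y - \<pi> y)) = 0" using c\<pi>[OF x(1) y(1)] by blast
        have S: "x \<in> S" "y \<in> S" using x y ES by auto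
        show ?thesis unfolding x y b\<pi>[OF S] 0 c by simp
      qed
    qed
    show "b x' (act (p ^ (r - 1) * f) x') = 0" if xx: "x' \<in> \<pi> ` E" "pderiv f = 0" for x' f
    proof -
      obtain x where x: "x \<in> E" "x' = \<pi> x" using xx by blast
      have 0: "b x (act (p ^ (r - 1) * f) x) = 0" using E x xx(2) unfolding odd_frame_def by blast
      show ?thesis
      proof (cases "\<pi> x = 0")
        case False
        have S: "x \<in> S" using x ES by auto
        show ?thesis unfolding x b\<pi>[OF S S] 0 c\<pi>[OF x(1) x(1) False False] by simp
      qed (use x in simp)
    qed
    fix v assume v: "v \<in> perp S W" "act (p ^ r) v = 0"
    have "v \<in> S" using v(1) unfolding perp_def by blast
    then obtain w z where w: "w \<in> mspan E" and z: "z \<in> S" "act (p ^ (r - 1)) (v - w) = act (p ^ r) z"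
      using E v(2) unfolding odd_frame_def by blast
    obtain s where s: "s \<in> mspan (\<pi> ` E)" "w - s \<in> W" using mspan\<pi>[OF w] by blast
    have "mspan (\<pi> ` E) \<subseteq> perp S W" using \<pi>(1) ES ip by (intro mspan_minimal) auto
    then have sp: "s \<in> perp S W" using s by blast
    let ?w = "act (p ^ (r - 1)) (w - s) + act (p ^ r) (z - \<pi> z)"
    let ?s = "act (p ^ (r - 1)) (v - s) - act (p ^ r) (\<pi> z)"
    have "?w \<in> W" using invariant_act[OF assms(2) s(2)] invariant_act[OF assms(2) \<pi>(2)[OF z(1)]] assms(2)
      unfolding invariant_def by (auto intro: subspace_add simp del: act_vdiff)
    moreover have "?s \<in> perp S W"
      using invariant_act[OF ip, of "v - s"] invariant_act[OF ip \<pi>(1)[OF z(1)]] v(1) sp ip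
      unfolding invariant_def by (auto intro!: subspace_diff simp del: act_vdiff)
    moreover have "?w + ?s = 0"
    proof -
      have "?w + ?s = act (p ^ (r - 1)) (v - w) + act (p ^ r) z + (act (p ^ (r - 1)) s + act (p ^ (r - 1)) s)
            + (act (p ^ r) (\<pi> z) + act (p ^ r) (\<pi> z))"
        unfolding vec_diff act_vadd by (simp add: ac_simps)
      also have "\<dots> = 0" unfolding z(2) by (simp only: vec_double add_0)
      finally show ?thesis .
    qed
    ultimately have "?s = 0" using split_zero(2)[OF assms(1-3)] by blast
    then have "act (p ^ (r - 1)) (v - s) = act (p ^ r) (\<pi> z)" by (simp only: right_minus_eq)
    then show "\<exists>w\<in>mspan (\<pi> ` E). \<exists>z\<in>perp S W. act (p ^ (r - 1)) (v - w) = act (p ^ r) z"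
      using s(1) \<pi>(1)[OF z(1)] by blast
  qed
  then show ?thesis by blast
qed

section \<open>Dual torsion vectors and cyclic pieces\<close>

lemma act_mult_torsion: "act a x = 0 \<Longrightarrow> act (a * f) x = 0" "act a x = 0 \<Longrightarrow> act a (act f x) = 0"
  by (simp_all add: act_mult' act_commute[of a])

text \<open>Torsion vectors can pair nontrivially only if their primes are conjugate.\<close>

lemma torsion_orthogonal:
  assumes "irreducible p" "\<not> p dvd star a" "act (p ^ r) x = 0" "act a z = 0"
  shows "b x z = 0"
proof -
  obtain s where s: "p ^ r dvd s * star a - 1"
    using poly_inverse_mod_prime_power[OF assms(1,2)] by blast
  have "act (star a * s) x = x" using act_cong_torsion[OF s assms(3)] by (simp add: mult.commute)
  then have "b x z = b (act (star a * s) x) z" by simp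
  also have "\<dots> = b (act s x) (act a z)" unfolding act_mult b_act[of "star a"] star_star ..
  finally show ?thesis using assms(4) by simp
qed

lemma self_torsion_orthogonal:
  assumes p: "irreducible p" "\<not> p dvd star p" and x: "act (p ^ r) x = 0"
  shows "b (act f x) (act g x) = 0"
proof (rule torsion_orthogonal[OF p(1), of "p ^ r" r])
  show "\<not> p dvd star (p ^ r)" using irreducible_dvd_power[OF p(1)] p(2) by auto
qed (use x in \<open>simp_all add: act_commute[of "p ^ r"]\<close>)

text \<open>A vector that pairs nontrivially with $p^{r-1}x$ may be replaced by its component for the conjugate prime.
  Maximality of $r$ bounds the order of this component: $p(u)^r$ kills everything that can pair with it.\<close>

lemma ex_dual_vector:
  assumes p: "irreducible p" and S: "invariant S" "regular S"
    and max: "\<forall>k. \<forall>x\<in>S. act (p ^ k) x = 0 \<longrightarrow> act (p ^ r) x = 0"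
    and x: "x \<in> S" "act (p ^ r) x = 0" "act (p ^ (r - 1)) x \<noteq> 0"
  shows "\<exists>y\<in>S. act (star p ^ r) y = 0 \<and> b y (act (p ^ (r - 1)) x) \<noteq> 0"
proof -
  let ?x = "act (p ^ (r - 1)) x"
  have "?x \<in> S" using invariant_act[OF S(1) x(1)] .
  then obtain v where v: "v \<in> S" "b v ?x \<noteq> 0" using regularD[OF S(2), of ?x] x(3) by blast
  obtain K where K: "\<And>N. \<exists>e. star p ^ N dvd e - 1 \<and> (\<forall>x. act (star p ^ K) (act e x) = 0)"
    using primary_projection[OF irreducible_star[OF p]] by blast
  obtain K' where K': "\<And>N. \<exists>e. p ^ N dvd e - 1 \<and> (\<forall>x. act (p ^ K') (act e x) = 0)"
    using primary_projection[OF p] by blast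
  \<comment> \<open>The first polynomial projects to the component for the conjugate prime, and its conjugate fixes $x$; the
    second one projects to the component for $p$.\<close>
  obtain e where e: "star p ^ r dvd e - 1" "\<And>x. act (star p ^ K) (act e x) = 0" using K by blast
  obtain e' where e': "p ^ K dvd e' - 1" "\<And>x. act (p ^ K') (act e' x) = 0" using K' by blast
  define y where "y = act e v"
  have yS: "y \<in> S" unfolding y_def by (rule invariant_act[OF S(1) v(1)])
  have "b y ?x = b v ?x"
  proof -
    have "p ^ r dvd star e - 1" using e(1) star_dvd_star[of "star p ^ r" "e - 1"] by simp
    moreover have "act (p ^ r) ?x = 0" using x(2) by (simp add: act_commute[of "p ^ r"])
    ultimately have "act (star e) ?x = ?x" by (rule act_cong_torsion)
    then show ?thesis unfolding y_def b_act by simp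
  qed
  moreover have "act (star p ^ r) y = 0"
  proof (rule regularD[OF S(2)])
    show "act (star p ^ r) y \<in> S" using invariant_act[OF S(1) yS] .
    fix s assume s: "s \<in> S"
    obtain k where k: "e' - 1 = p ^ K * k" using e'(1) unfolding dvd_def by blast
    have "b (act (star p ^ r) y) (act (e' - 1) s) = b (act (star p ^ K) (act (star p ^ r) y)) (act k s)"
      unfolding k act_mult b_act[of "star p ^ K"] by simp
    also have "act (star p ^ K) (act (star p ^ r) y) = 0"
      unfolding y_def by (subst act_commute) (simp add: e(2))
    finally have "b (act (star p ^ r) y) s = b (act (star p ^ r) y) (act e' s)" by simp
    also have "\<dots> = b y (act (p ^ r) (act e' s))" unfolding b_act by simp
    also have "act (p ^ r) (act e' s) = 0"
      using max invariant_act[OF S(1) s] e'(2) by blast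
    finally show "b s (act (star p ^ r) y) = 0" by (simp add: b_eq_0_sym)
  qed
  ultimately show ?thesis using yS v by auto
qed

text \<open>The submodules generated by $x$ and $y$ are in perfect duality. This yields orthogonal projections, and
  vectors with prescribed pairings.\<close>

lemma dual_representation:
  assumes p: "irreducible p" and x: "act (p ^ r) x = 0" and ne: "b y (act (p ^ (r - 1) * f0) x) \<noteq> 0"
    and \<psi>: "functional \<psi>" "\<And>f. \<psi> (p ^ r * f) = 0"
  shows "\<exists>h. \<forall>f. b (act h y) (act f x) = \<psi> f"
proof -
  have 0: "act (p ^ r * f) x = 0" for f using x by (simp add: act_mult_torsion)
  have "\<exists>h. \<forall>f. b y (act (h * f) x) = \<psi> f"
    by (rule functional_duality[OF p functional_b_act _ ne \<psi>]) (simp add: 0)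
  then obtain h where "\<And>f. b y (act (h * f) x) = \<psi> f" by blast
  then have "\<forall>f. b (act (star h) y) (act f x) = \<psi> f"
    unfolding b_act star_star act_mult by blast
  then show ?thesis by blast
qed

lemma mspan_perpI:
  assumes "\<And>x f. x \<in> X \<Longrightarrow> b v (act f x) = 0" "v \<in> S"
  shows "v \<in> perp S (mspan X)"
proof -
  have "b v w = 0" if "w \<in> mspan X" for w
    using that
  proof (rule mspan_induct)
    show "subspace {w. b v w = 0}" by (rule subspaceI) auto
  qed (use assms in auto)
  then show ?thesis using assms(2) unfolding perp_def by (simp add: b_eq_0_sym)
qed

lemma cyclic_split:
  assumes p: "irreducible p" and S: "invariant S"
    and x: "x \<in> S" "act (p ^ r) x = 0" "b x (act (p ^ (r - 1) * f0) x) \<noteq> 0"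
    and v: "v \<in> S"
  shows "\<exists>w\<in>mspan {x}. v - w \<in> perp S (mspan {x})"
proof -
  have "b v (act (p ^ r * f) x) = 0" for f using x(2) by (simp add: act_mult_torsion)
  then obtain h where h: "\<And>f. b (act h x) (act f x) = b v (act f x)"
    using dual_representation[OF p x(2,3) functional_b_act, of v] by blast
  have "v - act h x \<in> perp S (mspan {x})"
    using h invariant_act[OF S x(1)] v S unfolding invariant_def
    by (intro mspan_perpI) (auto intro: subspace_diff)
  then show ?thesis using act_in_mspan[of x "{x}" h] by blast
qed

lemma hyperbolic_split:
  assumes p: "irreducible p" and np: "\<not> p dvd star p" and S: "invariant S"
    and x: "x \<in> S" "act (p ^ r) x = 0" and y: "y \<in> S" "act (star p ^ r) y = 0"
    and ne: "b y (act (p ^ (r - 1) * f0) x) \<noteq> 0"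
    and v: "v \<in> S"
  shows "\<exists>w\<in>mspan {x, y}. v - w \<in> perp S (mspan {x, y})"
proof -
  have ps: "irreducible (star p)" by (rule irreducible_star[OF p])
  have np': "\<not> star p dvd p" using np star_dvd_star[of "star p" p] by simp
  have xx: "b (act f x) (act g x) = 0" for f g by (rule self_torsion_orthogonal[OF p np x(2)])
  have "\<not> star p dvd star (star p)" using np' by simp
  then have yy: "b (act f y) (act g y) = 0" for f g by (rule self_torsion_orthogonal[OF ps _ y(2)])
  have "b v (act (p ^ r * f) x) = 0" for f using x(2) by (simp add: act_mult_torsion)
  then obtain h where h: "\<And>f. b (act h y) (act f x) = b v (act f x)"
    using dual_representation[OF p x(2) ne functional_b_act, of v] by blast
  have "b v (act (star p ^ r * f) y) = 0" for f using y(2) by (simp add: act_mult_torsion)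
  moreover have "b x (act (star p ^ (r - 1) * star f0) y) \<noteq> 0"
    using ne unfolding b_act_sym[of x] by simp
  ultimately obtain k where k: "\<And>f. b (act k x) (act f y) = b v (act f y)"
    using dual_representation[OF ps y(2) _ functional_b_act, of x "star f0" v] by blast
  let ?w = "act h y + act k x"
  have "v - ?w \<in> perp S (mspan {x, y})"
  proof (rule mspan_perpI)
    show "v - ?w \<in> S"
      using invariant_act[OF S x(1)] invariant_act[OF S y(1)] v S unfolding invariant_def
      by (auto intro: subspace_diff subspace_add)
    show "b (v - ?w) (act f z) = 0" if "z \<in> {x, y}" for z f
      using that h k xx yy by auto
  qed
  moreover have "?w \<in> mspan {x, y}"
    by (intro subspace_add[OF subspace_mspan] act_in_mspan) auto
  ultimately show ?thesis by blast
qed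

lemma order_dvd:
  assumes p: "irreducible p" and x: "act (p ^ r) x = 0" "act (p ^ (r - 1)) x \<noteq> 0" and a: "act a x = 0"
  shows "p ^ r dvd a"
proof (cases "a = 0")
  case False
  obtain j c where c: "a = p ^ j * c" "\<not> p dvd c" using factor_out_irreducible[OF p False] by blast
  \<comment> \<open>With a smaller exponent, $c(u)$ would kill $p(u)^{r-1}x$, although $c$ is prime to $p$.\<close>
  have "r \<le> j"
  proof (rule ccontr)
    assume "\<not> r \<le> j"
    then have j: "p ^ (r - 1) = p ^ (r - 1 - j) * p ^ j" by (simp add: power_add[symmetric])
    have "act c (act (p ^ (r - 1)) x) = act (p ^ (r - 1 - j)) (act a x)"
      unfolding j c(1) act_mult[symmetric] by (simp add: mult_ac)
    then have "act c (act (p ^ (r - 1)) x) = 0" using a by simp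
    moreover have "act (p ^ r) (act (p ^ (r - 1)) x) = 0" using x(1) by (simp add: act_commute[of "p ^ r"])
    ultimately show False using act_coprime_torsion[OF p c(2)] x(2) by blast
  qed
  then show ?thesis using c(1) by (simp add: le_imp_power_dvd)
qed simp

text \<open>Replacing $x$ by $g(u)x$ replaces $\<phi>(f) = b(x, f(u)x)$ by $\<phi>(gg^*f)$. The target is
  $\<psi>(f) = \<phi>(kf')$, which vanishes on even polynomials. It equals $\<phi>(hf)$ by duality, the assumption on $k$ forces
  $h$ to be congruent to 1 modulo $p$, and lemma \<open>hensel\<close> solves $h = gg^*$.\<close>

lemma ex_odd_generator:
  assumes p: "irreducible p" "star p = p" and r: "r \<ge> 1" and q: "pderiv (p ^ r) = 0"
    and x: "act (p ^ r) x = 0" "b x (act (p ^ (r - 1) * f0) x) \<noteq> 0"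
    and k: "star k = k" "\<And>f. b x (act (k * pderiv (p ^ (r - 1) * f)) x) = b x (act (p ^ (r - 1) * f) x)"
  shows "\<exists>g. p dvd g - 1 \<and> (\<forall>f. pderiv f = 0 \<longrightarrow> b (act g x) (act f (act g x)) = 0)"
proof -
  define \<phi> where "\<phi> f = b x (act f x)" for f
  define \<psi> where "\<psi> f = \<phi> (k * pderiv f)" for f
  have \<phi>: "functional \<phi>" unfolding \<phi>_def by (rule functional_b_act)
  have \<phi>0: "\<phi> (p ^ r * f) = 0" for f unfolding \<phi>_def using x(1) by (simp add: act_mult_torsion)
  have \<phi>s: "\<phi> (star f) = bul (\<phi> f)" for f unfolding \<phi>_def using b_act_sym[of x "star f" x] by simp
  have \<psi>: "functional \<psi>"
    unfolding functional_def \<psi>_def using functional_add[OF \<phi>] functional_smult[OF \<phi>]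
    by (simp add: pderiv_add pderiv_smult distrib_left)
  have \<psi>0: "\<psi> (p ^ r * f) = 0" for f
  proof -
    have "k * pderiv (p ^ r * f) = p ^ r * (k * pderiv f)" unfolding pderiv_mult q by simp
    then show ?thesis unfolding \<psi>_def by (simp only: \<phi>0)
  qed
  obtain h0 where h0: "\<And>f. \<phi> (h0 * f) = \<psi> f"
    using functional_duality[OF p(1) \<phi> \<phi>0 _ \<psi> \<psi>0] x(2) unfolding \<phi>_def by blast
  obtain e where e: "e + bul e = 1" using ex_trace_one by blast
  \<comment> \<open>Averaging with an element of trace 1 makes the multiplier symmetric without changing the functional.\<close>
  define h where "h = psm e h0 + star (psm e h0)"
  have h: "\<phi> (h * f) = \<psi> f" for f
  proof -
    have "\<psi> (star f) = bul (\<psi> f)"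
      unfolding \<psi>_def using \<phi>s[of "k * pderiv f"] k(1) by simp
    then have "\<phi> (star h0 * f) = \<psi> f"
      using \<phi>s[of "h0 * star f"] h0[of "star f"] by simp
    moreover have "h * f = psm e (h0 * f) + psm (bul e) (star h0 * f)"
      unfolding h_def by (simp add: distrib_right)
    ultimately have "\<phi> (h * f) = (e + bul e) * \<psi> f"
      by (simp only: functional_add[OF \<phi>] functional_smult[OF \<phi>] h0 distrib_right)
    then show ?thesis unfolding e by simp
  qed
  have "p dvd h - 1"
  proof (rule dvd_if_functional_vanishes[where \<phi> = "\<lambda>f. \<phi> (p ^ (r - 1) * f)"])
    show "functional (\<lambda>f. \<phi> (p ^ (r - 1) * f))" by (rule functional_mult_left[OF \<phi>])
    have "p ^ (r - 1) * (p * f) = p ^ r * f" for f using r by (cases r) auto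
    then show "\<phi> (p ^ (r - 1) * (p * f)) = 0" for f by (simp only: \<phi>0)
    show "\<phi> (p ^ (r - 1) * f0) \<noteq> 0" using x(2) unfolding \<phi>_def .
    have "\<phi> (p ^ (r - 1) * ((h - 1) * f)) = \<phi> (h * (p ^ (r - 1) * f)) - \<phi> (p ^ (r - 1) * f)" for f
      unfolding functional_diff[OF \<phi>, symmetric] by (simp add: algebra_simps del: poly_uminus_id)
    also have "\<dots> f = 0" for f
      unfolding h \<psi>_def using k(2)[of f] unfolding \<phi>_def by simp
    finally show "\<phi> (p ^ (r - 1) * ((h - 1) * f)) = 0" for f .
  qed (rule p(1))
  moreover have "star h = h" unfolding h_def by (simp add: add.commute)
  moreover have "p \<noteq> 0" using p(1) by auto
  ultimately obtain g where g: "p dvd g - 1" "p ^ Suc (r - 1) dvd h - g * star g"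
    using hensel[OF p(2)] by blast
  have "b (act g x) (act f (act g x)) = 0" if "pderiv f = 0" for f
  proof -
    obtain c where c: "h - g * star g = p ^ r * c" using g(2) r unfolding dvd_def by auto
    have "b (act g x) (act f (act g x)) = \<phi> (g * star g * f)"
      unfolding \<phi>_def b_act act_mult[symmetric] by (simp add: mult_ac)
    also have "\<dots> = \<phi> (h * f) - \<phi> (p ^ r * (c * f))"
      unfolding functional_diff[OF \<phi>, symmetric] mult.assoc[symmetric] c[symmetric]
      by (simp add: algebra_simps del: poly_uminus_id)
    also have "\<dots> = 0" unfolding h \<phi>0 \<psi>_def that by (simp add: functional_0[OF \<phi>])
    finally show ?thesis .
  qed
  then show ?thesis using g(1) by blast
qed

section \<open>Generators on which the even part of the form vanishes\<close>

lemma act_split_component: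
  assumes "invariant S" "invariant W" "W \<inter> perp S W = {0}"
    and "w \<in> W" "x - w \<in> perp S W" "act f x = 0"
  shows "act f w = 0"
proof (rule split_zero(1)[OF assms(1-3)])
  show "act f w \<in> W" "act f (x - w) \<in> perp S W"
    using invariant_act assms(2,4,5) invariant_perp[OF assms(1,2)] by blast+
  show "act f w + act f (x - w) = 0" unfolding act_vadd[symmetric] using assms(6) by simp
qed

lemma odd_frame_perp_coprime:
  assumes S: "invariant S" "invariant W" "W \<inter> perp S W = {0}"
    and split: "\<And>v. v \<in> S \<Longrightarrow> \<exists>w\<in>W. v - w \<in> perp S W"
    and E: "odd_frame p r S E" and p: "irreducible p" "\<not> p dvd a" and a: "\<And>w. w \<in> W \<Longrightarrow> act a w = 0"
  shows "\<exists>E'. odd_frame p r (perp S W) E'"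
proof (rule odd_frame_perp[OF S split E])
  fix x y w w'
  assume "y \<in> E" and w': "w' \<in> W" "y - w' \<in> perp S W"
  then have "act (p ^ r) y = 0" using E unfolding odd_frame_def by blast
  from act_split_component[OF S w' this] have "w' = 0"
    using act_coprime_torsion[OF p _ a[OF w'(1)]] by blast
  then show "\<forall>f. b w (act (p ^ (r - 1) * f) w') = 0" by simp
qed

text \<open>Let $w, w'$ be the components in $F[u]x$ of two frame vectors for the exponent $r'$, so that they are killed by
  $p^{r'}$. For $r' > r$ the factor $p^{r'-1}$ kills them, for $r' < r$ they are multiples of $p^{r-r'}x$,
  so that $p^r$ divides the product of the three factors, and
  for $r' = r$ orthogonality to the frame vector $x$ forces $p^{r-1}w' = 0$.\<close>

lemma odd_frame_perp_cyclic:
  assumes S: "invariant S" "regular S" and p: "irreducible p" "star p = p"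
    and x: "x \<in> S" "act (p ^ r) x = 0" "b x (act (p ^ (r - 1) * f0) x) \<noteq> 0" "r \<ge> 1"
    and E: "odd_frame p r' S E" "r' \<ge> 1" and rr: "r' = r \<Longrightarrow> x \<in> E"
  shows "\<exists>E'. odd_frame p r' (perp S (mspan {x})) E'"
proof -
  let ?W = "mspan {x}"
  have W: "?W \<subseteq> S" using x(1) S(1) by (intro mspan_minimal) auto
  note split = cyclic_split[OF p(1) S(1) x(1-3)]
  note facts = regular_splitting[OF S(1) invariant_mspan W S(2) split]
  have W0: "act (p ^ r * f) w = 0" if "w \<in> ?W" for w f
    using that x(2) unfolding mspan_singleton by (auto simp: act_mult act_commute[of "p ^ r"])
  have xW: "x \<in> ?W" using subset_mspan by blast
  have ne: "act (p ^ (r - 1)) x \<noteq> 0" using x(3) unfolding act_mult' by auto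
  show ?thesis
  proof (rule odd_frame_perp[OF S(1) invariant_mspan facts(3) split E(1)])
    fix y z w w'
    assume yz: "y \<in> E" "z \<in> E" and w: "w \<in> ?W" "w' \<in> ?W"
      "y - w \<in> perp S ?W" "z - w' \<in> perp S ?W" and yw: "y \<noteq> w" "z \<noteq> w'"
    have k: "act (p ^ r') w = 0" "act (p ^ r') w' = 0"
      using act_split_component[OF S(1) invariant_mspan facts(3)] w yz E(1) unfolding odd_frame_def by blast+
    obtain g g' where g: "w = act g x" "w' = act g' x" using w(1,2) unfolding mspan_singleton by blast
    consider "r' > r" | "r' < r" | "r' = r" by linarith
    then show "\<forall>f. b w (act (p ^ (r' - 1) * f) w') = 0"
    proof cases
      case 1
      then have "p ^ (r' - 1) = p ^ r * p ^ (r' - 1 - r)" by (simp add: power_add[symmetric])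
      then show ?thesis using W0[OF w(2)] by (simp add: mult.assoc)
    next
      case 2
      have pr: "p ^ r = p ^ r' * p ^ (r - r')" using 2 by (simp add: power_add[symmetric])
      have "p ^ r dvd p ^ r' * g" "p ^ r dvd p ^ r' * g'"
        using order_dvd[OF p(1) x(2) ne] k unfolding g act_mult[symmetric] by blast+
      then have "p ^ (r - r') dvd g" "p ^ (r - r') dvd g'"
        using p(1) unfolding pr by auto
      then obtain c c' where c: "g = p ^ (r - r') * c" "g' = p ^ (r - r') * c'" unfolding dvd_def by blast
      have e: "r - r' + (r - r') + (r' - 1) = r + (r - r' - 1)" using 2 E(2) by linarith
      have "star g * (p ^ (r' - 1) * f * g') = p ^ r * (p ^ (r - r' - 1) * (star c * f * c'))" for f
      proof -
        have "star g * (p ^ (r' - 1) * f * g') = p ^ (r - r' + (r - r') + (r' - 1)) * (star c * f * c')"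
          unfolding c star_mult star_power p power_add by (simp only: mult_ac)
        then show ?thesis unfolding e power_add by (simp only: mult_ac)
      qed
      then have "b x (act (star g * (p ^ (r' - 1) * f * g')) x) = 0" for f
        by (simp only: W0[OF xW] b_0)
      then show ?thesis unfolding g b_act act_mult by blast
    next
      case 3
      have "act (p ^ (r - 1)) w' = 0"
      proof (rule regularD[OF facts(1)])
        show "act (p ^ (r - 1)) w' \<in> ?W" by (rule invariant_act[OF invariant_mspan w(2)])
        fix v assume v: "v \<in> ?W"
        then obtain h where h: "v = act h x" unfolding mspan_singleton by auto
        have "x \<noteq> z"
        proof
          assume xz: "x = z"
          have "z - w' \<in> ?W" using subspace_diff[OF subspace_mspan xW w(2)] unfolding xz .
          then have "z - w' = 0" using w(4) facts(3) by blast
          then show False using yw(2) by (simp only: right_minus_eq)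
        qed
        then have "b x (act (p ^ (r - 1) * f) z) = 0" for f
          using E(1) rr[OF 3] yz(2) 3 unfolding odd_frame_def by blast
        then have "b v (act (p ^ (r - 1)) z) = 0"
          unfolding h b_act act_mult[symmetric] by (simp only: mult.commute)
        moreover have "b v (act (p ^ (r - 1)) (z - w')) = 0"
          by (rule act_b_perp(1)[OF invariant_mspan v w(4)])
        ultimately show "b v (act (p ^ (r - 1)) w') = 0" by simp
      qed
      then show ?thesis unfolding 3 act_mult' by simp
    qed
  qed
qed

text \<open>Otherwise polarization would give $c b(v, f(u)z)$ the trace 0 for every scalar $c$.\<close>

lemma ex_anisotropic:
  assumes T: "star f = f" and S: "subspace S" and vz: "v \<in> S" "z \<in> S" "b v (act f z) \<noteq> 0"
  shows "\<exists>x\<in>S. b x (act f x) \<noteq> 0"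
proof (rule ccontr)
  assume "\<not> ?thesis"
  then have 0: "b x (act f x) = 0" if "x \<in> S" for x using that by blast
  obtain t where t: "t + bul t \<noteq> 0" using ex_trace by blast
  define c where "c = t / b v (act f z)"
  have c: "c * b v (act f z) = t" unfolding c_def using vz(3) by simp
  have "scale c z \<in> S" "v + scale c z \<in> S" using vz S by (auto intro: subspace_add subspace_scale)
  from 0[OF this(1)] 0[OF this(2)] 0[OF vz(1)]
  have "b (scale c z) (act f v) + b v (act f (scale c z)) = 0"
    by (simp only: b_simps(1,3) act_vadd add_0 add_0_right)
  moreover have "b v (act f (scale c z)) = t" using c by simp
  moreover have "b (scale c z) (act f v) = bul t"
    using b_act_sym[of "scale c z" f v] T c by simp
  ultimately show False using t by (simp only: add.commute)
qed

lemma mspan_annihilated: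
  assumes "\<And>y. y \<in> Y \<Longrightarrow> act a y = 0" "w \<in> mspan Y"
  shows "act a w = 0"
  using assms(2)
proof (rule mspan_induct)
  show "subspace {v. act a v = 0}" by (rule subspaceI) auto
  show "act a (act f x) = 0" if "x \<in> Y" for f x using assms(1)[OF that] by (simp add: act_commute[of a])
qed

text \<open>The inductive step: even-isotropic generators of a piece and of its orthogonal complement are
  even-isotropic together.\<close>

lemma even_isotropic_generators_splitting:
  assumes S: "invariant S" "regular S" "no_odd_invariants S"
    and Y: "Y \<subseteq> S" "even_isotropic Y" "y \<in> Y" "y \<noteq> 0"
    and split: "\<And>v. v \<in> S \<Longrightarrow> \<exists>w\<in>mspan Y. v - w \<in> perp S (mspan Y)"
    and framed: "odd_framed (perp S (mspan Y))"
    and IH: "\<And>S'. \<lbrakk>dim S' < dim S; invariant S'; regular S'; no_odd_invariants S'; odd_framed S'\<rbrakk>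
        \<Longrightarrow> \<exists>X\<subseteq>S'. S' \<subseteq> mspan X \<and> even_isotropic X"
  shows "\<exists>X\<subseteq>S. S \<subseteq> mspan X \<and> even_isotropic X"
proof -
  let ?W = "mspan Y" and ?P = "perp S (mspan Y)"
  have W: "?W \<subseteq> S" using Y(1) S(1) by (intro mspan_minimal) auto
  note facts = regular_splitting[OF S(1) invariant_mspan W S(2) split]
  note ip = invariant_perp[OF S(1) invariant_mspan[of Y]]
  have PS: "?P \<subseteq> S" unfolding perp_def by auto
  have yW: "y \<in> ?W" using Y(3) subset_mspan by blast
  then have "y \<notin> ?P" using facts(3) Y(4) by blast
  then have "?P \<subset> S" using PS Y(1,3) by blast
  then have "dim ?P < dim S" using ip S(1) unfolding invariant_def by (intro dim_less) simp_all
  from IH[OF this ip facts(2) no_odd_invariants_perp[OF S(1) invariant_mspan facts(3) split S(3)] framed]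
  obtain X where X: "X \<subseteq> ?P" "?P \<subseteq> mspan X" "even_isotropic X" by blast
  have "even_isotropic (Y \<union> X)"
  proof -
    have YX: "b w (act f s) = 0" "b s (act f w) = 0" if "w \<in> Y" "s \<in> X" for w s f
      using act_b_perp[OF invariant_mspan, of w Y s S f] that X(1) subset_mspan[of Y] by blast+
    show ?thesis using Y(2) X(3) YX unfolding even_isotropic_def by auto
  qed
  moreover have "S \<subseteq> mspan (Y \<union> X)"
  proof
    fix v assume "v \<in> S"
    then obtain w where w: "w \<in> ?W" "v - w \<in> ?P" using split by blast
    have "w \<in> mspan (Y \<union> X)" "v - w \<in> mspan (Y \<union> X)"
      using w X(2) mspan_mono[of Y "Y \<union> X"] mspan_mono[of X "Y \<union> X"] by blast+
    then have "w + (v - w) \<in> mspan (Y \<union> X)" by (rule subspace_add[OF subspace_mspan])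
    then show "v \<in> mspan (Y \<union> X)" by simp
  qed
  ultimately show ?thesis using Y(1) X(1) PS by (intro exI[of _ "Y \<union> X"]) blast
qed

lemma even_max_exponent:
  assumes S: "no_odd_invariants S" and p: "p \<in> Irr - Irr0"
    and max: "\<forall>k. \<forall>x\<in>S. act (p ^ k) x = 0 \<longrightarrow> act (p ^ r) x = 0"
    and x: "x \<in> S" "act (p ^ r) x = 0" "act (p ^ (r - 1)) x \<noteq> 0"
  shows "even r"
proof (rule ccontr)
  assume "odd r"
  then obtain z where z: "z \<in> S" "act (p ^ (r - 1)) x = act (p ^ r) z"
    using S p x unfolding no_odd_invariants_def by blast
  have "act (p ^ (r + r)) z = act (p ^ r) (act (p ^ (r - 1)) x)"
    unfolding power_add act_mult z(2) ..
  also have "\<dots> = 0" using x(2) by (simp add: act_commute[of "p ^ r"])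
  finally have "act (p ^ r) z = 0" using max z(1) by blast
  then show False using x(3) z(2) by simp
qed

text \<open>The vector to which lemma \<open>ex_odd_generator\<close> will be applied. For even $p$ it is taken from the frame for $(p,r)$,
  where maximality of $r$ guarantees that not all diagonal values are zero; then $k = t$. For other $p$ any
  anisotropic vector works, with $k = p k_0$ and $k_0 p'$ congruent to 1 modulo $p$.\<close>

lemma ex_cyclic_generator:
  assumes S: "invariant S" "regular S" "no_odd_invariants S" "odd_framed S"
    and p: "p \<in> Irr" "star p = p" and r: "r \<ge> 1"
    and max: "\<forall>k. \<forall>x\<in>S. act (p ^ k) x = 0 \<longrightarrow> act (p ^ r) x = 0"
    and x0: "x0 \<in> S" "act (p ^ r) x0 = 0" "act (p ^ (r - 1)) x0 \<noteq> 0"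
  obtains x f0 k where "x \<in> S" "act (p ^ r) x = 0" "b x (act (p ^ (r - 1) * f0) x) \<noteq> 0"
    "pderiv (p ^ r) = 0" "star k = k"
    "\<And>f. b x (act (k * pderiv (p ^ (r - 1) * f)) x) = b x (act (p ^ (r - 1) * f) x)"
    "p \<in> Irr0 \<Longrightarrow> \<exists>E. odd_frame p r S E \<and> x \<in> E"
proof -
  have pi: "irreducible p" using p(1) unfolding Irr_def by blast
  have "\<exists>v\<in>S. act (star p ^ r) v = 0 \<and> b v (act (p ^ (r - 1)) x0) \<noteq> 0"
    by (rule ex_dual_vector[OF pi S(1,2) max x0])
  then obtain v where v: "v \<in> S" "act (p ^ r) v = 0" "b v (act (p ^ (r - 1)) x0) \<noteq> 0"
    unfolding p(2) by blast
  show ?thesis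
  proof (cases "p \<in> Irr0")
    case True
    then have "p \<in> Irr0 \<inter> fixed_polys bul" using p(2) fixed_polys_iff by blast
    then obtain E where E: "odd_frame p r S E" using S(4) r unfolding odd_framed_def by blast
    have dp: "pderiv p = 0" using True Irr0_iff by blast
    have "\<exists>x\<in>E. \<exists>f0. b x (act (p ^ (r - 1) * f0) x) \<noteq> 0"
    proof (rule ccontr)
      assume "\<not> ?thesis"
      then have 0: "b x (act (p ^ (r - 1) * f) y) = 0" if "x \<in> E" "y \<in> E" for x y f
        using E that unfolding odd_frame_def by (cases "x = y") auto
      have mE: "b w (act (p ^ (r - 1)) w') = 0" if "w \<in> mspan E" "w' \<in> mspan E" for w w'
        using that(1)
      proof (rule mspan_induct)
        show "subspace {w. b w (act (p ^ (r - 1)) w') = 0}" by (rule subspaceI) auto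
        fix f x assume x: "x \<in> E"
        show "b (act f x) (act (p ^ (r - 1)) w') = 0"
          using that(2)
        proof (rule mspan_induct)
          show "subspace {w'. b (act f x) (act (p ^ (r - 1)) w') = 0}" by (rule subspaceI) auto
          show "b (act f x) (act (p ^ (r - 1)) (act g y)) = 0" if "y \<in> E" for g y
            using 0[OF x that, of "star f * g"] unfolding b_act act_mult[symmetric] by (simp add: mult_ac)
        qed
      qed
      have Ek: "act (p ^ r) w = 0" if "w \<in> mspan E" for w
      proof (rule mspan_annihilated[OF _ that])
        show "act (p ^ r) y = 0" if "y \<in> E" for y using E that unfolding odd_frame_def by blast
      qed
      have red: "\<exists>w\<in>mspan E. \<forall>y. act (p ^ r) y = 0 \<longrightarrow> b (act (p ^ (r - 1)) s) y = b (act (p ^ (r - 1)) w) y"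
        if s: "s \<in> S" "act (p ^ r) s = 0" for s
      proof -
        obtain w z where w: "w \<in> mspan E" "act (p ^ (r - 1)) (s - w) = act (p ^ r) z"
          using E s unfolding odd_frame_def by blast
        have "b (act (p ^ (r - 1)) s) y = b (act (p ^ (r - 1)) w) y" if "act (p ^ r) y = 0" for y
        proof -
          have "b (act (p ^ (r - 1)) (s - w)) y = b z (act (p ^ r) y)"
            unfolding w(2) b_act by (simp add: p(2))
          then show ?thesis using that by simp
        qed
        then show ?thesis using w(1) by blast
      qed
      obtain w where w: "w \<in> mspan E" "\<And>y. act (p ^ r) y = 0 \<Longrightarrow> b (act (p ^ (r - 1)) v) y = b (act (p ^ (r - 1)) w) y"
        using red[OF v(1,2)] by blast
      obtain w' where w': "w' \<in> mspan E" "\<And>y. act (p ^ r) y = 0 \<Longrightarrow> b (act (p ^ (r - 1)) x0) y = b (act (p ^ (r - 1)) w') y"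
        using red[OF x0(1,2)] by blast
      have "b (act (p ^ (r - 1)) v) x0 = b (act (p ^ (r - 1)) w) x0" using w(2) x0(2) by blast
      also have "\<dots> = b w (act (p ^ (r - 1)) x0)" unfolding b_act by (simp add: p(2))
      also have "\<dots> = 0"
        by (rule b_eq_0_sym) (simp only: w'(2)[OF Ek[OF w(1)]], rule b_eq_0_sym, rule mE[OF w(1) w'(1)])
      finally show False using v(3) unfolding b_act by (simp add: p(2))
    qed
    then obtain x f0 where x: "x \<in> E" "b x (act (p ^ (r - 1) * f0) x) \<noteq> 0" by blast
    have xs: "x \<in> S" "act (p ^ r) x = 0" using E x(1) unfolding odd_frame_def by auto
    have dp': "pderiv (p ^ n) = 0" for n using dp by (simp add: pderiv_power_char2)
    have "b x (act (monom 1 1 * pderiv (p ^ (r - 1) * f)) x) = b x (act (p ^ (r - 1) * f) x)" for f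
    proof -
      have "pderiv (f - monom 1 1 * pderiv f) = 0"
        unfolding pderiv_diff pderiv_mult pderiv_pderiv by (simp add: pderiv_monom monom_0 one_pCons[symmetric] del: poly_uminus_id)
      then have "b x (act (p ^ (r - 1) * (f - monom 1 1 * pderiv f)) x) = 0"
        using E x(1) unfolding odd_frame_def by blast
      moreover have "p ^ (r - 1) * (f - monom 1 1 * pderiv f) = p ^ (r - 1) * f - monom 1 1 * pderiv (p ^ (r - 1) * f)"
        unfolding pderiv_mult dp' by (simp add: algebra_simps del: poly_uminus_id)
      ultimately show ?thesis by simp
    qed
    then show ?thesis using that[OF xs x(2) dp', of "monom 1 1"] E x(1) by auto
  next
    case False
    have "even r" by (rule even_max_exponent[OF S(3) _ max x0]) (use False p(1) in blast)
    have "pderiv p \<noteq> 0" using False p(1) Irr0_iff by blast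
    then have "\<not> p dvd pderiv p" by (rule irreducible_not_dvd_pderiv[OF pi])
    then obtain s t where st: "s * pderiv p + t * p = 1" using poly_bezout_irreducible[OF pi] by blast
    obtain e where e: "e + bul e = 1" using ex_trace_one by blast
    \<comment> \<open>The Bezout coefficients are symmetrized in the same way.\<close>
    define k0 where "k0 = psm e s + star (psm e s)"
    define t0 where "t0 = psm e t + star (psm e t)"
    have k0: "star k0 = k0" unfolding k0_def by (simp add: add.commute)
    have "star s * pderiv p + star t * p = 1" using arg_cong[OF st, of star] p(2) pderiv_star[of p] by simp
    moreover have "k0 * pderiv p + t0 * p = psm e (s * pderiv p + t * p) + psm (bul e) (star s * pderiv p + star t * p)"
      unfolding k0_def t0_def star_smult distrib_right smult_add_right mult_smult_left by (simp only: ac_simps)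
    ultimately have "k0 * pderiv p + t0 * p = psm (e + bul e) 1"
      unfolding st smult_add_left by (simp only:)
    then have "k0 * pderiv p + t0 * p = 1" unfolding e by simp
    then have kt: "k0 * pderiv p = 1 - t0 * p" by (simp only: eq_diff_eq)
    obtain x where x: "x \<in> {s\<in>S. act (p ^ r) s = 0}" "b x (act (p ^ (r - 1)) x) \<noteq> 0"
    proof -
      have "subspace {s\<in>S. act (p ^ r) s = 0}"
        using S(1) unfolding invariant_def subspace_def by auto
      moreover have "star (p ^ (r - 1)) = p ^ (r - 1)" using p(2) by simp
      moreover have "v \<in> {s\<in>S. act (p ^ r) s = 0}" "x0 \<in> {s\<in>S. act (p ^ r) s = 0}" using v x0 by auto
      ultimately show ?thesis using that ex_anisotropic[OF _ _ _ _ v(3)] by blast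
    qed
    have xr: "act (p ^ r * f) x = 0" for f using x(1) by (simp add: act_mult_torsion)
    have r2: "r \<ge> 2" "odd (r - 1)" using \<open>even r\<close> r by presburger+
    have "b x (act (p * k0 * pderiv (p ^ (r - 1) * f)) x) = b x (act (p ^ (r - 1) * f) x)" for f
    proof -
      have rr: "r = Suc (Suc (r - 2))" using r2 by simp
      have e1: "p * p ^ (r - 1 - 1) = p ^ (r - 1)" "p * p ^ (r - 1) = p ^ r"
        by (subst (1 2) rr, simp, subst (1 2) rr, simp)
      have pd: "pderiv (p ^ (r - 1)) = p ^ (r - 1 - 1) * pderiv p"
        using pderiv_power_char2[of p "r - 1"] unfolding if_P[OF r2(2)] .
      have "p * k0 * pderiv (p ^ (r - 1) * f) = (p * p ^ (r - 1)) * (k0 * pderiv f) + (p * p ^ (r - 1 - 1)) * (k0 * pderiv p) * f"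
        unfolding pderiv_mult pd by (simp only: algebra_simps)
      also have "\<dots> = (p * p ^ (r - 1)) * (k0 * pderiv f) + p ^ (r - 1) * (1 - t0 * p) * f"
        unfolding kt e1(1) ..
      also have "\<dots> = p ^ (r - 1) * f + (p * p ^ (r - 1)) * (k0 * pderiv f - t0 * f)"
        by (simp add: algebra_simps del: poly_uminus_id power_Suc)
      also have "\<dots> = p ^ (r - 1) * f + p ^ r * (k0 * pderiv f - t0 * f)" unfolding e1 ..
      finally show ?thesis by (simp only: act_add xr add_0_right)
    qed
    moreover have "star (p * k0) = p * k0" using p(2) k0 by simp
    moreover have "b x (act (p ^ (r - 1) * 1) x) \<noteq> 0" using x(2) by simp
    moreover have "pderiv (p ^ r) = 0" using \<open>even r\<close> by (simp add: pderiv_power_char2)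
    ultimately show ?thesis using that[of x 1 "p * k0"] x(1) False by blast
  qed
qed

text \<open>The piece split off is cyclic if $p$ is fixed by the involution, and otherwise it is generated by two vectors
  for $p$ and its conjugate.\<close>

lemma ex_even_isotropic_generators:
  "\<lbrakk>invariant S; regular S; no_odd_invariants S; odd_framed S\<rbrakk> \<Longrightarrow>
    \<exists>X\<subseteq>S. S \<subseteq> mspan X \<and> even_isotropic X"
proof (induction "dim S" arbitrary: S rule: less_induct)
  case less
  note S = less.prems
  show ?case
  proof (cases "S = {0}")
    case True
    then show ?thesis using subspace_0[OF subspace_mspan]
      by (intro exI[of _ "{}"]) (auto simp: even_isotropic_def)
  next
    case False
    then obtain x where "x \<in> S" "x \<noteq> 0" using S(1) subspace_0 unfolding invariant_def by blast
    then obtain p x1 where p: "p \<in> Irr" and x1: "x1 \<in> S" "x1 \<noteq> 0" "act p x1 = 0"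
      using ex_irreducible_torsion[OF S(1)] by blast
    have pi: "irreducible p" using p unfolding Irr_def by blast
    obtain r where r: "r \<ge> 1"
      and ex: "\<exists>x\<in>S. act (p ^ r) x = 0 \<and> act (p ^ (r - 1)) x \<noteq> 0"
      and max: "\<forall>k. \<forall>x\<in>S. act (p ^ k) x = 0 \<longrightarrow> act (p ^ r) x = 0"
      using ex_max_exponent[OF pi x1] by blast
    obtain x0 where x0: "x0 \<in> S" "act (p ^ r) x0 = 0" "act (p ^ (r - 1)) x0 \<noteq> 0" using ex by blast
    show ?thesis
    proof (cases "star p = p")
      case True
      obtain x f0 k where x: "x \<in> S" "act (p ^ r) x = 0" "b x (act (p ^ (r - 1) * f0) x) \<noteq> 0"
        and q: "pderiv (p ^ r) = 0"
        and k: "star k = k" "\<And>f. b x (act (k * pderiv (p ^ (r - 1) * f)) x) = b x (act (p ^ (r - 1) * f) x)"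
        and xE: "p \<in> Irr0 \<Longrightarrow> \<exists>E. odd_frame p r S E \<and> x \<in> E"
        using ex_cyclic_generator[OF S p True r max x0] by blast
      obtain g where g: "p dvd g - 1" "\<And>f. pderiv f = 0 \<Longrightarrow> b (act g x) (act f (act g x)) = 0"
        using ex_odd_generator[OF pi True r q x(2,3) k] by blast
      let ?y = "act g x"
      \<comment> \<open>$g$ is invertible modulo $p^r$, so $g(u)x$ generates the same submodule.\<close>
      have ng: "\<not> p dvd g"
      proof
        assume "p dvd g"
        from dvd_diff[OF this g(1)] have "is_unit p" by (simp del: poly_uminus_id)
        then show False using irreducible_not_unit[OF pi] by blast
      qed
      obtain s where "p ^ r dvd s * g - 1" using poly_inverse_mod_prime_power[OF pi ng] by blast
      from act_cong_torsion[OF this x(2)] have sx: "act s ?y = x" by (simp add: act_mult)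
      have W: "mspan {?y} = mspan {x}"
      proof
        show "mspan {?y} \<subseteq> mspan {x}" by (intro mspan_minimal invariant_mspan) (auto intro: act_in_mspan)
        show "mspan {x} \<subseteq> mspan {?y}"
          using act_in_mspan[of ?y "{?y}" s] unfolding sx by (intro mspan_minimal invariant_mspan) auto
      qed
      note split = cyclic_split[OF pi S(1) x(1-3)]
      have WS: "mspan {x} \<subseteq> S" using x(1) S(1) by (intro mspan_minimal) auto
      note facts = regular_splitting[OF S(1) invariant_mspan WS S(2) split]
      have framed: "odd_framed (perp S (mspan {x}))"
        unfolding odd_framed_def
      proof (intro ballI allI impI)
        fix p' r' assume p': "p' \<in> Irr0 \<inter> fixed_polys bul" and r': "r' \<ge> (1::nat)"
        obtain E where E: "odd_frame p' r' S E" using S(4) p' r' unfolding odd_framed_def by blast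
        show "\<exists>E'. odd_frame p' r' (perp S (mspan {x})) E'"
        proof (cases "p' = p")
          case same: True
          then obtain E1 where E1: "odd_frame p r S E1" "x \<in> E1" using xE p' by blast
          show ?thesis
          proof (cases "r' = r")
            case True
            then show ?thesis using odd_frame_perp_cyclic[OF S(1,2) pi \<open>star p = p\<close> x r E1(1) r E1(2)] same by simp
          next
            case False
            then show ?thesis using odd_frame_perp_cyclic[OF S(1,2) pi \<open>star p = p\<close> x r _ r'] E same by simp
          qed
        next
          case False
          have pI: "p' \<in> Irr" "irreducible p'" using p' unfolding Irr0_def Irr_def by auto
          have nd: "\<not> p' dvd p ^ r"
            using irreducible_dvd_power[OF pI(2)] Irr_dvd_imp_eq[OF pI(1) p] False by blast
          show ?thesis
          proof (rule odd_frame_perp_coprime[OF S(1) invariant_mspan facts(3) split E pI(2) nd])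
            fix w assume w: "w \<in> mspan {x}"
            show "act (p ^ r) w = 0"
              by (rule mspan_annihilated[OF _ w]) (simp only: singleton_iff x(2))
          qed
        qed
      qed
      show ?thesis
      proof (rule even_isotropic_generators_splitting[OF S(1-3), of "{?y}" ?y])
        show "{?y} \<subseteq> S" using invariant_act[OF S(1) x(1)] by simp
        show "even_isotropic {?y}" using g(2) unfolding even_isotropic_def by simp
        show "?y \<noteq> 0" using sx x(3) by auto
        show "\<exists>w\<in>mspan {?y}. v - w \<in> perp S (mspan {?y})" if "v \<in> S" for v
          unfolding W by (rule split[OF that])
        show "odd_framed (perp S (mspan {?y}))" unfolding W by (rule framed)
      qed (use less.hyps in auto)
    next
      case False
      have ps: "star p \<in> Irr" "irreducible (star p)" using Irr_star[OF p] irreducible_star[OF pi] by auto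
      have np: "\<not> p dvd star p" using Irr_dvd_imp_eq[OF p ps(1)] False by auto
      have "\<exists>v\<in>S. act (star p ^ r) v = 0 \<and> b v (act (p ^ (r - 1)) x0) \<noteq> 0"
        by (rule ex_dual_vector[OF pi S(1,2) max x0])
      then obtain y0 where y0: "y0 \<in> S" "act (star p ^ r) y0 = 0" "b y0 (act (p ^ (r - 1)) x0) \<noteq> 0"
        by blast
      have q: "pderiv (p ^ r) = 0"
      proof (cases "p \<in> Irr0")
        case True
        then show ?thesis using Irr0_iff by (simp add: pderiv_power_char2)
      next
        case False
        have "even r" by (rule even_max_exponent[OF S(3) _ max x0]) (use False p in blast)
        then show ?thesis by (simp add: pderiv_power_char2)
      qed
      have "b y0 (act (p ^ (r - 1) * 1) x0) \<noteq> 0" using y0(3) by simp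
      from dual_representation[OF pi x0(2) this functional_top_coeff top_coeff_mult]
      obtain h where h: "\<And>f. b (act h y0) (act f x0) = top_coeff (p ^ r) f" by blast
      define y where "y = act h y0"
      have y: "y \<in> S" "act (star p ^ r) y = 0"
        unfolding y_def using invariant_act[OF S(1) y0(1)] y0(2) by (simp_all add: act_commute[of "star p ^ r"])
      have ne: "b y (act (p ^ (r - 1) * monom 1 (degree p - 1)) x0) \<noteq> 0"
        unfolding y_def h top_coeff_prime_power[OF p r] by simp
      note split = hyperbolic_split[OF pi np S(1) x0(1,2) y ne]
      have WS: "mspan {x0, y} \<subseteq> S" using x0(1) y(1) S(1) by (intro mspan_minimal) auto
      note facts = regular_splitting[OF S(1) invariant_mspan WS S(2) split]
      have framed: "odd_framed (perp S (mspan {x0, y}))"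
        unfolding odd_framed_def
      proof (intro ballI allI impI)
        fix p' r' assume p': "p' \<in> Irr0 \<inter> fixed_polys bul" and r': "r' \<ge> (1::nat)"
        obtain E where E: "odd_frame p' r' S E" using S(4) p' r' unfolding odd_framed_def by blast
        have pI: "p' \<in> Irr" "irreducible p'" "star p' = p'"
          using p' fixed_polys_iff unfolding Irr0_def Irr_def by auto
        have "p' \<noteq> p" "p' \<noteq> star p" using pI(3) False by auto
        then have "\<not> p' dvd p ^ r" "\<not> p' dvd star p ^ r"
          using irreducible_dvd_power[OF pI(2)] Irr_dvd_imp_eq[OF pI(1)] p ps(1) by blast+
        then have nd: "\<not> p' dvd p ^ r * star p ^ r" using prime_elem_dvd_mult_iff[OF field_poly_irreducible_imp_prime[OF pI(2)]] by blast
        show "\<exists>E'. odd_frame p' r' (perp S (mspan {x0, y})) E'"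
        proof (rule odd_frame_perp_coprime[OF S(1) invariant_mspan facts(3) split E pI(2) nd])
          fix w assume w: "w \<in> mspan {x0, y}"
          have "act (p ^ r * star p ^ r) x0 = 0" "act (p ^ r * star p ^ r) y = 0"
            by (simp only: act_mult' x0(2) act_v0, simp only: act_mult y(2) act_v0)
          then show "act (p ^ r * star p ^ r) w = 0"
            by (intro mspan_annihilated[OF _ w]) blast
        qed
      qed
      show ?thesis
      proof (rule even_isotropic_generators_splitting[OF S(1-3), of "{x0, y}" x0])
        show "{x0, y} \<subseteq> S" using x0(1) y(1) by simp
        have xx: "b x0 (act f x0) = 0" for f
          using self_torsion_orthogonal[OF pi np x0(2), of 1 f] by simp
        have "\<not> star p dvd star (star p)" using np star_dvd_star[of "star p" p] by simp
        from self_torsion_orthogonal[OF ps(2) this y(2), of 1] have yy: "b y (act f y) = 0" for f by simp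
        have dq: "degree (p ^ r) > 0" "p ^ r \<noteq> 0"
          using irreducible_degree_pos[OF pi] r pi by (auto simp: degree_power_eq)
        have yx: "b y (act f x0) = 0" if "pderiv f = 0" for f
          unfolding y_def h by (rule top_coeff_even[OF q dq(2,1) that])
        have xy: "b x0 (act f y) = 0" if "pderiv f = 0" for f
          unfolding b_act_sym[of x0] using yx[of "star f"] that by simp
        show "even_isotropic {x0, y}" unfolding even_isotropic_def using xx yy xy yx by simp
        show "x0 \<noteq> 0" using x0(3) by auto
      qed (use less.hyps split framed in auto)
    qed
  qed
qed

section \<open>Lagrangian subspaces and sums of two square-zero maps\<close>

definition sum_of_two_square_zero :: bool where
  "sum_of_two_square_zero \<longleftrightarrow> (\<exists>a1 a2. Vector_Spaces.linear scale scale a1 \<and> Vector_Spaces.linear scale scale a2 \<and>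
      selfadjoint b a1 \<and> selfadjoint b a2 \<and>
      (\<forall>x. a1 (a1 x) = 0) \<and> (\<forall>x. a2 (a2 x) = 0) \<and> (\<forall>x. u x = a1 x + a2 x))"

lemma u_eq_0: "u x = 0 \<longleftrightarrow> x = 0"
  using bij_u u_0 by (metis bij_pointE)

lemma u_inj: "u x = u y \<longleftrightarrow> x = y"
  using bij_is_inj[OF bij_u] by (auto dest: injD)

lemma endomorphismI: "\<lbrakk>\<And>x y. f (x + y) = f x + f y; \<And>c x. f (scale c x) = scale c (f x)\<rbrakk>
    \<Longrightarrow> Vector_Spaces.linear scale scale f"
  by (intro Vector_Spaces.linear.intro vector_space_axioms module_hom.intro module_axioms module_hom_axioms.intro) auto

lemma act_parity: "act f x = act (f - monom 1 1 * pderiv f) x + u (act (pderiv f) x)"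
proof -
  have "act f x = act ((f - monom 1 1 * pderiv f) + monom 1 1 * pderiv f) x" by (simp only: diff_add_cancel)
  then show ?thesis by (simp only: act_add act_mult act_X)
qed

text \<open>The sum $V_0 + uV_0$ is direct because $V_0$ is isotropic: a vector $uy$ of $V_0$ with $y \<in> V_0$ is orthogonal to $V_0$,
  and to $uV_0$ since $u^2 y \<in> V_0$. With $v = x + uy$ the two maps are $v \<mapsto> u^2 y$ and $v \<mapsto> ux$.\<close>

lemma sum_of_two_square_zero_if_lagrangian:
  assumes V0: "subspace V0" "\<And>v. v \<in> V0 \<Longrightarrow> u (u v) \<in> V0" "\<And>v w. v \<in> V0 \<Longrightarrow> w \<in> V0 \<Longrightarrow> b v w = 0"
    and dec: "\<And>v. \<exists>y\<in>V0. v - u y \<in> V0"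
  shows sum_of_two_square_zero
proof -
  obtain Y where Y: "\<And>v. Y v \<in> V0" "\<And>v. v - u (Y v) \<in> V0" using dec by metis
  have b_uu: "b (u y) (u (u z)) = b (u (u y)) (u z)" for y z by (simp add: b_u)
  have zero: "y = 0" if y: "y \<in> V0" "u y \<in> V0" for y
  proof -
    have "b (u y) v = 0" for v
    proof -
      have "b (u y) (v - u (Y v)) = 0" using V0(3)[OF y(2) Y(2)] .
      moreover have "b (u y) (u (Y v)) = 0" using V0(3)[OF V0(2)[OF y(1)] Y(1)[of v]] by (simp add: b_u)
      ultimately show ?thesis by simp
    qed
    then have "u y = 0" by (rule nondegD)
    then show ?thesis by (simp add: u_eq_0)
  qed
  have uniq: "Y v = y" if y: "y \<in> V0" "v - u y \<in> V0" for v y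
  proof -
    have "u (Y v - y) = (v - u y) - (v - u (Y v))"
    proof -
      have "u (Y v - y) + u y = u (Y v)" unfolding u_add[symmetric] by simp
      then have "u (Y v - y) = u (Y v) - u y" by (simp only: eq_diff_eq)
      then show ?thesis by (simp add: algebra_simps del: vec_uminus)
    qed
    also have "\<dots> \<in> V0" using subspace_diff[OF V0(1) y(2) Y(2)] .
    finally have "Y v - y = 0" using zero subspace_diff[OF V0(1) Y(1) y(1)] by blast
    then show ?thesis by (simp only: right_minus_eq)
  qed
  have Y_add: "Y (v + w) = Y v + Y w" for v w
  proof (rule uniq)
    show "Y v + Y w \<in> V0" using subspace_add[OF V0(1) Y(1) Y(1)] .
    have "(v - u (Y v)) + (w - u (Y w)) \<in> V0" using subspace_add[OF V0(1) Y(2) Y(2)] .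
    then show "v + w - u (Y v + Y w) \<in> V0" by (simp only: u_add add_diff_add)
  qed
  have Y_scale: "Y (scale c v) = scale c (Y v)" for c v
  proof (rule uniq)
    show "scale c (Y v) \<in> V0" using subspace_scale[OF V0(1) Y(1)] .
    have "scale c (v - u (Y v)) \<in> V0" using subspace_scale[OF V0(1) Y(2)] .
    then show "scale c v - u (scale c (Y v)) \<in> V0" by (simp only: u_scale scale_right_diff_distrib)
  qed
  have Y0: "Y v = 0" if "v \<in> V0" for v
    by (rule uniq) (use that V0(1) subspace_0 in auto)
  have Yu: "Y (u y) = y" if "y \<in> V0" for y
    by (rule uniq) (use that V0(1) subspace_0 in auto)
  \<comment> \<open>$v = (v - uY(v)) + uY(v)$ is the decomposition of $v$.\<close>
  define a1 where "a1 v = u (u (Y v))" for v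
  define a2 where "a2 v = u (v - u (Y v))" for v
  have u_diff: "u (x - y) = u x - u y" for x y by (simp add: vec_diff)
  have 1: "u v = a1 v + a2 v" for v unfolding a1_def a2_def u_add[symmetric] by simp
  have a2: "a2 v = u v + a1 v" for v unfolding a1_def a2_def by (simp add: vec_diff)
  have l1: "Vector_Spaces.linear scale scale a1" by (rule endomorphismI) (simp_all add: a1_def Y_add Y_scale)
  have l2: "Vector_Spaces.linear scale scale a2"
    by (rule endomorphismI) (simp_all add: a2 a1_def Y_add Y_scale scale_right_distrib ac_simps)
  have s1: "selfadjoint b a1"
    unfolding selfadjoint_def
  proof (intro allI)
    fix v w
    have "b (a1 v) w = b (a1 v) (w - u (Y w)) + b (a1 v) (u (Y w))" by simp
    also have "b (a1 v) (w - u (Y w)) = 0" unfolding a1_def by (rule V0(3)[OF V0(2)[OF Y(1)] Y(2)])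
    also have "b (a1 v) (u (Y w)) = b (u (Y v)) (a1 w)" unfolding a1_def by (simp only: b_u)
    also have "0 = b (v - u (Y v)) (a1 w)" unfolding a1_def by (rule V0(3)[OF Y(2) V0(2)[OF Y(1)], symmetric])
    also have "b (v - u (Y v)) (a1 w) + b (u (Y v)) (a1 w) = b v (a1 w)" by simp
    finally show "b (a1 v) w = b v (a1 w)" .
  qed
  have s2: "selfadjoint b a2"
    using s1 unfolding selfadjoint_def a2 by (simp add: b_u)
  have z1: "a1 (a1 v) = 0" for v unfolding a1_def using Y0[OF V0(2)[OF Y(1)]] by simp
  have z2: "a2 (a2 v) = 0" for v unfolding a2_def using Yu[OF Y(2)] by simp
  show ?thesis unfolding sum_of_two_square_zero_def using l1 l2 s1 s2 z1 z2 1 by blast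
qed

text \<open>$V_0$ is the $F[t^2]$-span of $X$. It satisfies $V = V_0 + uV_0$ because $f = (f - tf') + tf'$, with $f - tf'$ and
  $f'$ even.\<close>

lemma sum_of_two_square_zero_if_generators:
  assumes "mspan X = UNIV" "even_isotropic X"
  shows sum_of_two_square_zero
proof -
  define V0 where "V0 = span {act f x | f x. x \<in> X \<and> pderiv f = 0}"
  have base: "act f x \<in> V0" if "x \<in> X" "pderiv f = 0" for f x
    unfolding V0_def using that by (intro span_base) blast
  have ind: "P v" if v: "v \<in> V0" and sP: "subspace {v. P v}" and b: "\<And>f x. x \<in> X \<Longrightarrow> pderiv f = 0 \<Longrightarrow> P (act f x)" for P v
  proof -
    have "V0 \<subseteq> {v. P v}" unfolding V0_def using sP b by (intro span_minimal) auto
    then show ?thesis using v by auto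
  qed
  show ?thesis
  proof (rule sum_of_two_square_zero_if_lagrangian)
    show sV: "subspace V0" unfolding V0_def by simp
    show "u (u v) \<in> V0" if "v \<in> V0" for v
      using that
    proof (rule ind)
      show "subspace {v. u (u v) \<in> V0}" using sV unfolding subspace_def by simp
      fix f :: "'f poly" and x assume fx: "x \<in> X" "pderiv f = 0"
      have "pderiv (monom 1 1 * (monom 1 1 * f)) = 0"
        unfolding pderiv_mult fx(2) by (simp add: poly_double pderiv_monom monom_0 one_pCons[symmetric])
      from base[OF fx(1) this] show "u (u (act f x)) \<in> V0" unfolding act_mult act_X .
    qed
    show "b v w = 0" if v: "v \<in> V0" and w: "w \<in> V0" for v w
      using v
    proof (rule ind)
      show "subspace {v. b v w = 0}" by (rule subspaceI) auto
      fix f :: "'f poly" and x assume fx: "x \<in> X" "pderiv f = 0"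
      show "b (act f x) w = 0"
        using w
      proof (rule ind)
        show "subspace {w. b (act f x) w = 0}" by (rule subspaceI) auto
        fix g :: "'f poly" and y assume gy: "y \<in> X" "pderiv g = 0"
        have "pderiv (star f * g) = 0" unfolding pderiv_mult pderiv_star fx(2) gy(2) by simp
        then show "b (act f x) (act g y) = 0"
          using assms(2) fx(1) gy(1) unfolding even_isotropic_def b_act act_mult[symmetric] by blast
      qed
    qed
    show "\<exists>y\<in>V0. v - u y \<in> V0" for v
    proof -
      have "v \<in> mspan X" using assms(1) by simp
      then show ?thesis
      proof (rule mspan_induct)
        show "subspace {v. \<exists>y\<in>V0. v - u y \<in> V0}"
          by (rule subspace_modulo[OF sV sV]) simp_all
        fix f x assume x: "x \<in> X"
        have "act f x - u (act (pderiv f) x) = act (f - monom 1 1 * pderiv f) x"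
          using act_parity[of f x] by (simp only: diff_eq_eq)
        then show "\<exists>y\<in>V0. act f x - u y \<in> V0"
          using base[OF x even_part[of f]] base[OF x pderiv_pderiv[of f]] by (intro bexI[of _ "act (pderiv f) x"]) (simp_all only:)
      qed
    qed
  qed
qed

text \<open>The linear map $w \<mapsto> \<Sum> b(e,w) e$, summed over the basis, is injective and hence onto; this replaces
  the semilinear map into the dual space.\<close>

lemma riesz_representation:
  assumes l: "\<And>v w. l (v + w) = l v + l w" "\<And>c v. l (scale c v) = c * l v"
  shows "\<exists>y. \<forall>v. b y v = (l v :: 'f)"
proof -
  define T where "T w = (\<Sum>e\<in>Basis. scale (b e w) e)" for w
  have T: "Vector_Spaces.linear scale scale T"
    by (rule endomorphismI) (simp_all add: T_def scale_left_distrib sum.distrib scale_sum_right)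
  have coord: "c e = c' e" if "(\<Sum>e\<in>Basis. scale (c e) e) = (\<Sum>e\<in>Basis. scale (c' e) e)" "e \<in> Basis" for c c' e
  proof -
    have "(\<Sum>e\<in>Basis. scale (c e - c' e) e) = 0"
      using that(1) unfolding scale_left_diff_distrib sum_subtractf by (simp only: right_minus_eq)
    then have "c e - c' e = 0" by (rule independentD[OF independent_Basis finite_Basis subset_refl _ that(2)])
    then show ?thesis by (simp only: right_minus_eq)
  qed
  have ext: "g v = 0" if g: "\<And>v w. g (v + w) = g v + g w" "\<And>c v. g (scale c v) = c * g v"
      "\<And>e. e \<in> Basis \<Longrightarrow> g e = 0" for g :: "'v \<Rightarrow> 'f" and v
  proof -
    have "v \<in> span Basis" using span_Basis by simp
    then show ?thesis
    proof (induction v rule: span_induct_alt)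
      case base
      then show ?case using g(2)[of 0 0] by simp
    qed (simp add: g)
  qed
  have "inj T"
  proof (rule injI)
    fix x y assume "T x = T y"
    then have *: "b e x = b e y" if "e \<in> Basis" for e unfolding T_def by (rule coord[OF _ that])
    have "b (x - y) v = 0" for v
    proof (rule ext[of "b (x - y)"])
      show "b (x - y) e = 0" if "e \<in> Basis" for e
        by (rule b_eq_0_sym) (use *[OF that] in simp)
    qed simp_all
    then have "x - y = 0" by (rule nondegD)
    then show "x = y" by (simp only: right_minus_eq)
  qed
  then have "surj T" by (rule linear_inj_imp_surj[OF T])
  from surjD[OF this] obtain w where "(\<Sum>e\<in>Basis. scale (bul (l e)) e) = T w" by blast
  from this[symmetric] have "T w = (\<Sum>e\<in>Basis. scale (bul (l e)) e)" .
  then have *: "b e w = bul (l e)" if "e \<in> Basis" for e unfolding T_def by (rule coord[OF _ that])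
  have "b w v - l v = 0" for v
  proof (rule ext[of "\<lambda>v. b w v - l v"])
    show "b w e - l e = 0" if "e \<in> Basis" for e
      using *[OF that] unfolding b_sym[of w e] by simp
  qed (simp_all add: l algebra_simps del: uminus_id)
  then show ?thesis by (intro exI[of _ w]) simp
qed

text \<open>For selfadjoint $T$ the orthogonal complement of $ker T$ is the image of $T$: a linear form that separates
  a vector from the image is represented by a vector of the kernel.\<close>

lemma perp_ker_subset_range:
  assumes q: "star q = q" and c: "\<And>y. act q y = 0 \<Longrightarrow> b y c = 0"
  shows "\<exists>z. c = act q z"
proof (rule ccontr)
  assume nc: "\<nexists>z. c = act q z"
  interpret p: vector_space_pair scale "(*) :: 'f \<Rightarrow> 'f \<Rightarrow> 'f"
    by unfold_locales (auto simp: algebra_simps)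
  let ?R = "range (act q)"
  have sR: "subspace ?R"
  proof (rule subspaceI)
    show "0 \<in> ?R" by (rule image_eqI[of _ _ 0]) auto
    show "v + w \<in> ?R" if "v \<in> ?R" "w \<in> ?R" for v w using that by (auto simp: act_vadd[symmetric] simp del: act_vadd)
    show "scale k v \<in> ?R" if "v \<in> ?R" for k v using that by (auto simp: act_vscale[symmetric] simp del: act_vscale)
  qed
  obtain B where B: "B \<subseteq> ?R" "independent B" "?R \<subseteq> span B" by (rule basis_exists[of ?R])
  have "span B \<subseteq> ?R" by (rule span_minimal[OF B(1) sR])
  then have cB: "c \<notin> span B" using nc by auto
  have "independent (insert c B)" using B(2) cB by (simp add: independent_insert)
  from p.linear_independent_extend[OF this, of "\<lambda>x. if x = c then 1 else 0"]
  obtain l where l: "Vector_Spaces.linear scale (*) l" "\<And>x. x \<in> insert c B \<Longrightarrow> l x = (if x = c then 1 else 0)" by blast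
  have ll: "l (v + w) = l v + l w" "l (scale k v) = k * l v" for v w k
    using l(1) by (simp_all add: module_hom.add module_hom.scale linear_iff_module_hom)
  obtain y where y: "\<And>v. b y v = l v" using riesz_representation[of l] ll by blast
  have lB: "l v = 0" if "v \<in> span B" for v
    using that
  proof (induction v rule: span_induct_alt)
    case base
    then show ?case using ll(2)[of 0 0] by simp
  next
    case (step k e v)
    have "e \<noteq> c" using step(1) cB span_base by blast
    then show ?case using step l(2)[of e] by (simp add: ll)
  qed
  have "act q y = 0"
  proof (rule nondegD)
    fix v
    have "act q v \<in> span B" using B(3) by blast
    then show "b (act q y) v = 0" unfolding b_act q y by (rule lB)
  qed
  then have "b y c = 0" by (rule c)
  then show False using y[of c] l(2)[of c] by simp
qed

section \<open>Orthogonalization over $F[t^2]$\<close>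

text \<open>An orthogonal family for the form $b(x, f(u)p(u)^{r-1}y)$ that generates $Z$ up to its radical. The
  difference of $v$ and its approximation is required to lie in $Z$, which is only stable under even polynomials.\<close>

definition orthogonal_generators :: "'f poly \<Rightarrow> nat \<Rightarrow> 'v set \<Rightarrow> 'v set \<Rightarrow> bool" where
  "orthogonal_generators p r Z E \<longleftrightarrow> finite E \<and> E \<subseteq> Z \<and>
     (\<forall>x\<in>E. \<forall>y\<in>E. x \<noteq> y \<longrightarrow> (\<forall>f. b x (act (p ^ (r - 1) * f) y) = 0)) \<and>
     (\<forall>v\<in>Z. \<exists>w\<in>mspan E. v - w \<in> Z \<and> (\<forall>z\<in>Z. \<forall>f. b z (act (p ^ (r - 1) * f) (v - w)) = 0))"

text \<open>Gram-Schmidt by induction on the dimension. If some $x \<in> Z$ has a nonzero value, split off its span; as the form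
  vanishes for even $f$, the coefficients of the projection can be taken even, so one
  remains inside $Z$. If all values are zero, polarization shows that the form is zero on $Z$.\<close>

lemma orthogonalization:
  assumes p: "p \<in> Irr" "star p = p" and r: "r \<ge> 1"
  shows "\<lbrakk>subspace Z; \<And>v f. v \<in> Z \<Longrightarrow> pderiv f = 0 \<Longrightarrow> act f v \<in> Z; \<And>v. v \<in> Z \<Longrightarrow> act (p ^ r) v = 0;
      \<And>v w f. v \<in> Z \<Longrightarrow> w \<in> Z \<Longrightarrow> pderiv f = 0 \<Longrightarrow> b v (act (p ^ (r - 1) * f) w) = 0\<rbrakk> \<Longrightarrow>
    \<exists>E. orthogonal_generators p r Z E"
proof (induction "dim Z" arbitrary: Z rule: less_induct)
  case less
  note Z = less.prems
  let ?q = "p ^ (r - 1)"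
  have pi: "irreducible p" using p(1) unfolding Irr_def by blast
  have sq: "star (?q * f) = ?q * star f" for f using p(2) by simp
  show ?case
  proof (cases "\<forall>x\<in>Z. \<forall>f. b x (act (?q * f) x) = 0")
    case True
    have "b z (act (?q * f) v) = 0" if zv: "z \<in> Z" "v \<in> Z" for z v f
    proof (rule functional_eq_0I[where \<phi> = "\<lambda>f. b z (act (?q * f) v)"])
      show "functional (\<lambda>f. b z (act (?q * f) v))"
        using functional_mult_left[OF functional_b_act[of z v], of ?q] .
      fix i
      have st: "star (?q * monom 1 i) = ?q * monom 1 i" unfolding sq by simp
      show "b z (act (?q * monom 1 i) v) = 0"
      proof (rule ccontr)
        assume "b z (act (?q * monom 1 i) v) \<noteq> 0"
        from ex_anisotropic[OF st Z(1) zv this] show False using True by blast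
      qed
    qed
    then show ?thesis using subspace_0[OF subspace_mspan[of "{}"]] unfolding orthogonal_generators_def
      by (intro exI[of _ "{}"]) (auto intro!: bexI[of _ 0])
  next
    case False
    then obtain x f0 where x: "x \<in> Z" "b x (act (?q * f0) x) \<noteq> 0" by blast
    define Z' where "Z' = {v\<in>Z. \<forall>f. b x (act (?q * f) v) = 0}"
    have Z'Z: "Z' \<subseteq> Z" unfolding Z'_def by blast
    have sZ': "subspace Z'"
      using Z(1) unfolding Z'_def subspace_def by simp
    have eZ': "act f v \<in> Z'" if "v \<in> Z'" "pderiv f = 0" for v f
    proof -
      have "b x (act (?q * g) (act f v)) = 0" for g
      proof -
        have "b x (act (?q * (g * f)) v) = 0" using that(1) unfolding Z'_def by blast
        then show ?thesis by (simp only: act_mult)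
      qed
      then show ?thesis using that Z(2) unfolding Z'_def by blast
    qed
    have "x \<notin> Z'" using x(2) unfolding Z'_def by blast
    then have "Z' \<subset> Z" using Z'Z x(1) by blast
    then have dim: "dim Z' < dim Z" by (rule dim_less[OF sZ' Z(1)])
    have "\<exists>E. orthogonal_generators p r Z' E"
    proof (rule less.hyps[OF dim sZ'])
      show "act f v \<in> Z'" if "v \<in> Z'" "pderiv f = 0" for v f by (rule eZ'[OF that])
      show "act (p ^ r) v = 0" if "v \<in> Z'" for v using Z(3) Z'Z that by blast
      show "b v (act (?q * f) w) = 0" if "v \<in> Z'" "w \<in> Z'" "pderiv f = 0" for v w f
        by (rule Z(4)) (use Z'Z that in auto)
    qed
    then obtain E where E: "finite E" "E \<subseteq> Z'"
      and Eo': "\<forall>x\<in>E. \<forall>y\<in>E. x \<noteq> y \<longrightarrow> (\<forall>f. b x (act (?q * f) y) = 0)"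
      and Eg': "\<forall>v\<in>Z'. \<exists>w\<in>mspan E. v - w \<in> Z' \<and> (\<forall>z\<in>Z'. \<forall>f. b z (act (?q * f) (v - w)) = 0)"
      unfolding orthogonal_generators_def by (elim exE conjE)
    have Eo: "b x (act (?q * f) y) = 0" if "x \<in> E" "y \<in> E" "x \<noteq> y" for x y f
      using Eo' that by simp
    have xE: "b x (act (?q * f) y) = 0" if "y \<in> Z'" for y f using that unfolding Z'_def by blast
    have Ex: "b y (act (?q * f) x) = 0" if "y \<in> Z'" for y f
      unfolding b_act_sym[of y] sq using xE[OF that] by simp
    have proj: "\<exists>h. pderiv h = 0 \<and> v - act h x \<in> Z'" if v: "v \<in> Z" for v
    proof -
      define \<phi> where "\<phi> f = b x (act (?q * f) x)" for f
      define \<psi> where "\<psi> f = b x (act (?q * f) v)" for f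
      have f: "functional \<phi>" "functional \<psi>"
        unfolding \<phi>_def \<psi>_def
        using functional_mult_left[OF functional_b_act[of x x], of ?q] functional_mult_left[OF functional_b_act[of x v], of ?q]
        by simp_all
      have qp: "?q * (p ^ 1 * g) = p ^ r * g" for g using r by (cases r) auto
      have "act (p ^ r * g) v = 0" if "v \<in> Z" for v g using Z(3)[OF that] by (simp add: act_mult')
      then have k: "\<phi> (p ^ 1 * g) = 0" "\<psi> (p ^ 1 * g) = 0" for g
        unfolding \<phi>_def \<psi>_def qp using x(1) v by simp_all
      have "\<phi> (p ^ (1 - 1) * f0) \<noteq> 0" using x(2) unfolding \<phi>_def by simp
      from functional_duality[OF pi f(1) k(1) this f(2) k(2)]
      obtain h where h: "\<And>f. \<phi> (h * f) = \<psi> f" by blast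
      \<comment> \<open>The even part of the coefficient suffices and keeps the projection inside \<open>Z\<close>.\<close>
      define h0 where "h0 = h - monom 1 1 * pderiv h"
      have "\<phi> (h0 * g) = \<psi> g" for g
        unfolding h0_def
      proof (rule even_representative[OF f(1) _ _ h])
        show "\<phi> f = 0" "\<psi> f = 0" if "pderiv f = 0" for f
          unfolding \<phi>_def \<psi>_def using Z(4) x(1) v that by blast+
      qed
      then have "b x (act (?q * g) (v - act h0 x)) = 0" for g
        unfolding \<phi>_def \<psi>_def act_vdiff b_diff act_mult[symmetric] by (simp add: mult_ac)
      moreover have "v - act h0 x \<in> Z"
        using subspace_diff[OF Z(1) v Z(2)[OF x(1)]] even_part[of h] unfolding h0_def by blast
      ultimately show ?thesis using even_part[of h] unfolding Z'_def h0_def by blast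
    qed
    have "finite (insert x E)" "insert x E \<subseteq> Z" using E(1,2) Z'Z x(1) by auto
    moreover have "b y (act (?q * f) z) = 0" if "y \<in> insert x E" "z \<in> insert x E" "y \<noteq> z" for y z f
    proof -
      consider "y \<in> E" "z \<in> E" | "y = x" "z \<in> E" | "y \<in> E" "z = x" using \<open>y \<in> insert x E\<close> \<open>z \<in> insert x E\<close> \<open>y \<noteq> z\<close> by blast
      then show ?thesis
      proof cases
        case 1
        then show ?thesis using Eo \<open>y \<noteq> z\<close> by simp
      next
        case 2
        then show ?thesis using xE E(2) by auto
      next
        case 3
        then show ?thesis using Ex E(2) by auto
      qed
    qed
    moreover have "\<exists>w\<in>mspan (insert x E). v - w \<in> Z \<and> (\<forall>z\<in>Z. \<forall>f. b z (act (?q * f) (v - w)) = 0)"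
      if v: "v \<in> Z" for v
    proof -
      obtain h where h: "pderiv h = 0" "v - act h x \<in> Z'" using proj[OF v] by blast
      obtain w where w: "w \<in> mspan E" "v - act h x - w \<in> Z'"
        and w3: "\<forall>z\<in>Z'. \<forall>f. b z (act (?q * f) (v - act h x - w)) = 0" using Eg' h(2) by blast
      define d where "d = v - act h x - w"
      have dd: "v - (act h x + w) = d" unfolding d_def by (simp only: diff_diff_eq)
      have "b z (act (?q * f) d) = 0" if z: "z \<in> Z" for z f
      proof -
        obtain k where k: "z - act k x \<in> Z'" using proj[OF z] by blast
        have "b (z - act k x) (act (?q * f) d) = 0" using w3 k unfolding d_def by blast
        moreover have "b (act k x) (act (?q * f) d) = b x (act (?q * (star k * f)) d)"
          unfolding b_act act_mult[symmetric] by (simp only: mult_ac)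
        then have "b (act k x) (act (?q * f) d) = 0" unfolding d_def by (simp only: xE[OF w(2)])
        ultimately show ?thesis by simp
      qed
      moreover have "d \<in> Z" using w(2) Z'Z unfolding d_def by blast
      moreover have "act h x + w \<in> mspan (insert x E)"
      proof (rule subspace_add[OF subspace_mspan])
        show "act h x \<in> mspan (insert x E)" by (rule act_in_mspan) simp
        show "w \<in> mspan (insert x E)" using w(1) mspan_mono[of E "insert x E"] by blast
      qed
      ultimately show ?thesis unfolding dd[symmetric] by blast
    qed
    ultimately show ?thesis unfolding orthogonal_generators_def by (intro exI[of _ "insert x E"]) blast
  qed
qed

end

text \<open>The first summand $a$ of a decomposition of $u$. The second one only enters through
  the relation $au = ua + u^2$, which is what $(u - a)^2 = 0$ amounts to in characteristic 2.\<close>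

locale square_zero_summand = hermitian_pair +
  fixes a
  assumes a_add: "a (x + y) = a x + a y" and a_scale: "a (scale c x) = scale c (a x)"
    and a_selfadjoint: "b (a x) y = b x (a y)" and a_a: "a (a x) = 0"
    and a_u: "a (u x) = u (a x) + u (u x)"
begin

lemma a_0: "a 0 = 0" using a_scale[of 0 0] by simp

lemma u_diff: "u (x - y) = u x - u y" by (simp add: vec_diff)

lemma a_diff: "a (x - y) = a x - a y" by (simp add: vec_diff a_add)

text \<open>The map $a$ acts as the derivation $u^2 d/du$.\<close>

lemma a_act: "a (act f x) = act f (a x) + u (u (act (pderiv f) x))"
proof (induction f)
  case 0
  then show ?case by (simp add: a_0)
next
  case (pCons c f)
  then show ?case by (simp add: a_add a_scale a_u pderiv_pCons ac_simps)
qed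

lemma a_act_even: "pderiv f = 0 \<Longrightarrow> a (act f x) = act f (a x)"
  by (simp add: a_act)

lemma ex_uu: "\<exists>z. y = u (u z)"
  using bij_is_surj[OF bij_u] by (metis surjD)

lemma uu_act: "act f (u (u x)) = u (u (act f x))"
  by (simp add: act_u)

text \<open>Applying $a$ to $p(u)^r x = 0$ gives $u^2 p'(u)p(u)^{r-1}x = p(u)^r a(x)$ for odd $r$; both $u$ and $p'(u)$ can be inverted on
  $ker p(u)$.\<close>

lemma no_odd_invariants_UNIV: "no_odd_invariants UNIV"
  unfolding no_odd_invariants_def
proof (intro ballI allI impI)
  fix p r x assume p: "p \<in> Irr - Irr0" and r: "odd (r::nat)" and x: "act (p ^ r) x = 0"
  have pi: "irreducible p" using p unfolding Irr_def by blast
  have "pderiv p \<noteq> 0" using p Irr0_iff by blast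
  then have "\<not> p dvd pderiv p" by (rule irreducible_not_dvd_pderiv[OF pi])
  then obtain s where "p ^ 1 dvd s * pderiv p - 1" using poly_inverse_mod_prime_power[OF pi] by blast
  moreover have "act (p ^ 1) (act (p ^ (r - 1)) x) = 0"
  proof -
    have "p ^ 1 * p ^ (r - 1) = p ^ r" using r by (cases r) auto
    then show ?thesis unfolding act_mult[symmetric] using x by simp
  qed
  ultimately have s: "act (s * pderiv p) (act (p ^ (r - 1)) x) = act (p ^ (r - 1)) x"
    by (rule act_cong_torsion)
  have "0 = a (act (p ^ r) x)" using x by (simp add: a_0)
  also have "\<dots> = act (p ^ r) (a x) + u (u (act (p ^ (r - 1) * pderiv p) x))"
    using r by (simp add: a_act pderiv_power_char2)
  finally have "u (u (act (p ^ (r - 1) * pderiv p) x)) = act (p ^ r) (a x)"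
    by (metis minus_unique vec_uminus)
  then have "act s (u (u (act (p ^ (r - 1) * pderiv p) x))) = act s (act (p ^ r) (a x))" by simp
  then have "u (u (act (s * pderiv p) (act (p ^ (r - 1)) x))) = act (p ^ r) (act s (a x))"
    unfolding uu_act act_mult[symmetric] by (simp only: mult_ac)
  then have 1: "u (u (act (p ^ (r - 1)) x)) = act (p ^ r) (act s (a x))" unfolding s .
  obtain z where "act s (a x) = u (u z)" using ex_uu by blast
  then have "u (u (act (p ^ (r - 1)) x)) = u (u (act (p ^ r) z))" using 1 by (simp add: uu_act)
  then show "\<exists>z\<in>UNIV. act (p ^ (r - 1)) x = act (p ^ r) z" unfolding u_inj by blast
qed

text \<open>The kernel of $a$ is its image, as $w = uz$ in the kernel gives $a(z) = w$; a selfadjoint map whose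
  image is its kernel has isotropic kernel.\<close>

lemma ker_a_isotropic:
  assumes "a v = 0" "a w = 0"
  shows "b v w = 0"
proof -
  obtain z where z: "w = u z" using bij_is_surj[OF bij_u] by (metis surjD)
  have "u (a z) + u w = 0" using assms(2) unfolding z a_u .
  then have "u (a z + w) = 0" by simp
  then have "a z = w" by (metis u_eq_0 minus_unique vec_uminus add.commute)
  then have "b v w = b v (a z)" by simp
  also have "\<dots> = b (a v) z" by (simp only: a_selfadjoint)
  finally show ?thesis using assms(1) by simp
qed

text \<open>The component is $y = u^{-2} a(v)$.\<close>

lemma ker_a_decomposition:
  obtains y where "a y = 0" "a (v - u y) = 0" "\<And>f. pderiv f = 0 \<Longrightarrow> act f v = 0 \<Longrightarrow> act f y = 0"
proof -
  obtain y where y: "a v = u (u y)" using ex_uu by blast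
  have "u (u (a y)) = a (u (u y))" by (simp add: a_u vec_double ac_simps add.assoc[symmetric])
  then have ay: "a y = 0" unfolding y[symmetric] a_a by (simp add: u_eq_0)
  have "a (v - u y) = 0" unfolding a_diff a_u ay y by simp
  moreover have "act f y = 0" if f: "pderiv f = 0" "act f v = 0" for f
  proof -
    have "u (u (act f y)) = a (act f v)" unfolding uu_act[symmetric] y[symmetric] a_act_even[OF f(1)] ..
    then show ?thesis unfolding f(2) a_0 u_eq_0 .
  qed
  ultimately show ?thesis using that ay by blast
qed

text \<open>An orthogonalization of $Z = ker a \<inter> ker p(u)^r$ is a frame, since $ker p(u)^r = Z + uZ$, and a vector orthogonal to
  $ker p(u)^r$ lies in the image of $p(u)^r$.\<close>

lemma odd_framed_UNIV: "odd_framed UNIV"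
  unfolding odd_framed_def
proof (intro ballI allI impI)
  fix p r assume p: "p \<in> Irr0 \<inter> fixed_polys bul" and r: "r \<ge> (1::nat)"
  have pI: "p \<in> Irr" "star p = p" "pderiv p = 0" using p Irr0_iff fixed_polys_iff by auto
  let ?q = "p ^ (r - 1)"
  have dp: "pderiv (p ^ n) = 0" for n using pI(3) by (simp add: pderiv_power_char2)
  have dq: "pderiv (?q * f) = 0" if "pderiv f = 0" for f unfolding pderiv_mult dp that by simp
  define Z where "Z = {v. a v = 0 \<and> act (p ^ r) v = 0}"
  have sZ: "subspace Z" unfolding Z_def by (rule subspaceI) (simp_all add: a_0 a_add a_scale)
  have eZ: "act f v \<in> Z" if "v \<in> Z" "pderiv f = 0" for v f
    using that unfolding Z_def by (simp add: a_act_even act_commute[of "p ^ r"])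
  have kZ: "act (p ^ r) v = 0" if "v \<in> Z" for v using that unfolding Z_def by blast
  have iZ: "b v (act (?q * f) w) = 0" if "v \<in> Z" "w \<in> Z" "pderiv f = 0" for v w f
    using ker_a_isotropic[of v "act (?q * f) w"] eZ[OF that(2) dq[OF that(3)]] that(1) unfolding Z_def by blast
  have "\<exists>E. orthogonal_generators p r Z E"
  proof (rule orthogonalization[OF pI(1,2) r sZ])
    show "act f v \<in> Z" if "v \<in> Z" "pderiv f = 0" for v f by (rule eZ[OF that])
    show "act (p ^ r) v = 0" if "v \<in> Z" for v by (rule kZ[OF that])
    show "b v (act (?q * f) w) = 0" if "v \<in> Z" "w \<in> Z" "pderiv f = 0" for v w f by (rule iZ[OF that])
  qed
  then obtain E where E: "finite E" "E \<subseteq> Z" "\<forall>x\<in>E. \<forall>y\<in>E. x \<noteq> y \<longrightarrow> (\<forall>f. b x (act (?q * f) y) = 0)"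
    and Eg: "\<forall>v\<in>Z. \<exists>w\<in>mspan E. v - w \<in> Z \<and> (\<forall>z\<in>Z. \<forall>f. b z (act (?q * f) (v - w)) = 0)"
    unfolding orthogonal_generators_def by (elim exE conjE)
  have dec: "\<exists>y\<in>Z. v - u y \<in> Z" if v: "act (p ^ r) v = 0" for v
  proof -
    obtain y where y: "a y = 0" "a (v - u y) = 0" "\<And>f. pderiv f = 0 \<Longrightarrow> act f v = 0 \<Longrightarrow> act f y = 0"
      by (rule ker_a_decomposition[of v]) blast
    have "act (p ^ r) y = 0" by (rule y(3)[OF dp v])
    then have "act (p ^ r) (v - u y) = 0" using v by (simp add: act_u)
    with \<open>act (p ^ r) y = 0\<close> show ?thesis using y(1,2) unfolding Z_def by blast
  qed
  have gen: "\<exists>w\<in>mspan E. \<exists>z. act ?q (v - w) = act (p ^ r) z" if v: "act (p ^ r) v = 0" for v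
  proof -
    obtain y where y: "y \<in> Z" "v - u y \<in> Z" using dec[OF v] by blast
    obtain w1 where w1: "w1 \<in> mspan E" and w1': "\<forall>z\<in>Z. \<forall>f. b z (act (?q * f) (v - u y - w1)) = 0" using Eg y(2) by blast
    obtain w2 where w2: "w2 \<in> mspan E" and w2': "\<forall>z\<in>Z. \<forall>f. b z (act (?q * f) (y - w2)) = 0" using Eg y(1) by blast
    let ?w = "w1 + u w2"
    have "(v - u y - w1) + u (y - w2) = (v + (w1 + u w2)) + (u y + u y)"
      unfolding vec_diff u_add by (simp only: ac_simps)
    then have "(v - u y - w1) + u (y - w2) = v + ?w" unfolding vec_double add_0_right .
    then have vw: "v - ?w = (v - u y - w1) + u (y - w2)" unfolding vec_diff[of v ?w] by (rule sym)
    have bZ: "b z (act (?q * f) (v - ?w)) = 0" if "z \<in> Z" for z f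
    proof -
      have e: "act (?q * f) (u (y - w2)) = act (?q * (f * monom 1 1)) (y - w2)"
        by (simp only: act_X[symmetric] act_mult)
      have "b z (act (?q * f) (u (y - w2))) = 0" unfolding e using w2' that by blast
      moreover have "b z (act (?q * f) (v - u y - w1)) = 0" using w1' that by blast
      ultimately show ?thesis unfolding vw act_vadd b_simps(1) by (simp only: add_0)
    qed
    have "\<exists>z. act ?q (v - ?w) = act (p ^ r) z"
    proof (rule perp_ker_subset_range)
      show "star (p ^ r) = p ^ r" using pI(2) by simp
      fix s assume "act (p ^ r) s = 0"
      then obtain t where t: "t \<in> Z" "s - u t \<in> Z" using dec by blast
      have "b (u t) (act ?q (v - ?w)) = b t (act (?q * monom 1 1) (v - ?w))"
        unfolding act_mult act_X b_u act_u ..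
      moreover have "b (s - u t) (act (?q * 1) (v - ?w)) = 0" by (rule bZ[OF t(2)])
      ultimately show "b s (act ?q (v - ?w)) = 0" using bZ[OF t(1)] by simp
    qed
    moreover have "?w \<in> mspan E"
      using invariant_mspan w2 unfolding invariant_def by (intro subspace_add[OF subspace_mspan w1]) blast
    ultimately show ?thesis by blast
  qed
  have "odd_frame p r UNIV E"
    unfolding odd_frame_def
  proof (intro conjI ballI allI impI)
    show "act (p ^ r) x = 0" if "x \<in> E" for x using that E(2) kZ by blast
    show "b x (act (?q * f) x) = 0" if "x \<in> E" "pderiv f = 0" for x f using that E(2) iZ by blast
    show "\<exists>w\<in>mspan E. \<exists>z\<in>UNIV. act ?q (v - w) = act (p ^ r) z" if "act (p ^ r) v = 0" for v
      using gen[OF that] by blast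
  qed (use E in auto)
  then show "\<exists>E. odd_frame p r UNIV E" by blast
qed

end

context hermitian_pair
begin

theorem sum_of_two_square_zero_iff: "sum_of_two_square_zero \<longleftrightarrow> no_odd_invariants UNIV \<and> odd_framed UNIV"
proof
  assume sum_of_two_square_zero
  then obtain a1 a2 where l: "Vector_Spaces.linear scale scale a1" "Vector_Spaces.linear scale scale a2"
    and s: "selfadjoint b a1" and z: "\<And>x. a1 (a1 x) = 0" "\<And>x. a2 (a2 x) = 0" and sum: "\<And>x. u x = a1 x + a2 x"
    unfolding sum_of_two_square_zero_def by blast
  have add: "a1 (x + y) = a1 x + a1 y" "a2 (x + y) = a2 x + a2 y" "a1 (scale c x) = scale c (a1 x)" for x y c
    using l by (simp_all add: module_hom.add module_hom.scale linear_iff_module_hom)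
  interpret square_zero_summand scale Basis bul b u a1
  proof
    show "a1 (u x) = u (a1 x) + u (u x)" for x
    proof -
      have e: "a1 (u x) = a1 (a2 x)" "u (a1 x) = a2 (a1 x)" "u (u x) = a1 (a2 x) + a2 (a1 x)"
        unfolding sum add z by simp_all
      have "a2 (a1 x) + (a1 (a2 x) + a2 (a1 x)) = a1 (a2 x) + (a2 (a1 x) + a2 (a1 x))" by (simp only: ac_simps)
      then show ?thesis unfolding e vec_double by simp
    qed
    show "b (a1 x) y = b x (a1 y)" for x y using s unfolding selfadjoint_def by blast
  qed (simp_all add: add z)
  show "no_odd_invariants UNIV \<and> odd_framed UNIV"
    using no_odd_invariants_UNIV odd_framed_UNIV by blast
next
  assume "no_odd_invariants UNIV \<and> odd_framed UNIV"
  moreover have "regular UNIV" unfolding regular_def using nondegD by blast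
  ultimately obtain X where "UNIV \<subseteq> mspan X" "even_isotropic X"
    using ex_even_isotropic_generators[OF invariant_UNIV] by blast
  then show sum_of_two_square_zero by (intro sum_of_two_square_zero_if_generators) auto
qed

end

section \<open>The residue field $F[t]/(p)$\<close>

lemma mem_PIdl_iff: "f \<in> PIdl\<^bsub>class_ring\<^esub> p \<longleftrightarrow> p dvd (f :: 'f::field poly)"
  unfolding cgenideal_def by (auto simp: dvd_def mult.commute)

lemma mem_residue_class_iff: "f \<in> residue_class p g \<longleftrightarrow> p dvd f - (g :: 'f::field poly)"
proof -
  have "f \<in> residue_class p g \<longleftrightarrow> (\<exists>h. p dvd h \<and> f = h + g)"
    unfolding residue_class_def a_r_coset_def' using mem_PIdl_iff[of _ p] by auto
  also have "\<dots> \<longleftrightarrow> p dvd f - g"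
    by (metis add_diff_cancel_right' diff_add_cancel)
  finally show ?thesis .
qed

lemma residue_class_eq_iff: "residue_class p f = residue_class p g \<longleftrightarrow> p dvd f - (g :: 'f::field poly)"
proof
  assume "residue_class p f = residue_class p g"
  moreover have "f \<in> residue_class p f" by (simp add: mem_residue_class_iff)
  ultimately show "p dvd f - g" by (simp add: mem_residue_class_iff)
next
  assume d: "p dvd f - g"
  have "p dvd h - f \<longleftrightarrow> p dvd h - g" for h
  proof -
    have "h - g = (h - f) + (f - g)" by simp
    then show ?thesis using d by (metis dvd_add_left_iff)
  qed
  then show "residue_class p f = residue_class p g" by (intro Set.set_eqI) (simp only: mem_residue_class_iff)
qed

lemma ideal_PIdl: "ideal (PIdl\<^bsub>class_ring\<^esub> p) (class_ring :: 'f::field poly ring)"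
  by (rule cring.cgenideal_ideal[OF class_cring.is_cring]) simp

lemma carrier_residue_field: "carrier (residue_field p) = range (residue_class (p :: 'f::field poly))"
  unfolding FactRing_def A_RCOSETS_def' residue_class_def by auto

lemma residue_class_hom: "residue_class p \<in> Ring.ring_hom (class_ring :: 'f::field poly ring) (residue_field p)"
  using ideal.rcos_ring_hom[OF ideal_PIdl[of p]] unfolding residue_class_def by (simp add: fun_eq_iff)

lemma residue_field_ops:
  fixes p f g :: "'f::field poly"
  shows "residue_class p f \<otimes>\<^bsub>residue_field p\<^esub> residue_class p g = residue_class p (f * g)"
    "residue_class p f \<oplus>\<^bsub>residue_field p\<^esub> residue_class p g = residue_class p (f + g)"
    "\<one>\<^bsub>residue_field p\<^esub> = residue_class p 1" "\<zero>\<^bsub>residue_field p\<^esub> = residue_class p 0"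
proof -
  note h = residue_class_hom[of p]
  show "residue_class p f \<otimes>\<^bsub>residue_field p\<^esub> residue_class p g = residue_class p (f * g)"
    using ring_hom_mult[OF h, of f g] by simp
  show "residue_class p f \<oplus>\<^bsub>residue_field p\<^esub> residue_class p g = residue_class p (f + g)"
    using ring_hom_add[OF h, of f g] by simp
  show "\<one>\<^bsub>residue_field p\<^esub> = residue_class p 1"
    using ring_hom_one[OF h] by simp
  have "\<zero>\<^bsub>residue_field p\<^esub> = PIdl\<^bsub>class_ring\<^esub> p" unfolding FactRing_def by simp
  also have "\<dots> = residue_class p 0"
    by (intro Set.set_eqI) (simp add: mem_PIdl_iff mem_residue_class_iff)
  finally show "\<zero>\<^bsub>residue_field p\<^esub> = residue_class p 0" .
qed

lemma field_residue_field:
  fixes p :: "'f::field poly"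
  assumes "irreducible p"
  shows "field (residue_field p)"
proof -
  let ?R = "class_ring :: 'f poly ring"
  have "maximalideal (PIdl\<^bsub>?R\<^esub> p) ?R"
  proof (rule maximalidealI[OF ideal_PIdl])
    have "\<not> p dvd 1" using irreducible_not_unit[OF assms] by simp
    then have "1 \<notin> PIdl\<^bsub>?R\<^esub> p" by (simp add: mem_PIdl_iff)
    then show "carrier ?R \<noteq> PIdl\<^bsub>?R\<^esub> p" by auto
    fix J assume J: "ideal J ?R" "PIdl\<^bsub>?R\<^esub> p \<subseteq> J"
    show "J = PIdl\<^bsub>?R\<^esub> p \<or> J = carrier ?R"
    proof (rule disjCI)
      assume "J \<noteq> carrier ?R"
      have "p dvd f" if f: "f \<in> J" for f
      proof (rule ccontr)
        assume "\<not> p dvd f"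
        then obtain s t where st: "s * f + t * p = 1" using poly_bezout_irreducible[OF assms] by blast
        have pJ: "p \<in> J" using J(2) mem_PIdl_iff[of p p] by auto
        have JJ: "x * y \<in> J" if "y \<in> J" for x y
          using ideal.I_l_closed[OF J(1) that, of x] by simp
        have JA: "x + y \<in> J" if "x \<in> J" "y \<in> J" for x y
          using additive_subgroup.a_closed[OF ideal.axioms(1)[OF J(1)] that] by simp
        have "1 \<in> J" using JA[OF JJ[OF f, of s] JJ[OF pJ, of t]] unfolding st .
        then have "x \<in> J" for x using JJ[of 1 x] by simp
        then show False using \<open>J \<noteq> carrier ?R\<close> by auto
      qed
      then show "J = PIdl\<^bsub>?R\<^esub> p" using J(2) mem_PIdl_iff[of _ p] by blast
    qed
  qed
  moreover have "cring ?R" by (rule class_cring.is_cring)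
  ultimately show ?thesis by (rule maximalideal.quotient_is_field)
qed

lemma residue_form_class:
  fixes p f :: "'f::field poly"
  assumes "irreducible p"
  shows "residue_form p (residue_class p f) = coeff (f mod p) 0"
  unfolding residue_form_def
proof (rule the_equality)
  have p: "p \<noteq> 0" "degree p > 0" using assms irreducible_degree_pos by auto
  have "degree (f mod p) < degree p" using degree_mod_less[OF p(1), of f] p(2) by auto
  moreover have "f mod p \<in> residue_class p f"
    unfolding mem_residue_class_iff by (metis dvd_minus_mod dvd_minus_iff minus_diff_eq)
  ultimately show "\<exists>q\<in>residue_class p f. degree q < degree p \<and> coeff (f mod p) 0 = coeff q 0" by blast
  fix c assume "\<exists>q\<in>residue_class p f. degree q < degree p \<and> c = coeff q 0"
  then obtain q where qm: "q \<in> residue_class p f" and q: "degree q < degree p" "c = coeff q 0" by blast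
  have pq: "p dvd q - f" using qm by (simp only: mem_residue_class_iff)
  have "q = q mod p" using q(1) by (simp add: mod_poly_less)
  also have "\<dots> = f mod p" using pq by (simp only: mod_eq_dvd_iff)
  finally show "c = coeff (f mod p) 0" using q(2) by simp
qed

definition const_coeff :: "'f::field poly \<Rightarrow> 'f poly \<Rightarrow> 'f" where
  "const_coeff p f = coeff (f mod p) 0"

lemma functional_const_coeff: "functional (const_coeff p)"
  unfolding functional_def const_coeff_def by (simp add: poly_mod_add_left mod_smult_left)

lemma const_coeff_mult: "const_coeff p (p * f) = 0"
  unfolding const_coeff_def by simp

lemma const_coeff_1: "irreducible (p :: 'f::field poly) \<Longrightarrow> const_coeff p 1 = 1"
  unfolding const_coeff_def using irreducible_degree_pos[of p] by (simp add: mod_poly_less)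

context char2_involution
begin

lemma const_coeff_star:
  assumes "irreducible p" "star p = p"
  shows "const_coeff p (star f) = bul (const_coeff p f)"
proof -
  have p: "p \<noteq> 0" "degree p > 0" using assms(1) irreducible_degree_pos by auto
  have d: "degree (star (f mod p)) < degree p" using degree_mod_less[OF p(1), of f] p(2) by auto
  have "star f = star (p * (f div p) + f mod p)" by simp
  also have "\<dots> = p * star (f div p) + star (f mod p)" unfolding star_add star_mult assms(2) ..
  finally have "star f mod p = star (f mod p) mod p" by (simp only: mod_mult_self4)
  then show ?thesis unfolding const_coeff_def using d by (simp add: mod_poly_less)
qed

text \<open>Modulo $p$, the polynomial $e$ may be taken of even degree less than the even degree of $p$; then $te$ is
  reduced and has constant term 0. This is where the factor $t$ in odd representability comes from.\<close>

lemma const_coeff_odd: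
  fixes p e :: "'f poly"
  assumes "irreducible p" "pderiv p = 0" "pderiv e = 0"
  shows "const_coeff p (monom 1 1 * e) = 0"
proof -
  have p: "p \<noteq> 0" "degree p > 0" using assms(1) irreducible_degree_pos by auto
  let ?e = "e mod p"
  have ev: "pderiv ?e = 0" by (rule pderiv_mod_0[OF assms(2) p assms(3)])
  have "const_coeff p (monom 1 1 * e) = const_coeff p (monom 1 1 * ?e)"
    unfolding const_coeff_def by (simp only: mod_mult_right_eq)
  also have "\<dots> = 0"
  proof (cases "?e = 0")
    case True
    then show ?thesis by (simp only: mult_zero_right functional_0[OF functional_const_coeff])
  next
    case False
    have "even (degree p)" using odd_coeff_0[OF assms(2), of "degree p"] p(1) by auto
    moreover have "even (degree ?e)" using odd_coeff_0[OF ev, of "degree ?e"] False by auto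
    moreover have "degree ?e < degree p" using degree_mod_less[OF p(1), of e] False by auto
    ultimately have "Suc (degree ?e) < degree p" by presburger
    moreover have "degree (monom 1 1 * ?e) = Suc (degree ?e)"
      using False by (simp add: degree_mult_eq degree_monom_eq)
    ultimately have "(monom 1 1 * ?e) mod p = monom 1 1 * ?e" by (intro mod_poly_less) simp
    then show ?thesis unfolding const_coeff_def by (simp add: coeff_mult)
  qed
  finally show ?thesis .
qed

end

section \<open>The spaces $V_{p,r}$\<close>

locale primary_quotient = hermitian_pair scale Basis bul b u
  for scale :: "'f::field \<Rightarrow> 'v::ab_group_add \<Rightarrow> 'v" and Basis bul b u +
  fixes p :: "'f poly" and r :: nat
  assumes p: "p \<in> Irr" and r: "r \<ge> 1"
begin

abbreviation "denom \<equiv> primary_denom scale u p r"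
abbreviation "coset \<equiv> vec_coset denom"
abbreviation "ker \<equiv> ker_pow scale u p r"
abbreviation "M \<equiv> primary_space scale u p r"
abbreviation "L \<equiv> residue_field p"
abbreviation "q \<equiv> p ^ (r - 1)"

lemma p_irreducible: "irreducible p" using p unfolding Irr_def by blast

lemma p_q: "p * q = p ^ r" using r by (cases r) auto

lemma mem_ker: "x \<in> ker \<longleftrightarrow> act (p ^ r) x = 0"
  unfolding ker_pow_def by (simp add: act_power)

text \<open>The second summand of the denominator consists of the $p(u)z$ in $ker p(u)^r$, and $x - p(u)z$ is killed by
  $p(u)^{r-1}$ iff $p(u)^{r-1}x = p(u)^r z$.\<close>

lemma mem_denom: "x \<in> denom \<longleftrightarrow> act (p ^ r) x = 0 \<and> (\<exists>z. act q x = act (p ^ r) z)"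
proof
  assume "x \<in> denom"
  then obtain y w where x: "x = y + act p w" and y: "act q y = 0" and w: "act (p ^ r) (act p w) = 0"
    unfolding primary_denom_def ker_pow_def by (auto simp: act_power)
  have "act (p ^ r) y = 0" using y unfolding p_q[symmetric] act_mult by simp
  then have "act (p ^ r) x = 0" using w unfolding x by simp
  moreover have "act q x = act (p ^ r) w" using y unfolding x p_q[symmetric] by (simp add: act_mult')
  ultimately show "act (p ^ r) x = 0 \<and> (\<exists>z. act q x = act (p ^ r) z)" by blast
next
  assume "act (p ^ r) x = 0 \<and> (\<exists>z. act q x = act (p ^ r) z)"
  then obtain z where x: "act (p ^ r) x = 0" and z: "act q x = act (p ^ r) z" by blast
  have qp: "act q (act p z) = act (p ^ r) z" unfolding p_q[symmetric] by (simp add: act_mult')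
  have "act q (x - act p z) = 0" unfolding act_vdiff z qp by simp
  moreover have "act (p ^ r) (act p z) = act p (act q x)" unfolding z by (simp add: act_commute[of p])
  moreover have "act p (act q x) = 0" using x unfolding p_q[symmetric] act_mult .
  moreover have "x = (x - act p z) + act p z" by simp
  ultimately show "x \<in> denom"
    unfolding primary_denom_def ker_pow_def act_power mem_Collect_eq Int_iff
    by (intro exI[of _ "x - act p z"] exI[of _ "act p z"]) auto
qed

lemma invariant_ker: "invariant ker"
  unfolding invariant_def subspace_def by (auto simp: mem_ker act_u)

lemma denomI: "act (p ^ r) x = 0 \<Longrightarrow> act q x = act (p ^ r) z \<Longrightarrow> x \<in> denom"
  unfolding mem_denom by blast

lemma denomE:
  assumes "x \<in> denom"
  obtains z where "act (p ^ r) x = 0" "act q x = act (p ^ r) z"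
  using assms unfolding mem_denom by blast

lemma invariant_denom: "invariant denom"
  unfolding invariant_def
proof
  show "subspace denom"
  proof (rule subspaceI)
    show "0 \<in> denom" by (rule denomI[of 0 0]) simp_all
    show "x + y \<in> denom" if x: "x \<in> denom" and y: "y \<in> denom" for x y
    proof -
      obtain z z' where "act (p ^ r) x = 0" "act q x = act (p ^ r) z" "act (p ^ r) y = 0" "act q y = act (p ^ r) z'"
        using denomE[OF x] denomE[OF y] by metis
      then show ?thesis by (intro denomI[of "x + y" "z + z'"]) (simp_all only: act_vadd add_0)
    qed
    show "scale c x \<in> denom" if x: "x \<in> denom" for c x
    proof -
      obtain z where "act (p ^ r) x = 0" "act q x = act (p ^ r) z" using denomE[OF x] by metis
      then show ?thesis by (intro denomI[of "scale c x" "scale c z"]) (simp_all only: act_vscale scale_zero_right)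
    qed
  qed
  show "\<forall>x\<in>denom. u x \<in> denom"
  proof
    fix x assume x: "x \<in> denom"
    obtain z where "act (p ^ r) x = 0" "act q x = act (p ^ r) z" using denomE[OF x] by metis
    then show "u x \<in> denom" by (intro denomI[of "u x" "u z"]) (simp_all only: act_u u_0)
  qed
qed

lemma subspace_denom: "subspace denom" using invariant_denom invariant_def by blast

lemma denom_ker: "x \<in> denom \<Longrightarrow> x \<in> ker" unfolding mem_denom mem_ker by blast

lemma act_p_denom: "x \<in> ker \<Longrightarrow> act (p * f) x \<in> denom"
proof -
  assume x: "x \<in> ker"
  have "act q (act (p * f) x) = act f (act (p ^ r) x)" unfolding p_q[symmetric] act_mult[symmetric] by (simp add: mult_ac)
  also have "\<dots> = act (p ^ r) 0" using x by (simp add: mem_ker)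
  finally have "\<exists>z. act q (act (p * f) x) = act (p ^ r) z" by blast
  moreover have "act (p ^ r) (act (p * f) x) = 0" using invariant_act[OF invariant_ker x] by (simp add: mem_ker)
  ultimately show ?thesis unfolding mem_denom by blast
qed

lemma mem_coset: "y \<in> coset x \<longleftrightarrow> y - x \<in> denom"
proof -
  have "y \<in> coset x \<longleftrightarrow> (\<exists>w. w \<in> denom \<and> y = x + w)" unfolding vec_coset_def by auto
  then show ?thesis by (metis add_diff_cancel_left' le_add_diff_inverse add.commute diff_add_cancel)
qed

lemma coset_self: "x \<in> coset x" using subspace_0[OF subspace_denom] by (simp add: mem_coset)

lemma coset_eq: "coset x = coset y \<longleftrightarrow> x - y \<in> denom"
proof
  assume "coset x = coset y"
  then show "x - y \<in> denom" using coset_self[of x] by (simp add: mem_coset)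
next
  assume d: "x - y \<in> denom"
  have "z - x \<in> denom \<longleftrightarrow> z - y \<in> denom" for z
  proof
    assume "z - x \<in> denom"
    from subspace_add[OF subspace_denom this d] show "z - y \<in> denom"
      by (simp only: add_diff_eq diff_add_cancel)
  next
    assume "z - y \<in> denom"
    from subspace_diff[OF subspace_denom this d] show "z - x \<in> denom"
      by (simp only: diff_diff_eq2 diff_add_cancel)
  qed
  then show "coset x = coset y" by (intro Set.set_eqI) (simp only: mem_coset)
qed

lemma coset_ker:
  assumes "x \<in> ker" "y \<in> coset x"
  shows "y \<in> ker"
proof -
  have "subspace ker" using invariant_ker invariant_def by blast
  from subspace_add[OF this assms(1) denom_ker[OF assms(2)[unfolded mem_coset]]]
  show ?thesis by simp
qed

lemma carrier_M: "carrier M = coset ` ker"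
  unfolding primary_space_def by simp

lemma zero_M: "\<zero>\<^bsub>M\<^esub> = coset 0"
proof -
  have "\<zero>\<^bsub>M\<^esub> = denom" unfolding primary_space_def by simp
  also have "\<dots> = coset 0" by (intro Set.set_eqI) (simp add: mem_coset)
  finally show ?thesis .
qed

lemma add_M: "coset x \<oplus>\<^bsub>M\<^esub> coset y = coset (x + y)"
proof -
  have "coset x \<oplus>\<^bsub>M\<^esub> coset y = {v + w | v w. v \<in> coset x \<and> w \<in> coset y}" unfolding primary_space_def by simp
  also have "\<dots> = coset (x + y)"
  proof (intro Set.set_eqI iffI)
    fix z assume "z \<in> {v + w | v w. v \<in> coset x \<and> w \<in> coset y}"
    then obtain v w where z: "z = v + w" "v - x \<in> denom" "w - y \<in> denom" unfolding mem_coset by blast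
    from subspace_add[OF subspace_denom z(2,3)] show "z \<in> coset (x + y)"
      unfolding mem_coset z(1) by (simp only: add_diff_add)
  next
    fix z assume "z \<in> coset (x + y)"
    then have "(z - y) \<in> coset x" unfolding mem_coset by (simp add: diff_diff_eq add.commute del: vec_uminus)
    moreover have "z = (z - y) + y" by simp
    ultimately show "z \<in> {v + w | v w. v \<in> coset x \<and> w \<in> coset y}" using coset_self by blast
  qed
  finally show ?thesis .
qed

lemma smult_M:
  assumes x: "x \<in> ker"
  shows "residue_class p f \<odot>\<^bsub>M\<^esub> coset x = coset (act f x)"
proof -
  have c: "coset (act g y) = coset (act f x)" if gy: "g \<in> residue_class p f" "y \<in> coset x" for g y
  proof -
    obtain h where h: "g - f = p * h" using gy(1) unfolding mem_residue_class_iff dvd_def by blast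
    have "act g y - act f x = act (g - f) y + act f (y - x)" by simp
    moreover have "act (g - f) y \<in> denom" unfolding h by (rule act_p_denom[OF coset_ker[OF x gy(2)]])
    moreover have "act f (y - x) \<in> denom" using gy(2) unfolding mem_coset by (rule invariant_act[OF invariant_denom])
    ultimately show ?thesis unfolding coset_eq using subspace_add[OF subspace_denom] by metis
  qed
  have "residue_class p f \<odot>\<^bsub>M\<^esub> coset x = (\<Union>g\<in>residue_class p f. \<Union>y\<in>coset x. coset (act g y))"
    unfolding primary_space_def by simp
  also have "\<dots> = coset (act f x)"
  proof -
    have "f \<in> residue_class p f" by (simp add: mem_residue_class_iff)
    then show ?thesis using c coset_self[of x] by blast
  qed
  finally show ?thesis .
qed

lemma vectorspace_M: "vectorspace L M"
proof (rule vs_criteria[OF field_residue_field[OF p_irreducible]])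
  have k: "0 \<in> ker" "\<And>x y. x \<in> ker \<Longrightarrow> y \<in> ker \<Longrightarrow> x + y \<in> ker" "\<And>f x. x \<in> ker \<Longrightarrow> act f x \<in> ker"
    using invariant_ker invariant_act[OF invariant_ker] unfolding invariant_def by (auto intro: subspace_0 subspace_add)
  note ops = carrier_M zero_M carrier_residue_field
  show "\<zero>\<^bsub>M\<^esub> \<in> carrier M" unfolding ops using k(1) by blast
  show "\<forall>v w. v \<in> carrier M \<and> w \<in> carrier M \<longrightarrow> v \<oplus>\<^bsub>M\<^esub> w \<in> carrier M"
    unfolding ops using k(2) by (auto simp: add_M)
  show "\<forall>v\<in>carrier M. \<exists>w\<in>carrier M. v \<oplus>\<^bsub>M\<^esub> w = \<zero>\<^bsub>M\<^esub>"
    unfolding ops by (auto simp: add_M vec_double intro!: bexI)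
  show "\<forall>c v. c \<in> carrier L \<and> v \<in> carrier M \<longrightarrow> c \<odot>\<^bsub>M\<^esub> v \<in> carrier M"
    unfolding ops using k(3) by (auto simp: smult_M)
  show "\<forall>v w. v \<in> carrier M \<and> w \<in> carrier M \<longrightarrow> v \<oplus>\<^bsub>M\<^esub> w = w \<oplus>\<^bsub>M\<^esub> v"
    unfolding ops by (auto simp: add_M add.commute)
  show "\<forall>v w x. v \<in> carrier M \<and> w \<in> carrier M \<and> x \<in> carrier M \<longrightarrow> v \<oplus>\<^bsub>M\<^esub> w \<oplus>\<^bsub>M\<^esub> x = v \<oplus>\<^bsub>M\<^esub> (w \<oplus>\<^bsub>M\<^esub> x)"
    unfolding ops by (auto simp: add_M add.assoc)
  show "\<forall>v\<in>carrier M. v \<oplus>\<^bsub>M\<^esub> \<zero>\<^bsub>M\<^esub> = v"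
    unfolding ops by (auto simp: add_M)
  show "\<forall>a b v. a \<in> carrier L \<and> b \<in> carrier L \<and> v \<in> carrier M \<longrightarrow> a \<otimes>\<^bsub>L\<^esub> b \<odot>\<^bsub>M\<^esub> v = a \<odot>\<^bsub>M\<^esub> (b \<odot>\<^bsub>M\<^esub> v)"
    unfolding ops using k(3) by (auto simp: residue_field_ops smult_M act_mult)
  show "\<forall>v\<in>carrier M. \<one>\<^bsub>L\<^esub> \<odot>\<^bsub>M\<^esub> v = v"
    unfolding ops by (auto simp: residue_field_ops smult_M)
  show "\<forall>a b v. a \<in> carrier L \<and> b \<in> carrier L \<and> v \<in> carrier M \<longrightarrow> (a \<oplus>\<^bsub>L\<^esub> b) \<odot>\<^bsub>M\<^esub> v = a \<odot>\<^bsub>M\<^esub> v \<oplus>\<^bsub>M\<^esub> b \<odot>\<^bsub>M\<^esub> v"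
    unfolding ops by (auto simp: residue_field_ops smult_M add_M)
  show "\<forall>a v w. a \<in> carrier L \<and> v \<in> carrier M \<and> w \<in> carrier M \<longrightarrow> a \<odot>\<^bsub>M\<^esub> (v \<oplus>\<^bsub>M\<^esub> w) = a \<odot>\<^bsub>M\<^esub> v \<oplus>\<^bsub>M\<^esub> a \<odot>\<^bsub>M\<^esub> w"
    unfolding ops using k(2) by (auto simp: smult_M add_M)
qed

sublocale VS: vectorspace L M by (rule vectorspace_M)

lemma ex_coset: "X \<in> carrier M \<Longrightarrow> \<exists>x\<in>ker. X = coset x"
  unfolding carrier_M by blast

lemma span_cosets:
  assumes X: "X \<subseteq> ker"
  shows "VS.span (coset ` X) = coset ` mspan X"
proof
  have mk: "mspan X \<subseteq> ker" by (rule mspan_minimal[OF X invariant_ker])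
  have cX: "coset ` X \<subseteq> carrier M" using X carrier_M by blast
  have "submodule L (coset ` mspan X) M"
  proof
    show "coset ` mspan X \<subseteq> carrier M" using mk carrier_M by blast
    show "v \<oplus>\<^bsub>M\<^esub> w \<in> coset ` mspan X" if "v \<in> coset ` mspan X" "w \<in> coset ` mspan X" for v w
      using that subspace_add[OF subspace_mspan] by (auto simp: add_M)
    show "\<zero>\<^bsub>M\<^esub> \<in> coset ` mspan X" unfolding zero_M using subspace_0[OF subspace_mspan] by blast
    show "c \<odot>\<^bsub>M\<^esub> v \<in> coset ` mspan X" if c: "c \<in> carrier L" and v: "v \<in> coset ` mspan X" for c v
    proof -
      obtain f where f: "c = residue_class p f" using c unfolding carrier_residue_field by blast
      obtain x where x: "x \<in> mspan X" "v = coset x" using v by blast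
      have "c \<odot>\<^bsub>M\<^esub> v = coset (act f x)" unfolding f x(2) using x(1) mk by (intro smult_M) blast
      then show ?thesis using invariant_act[OF invariant_mspan x(1)] by blast
    qed
  qed
  moreover have "coset ` X \<subseteq> coset ` mspan X" using subset_mspan by blast
  ultimately show "VS.span (coset ` X) \<subseteq> coset ` mspan X" by (intro VS.span_is_subset)
  have sm: "submodule L (VS.span (coset ` X)) M" by (rule VS.span_is_submodule[OF cX])
  let ?S = "{v. v \<in> ker \<and> coset v \<in> VS.span (coset ` X)}"
  have "v \<in> ker \<and> coset v \<in> VS.span (coset ` X)" if "v \<in> mspan X" for v
    using that
  proof (rule mspan_induct)
    show "subspace ?S"
    proof (rule subspaceI)
      have sk: "subspace ker" using invariant_ker invariant_def by blast
      show "0 \<in> ?S"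
        using submodule.zero_closed[OF sm] subspace_0[OF sk] unfolding zero_M by blast
      show "v + w \<in> ?S"
        if "v \<in> ?S" "w \<in> ?S" for v w
        using that submodule.m_closed[OF sm, of "coset v" "coset w"] subspace_add[OF sk, of v w] unfolding add_M by blast
      show "scale c v \<in> ?S"
        if "v \<in> ?S" for c v
      proof -
        have v: "v \<in> ker" "coset v \<in> VS.span (coset ` X)" using that by blast+
        have "residue_class p [:c:] \<in> carrier L" unfolding carrier_residue_field by blast
        from submodule.smult_closed[OF sm this v(2)]
        have "coset (act [:c:] v) \<in> VS.span (coset ` X)" unfolding smult_M[OF v(1)] .
        then show ?thesis using subspace_scale[OF sk v(1)] by simp
      qed
    qed
    fix f x assume x: "x \<in> X"
    then have "x \<in> ker" using X by blast
    have "residue_class p f \<in> carrier L" unfolding carrier_residue_field by blast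
    moreover have "coset x \<in> VS.span (coset ` X)" using VS.in_own_span[OF cX] x by blast
    ultimately have "residue_class p f \<odot>\<^bsub>M\<^esub> coset x \<in> VS.span (coset ` X)" by (rule submodule.smult_closed[OF sm])
    then show "act f x \<in> ker \<and> coset (act f x) \<in> VS.span (coset ` X)"
      unfolding smult_M[OF \<open>x \<in> ker\<close>] using invariant_act[OF invariant_ker \<open>x \<in> ker\<close>] by blast
  qed
  then show "coset ` mspan X \<subseteq> VS.span (coset ` X)" by blast
qed

lemma gen_set_iff:
  assumes X: "X \<subseteq> ker"
  shows "VS.gen_set (coset ` X) \<longleftrightarrow> (\<forall>v\<in>ker. \<exists>w\<in>mspan X. v - w \<in> denom)"
proof -
  have mk: "mspan X \<subseteq> ker" by (rule mspan_minimal[OF X invariant_ker])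
  have "VS.gen_set (coset ` X) \<longleftrightarrow> coset ` ker \<subseteq> coset ` mspan X"
    unfolding span_cosets[OF X] carrier_M using mk by blast
  also have "\<dots> \<longleftrightarrow> (\<forall>v\<in>ker. \<exists>w\<in>mspan X. coset v = coset w)" by (auto simp: image_subset_iff image_iff)
  finally show ?thesis unfolding coset_eq .
qed

text \<open>The dimension is a least cardinality, so a finite generating family is exhibited first; otherwise
  a value 0 would carry no information.\<close>

lemma primary_number_eq_0_iff: "primary_number scale u p r = 0 \<longleftrightarrow> ker \<subseteq> denom"
proof
  assume "ker \<subseteq> denom"
  then have "VS.gen_set (coset ` {0})"
    using subspace_0[OF subspace_mspan] invariant_ker
    by (subst gen_set_iff) (auto simp: invariant_def subspace_0 intro!: bexI[of _ 0])
  then show "primary_number scale u p r = 0"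
    unfolding primary_number_def using VS.dim0I by (simp add: zero_M)
next
  assume d: "primary_number scale u p r = 0"
  let ?P = "\<lambda>n. \<exists>A. finite A \<and> card A = n \<and> A \<subseteq> carrier M \<and> VS.gen_set A"
  obtain B where B: "B \<subseteq> ker" "independent B" "ker \<subseteq> span B" by (rule basis_exists[of ker])
  have "span B \<subseteq> mspan B" by (rule span_minimal[OF subset_mspan subspace_mspan])
  then have "VS.gen_set (coset ` B)"
    unfolding gen_set_iff[OF B(1)] using B(3) subspace_0[OF subspace_denom] by (auto intro!: bexI)
  moreover have "finite (coset ` B)" using finiteI_independent[OF B(2)] by simp
  moreover have "coset ` B \<subseteq> carrier M" using B(1) carrier_M by blast
  ultimately have "?P (card (coset ` B))" by blast
  then have "?P (LEAST n. ?P n)" by (rule LeastI)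
  moreover have "(LEAST n. ?P n) = 0" using d unfolding primary_number_def VS.dim_def .
  ultimately obtain A where A: "finite A" "card A = 0" "VS.gen_set A" by auto
  then have "VS.gen_set (coset ` {})" by simp
  then have g: "\<forall>v\<in>ker. \<exists>w\<in>mspan {}. v - w \<in> denom" by (subst (asm) gen_set_iff) auto
  have "mspan {} = {0}" unfolding mspan_def by simp
  then show "ker \<subseteq> denom" using g by auto
qed

end

section \<open>The Hermitian invariants\<close>

locale hermitian_primary_quotient = primary_quotient scale Basis bul b u p r
  for scale :: "'f::field \<Rightarrow> 'v::ab_group_add \<Rightarrow> 'v" and Basis bul b u p r +
  assumes star_p: "star p = p"
begin

abbreviation "invariant_form \<equiv> hermitian_invariant scale b u p r"

abbreviation "coset_form \<equiv> induced_form scale b u p r"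

abbreviation "odd_value \<Lambda> \<equiv> \<exists>s\<in>fixed_polys bul. \<Lambda> = residue_class p (monom 1 1 * at_t2 s)"

lemma b_q: "b (act q x) y = b x (act q y)" unfolding b_act by (simp add: star_p)

lemma induced_form_eq:
  assumes "x \<in> ker" "y \<in> ker"
  shows "coset_form (coset x) (coset y) = b x (act q y)"
proof -
  have c: "b x' (act q y') = b x (act q y)" if xy: "x' \<in> coset x" "y' \<in> coset y" for x' y'
  proof -
    have d: "x' - x \<in> denom" "y' - y \<in> denom" using xy unfolding mem_coset by blast+
    have yk: "y' \<in> ker" by (rule coset_ker[OF assms(2) xy(2)])
    obtain z where z: "act q (x' - x) = act (p ^ r) z" using denomE[OF d(1)] by metis
    obtain w where w: "act q (y' - y) = act (p ^ r) w" using denomE[OF d(2)] by metis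
    have "b (x' - x) (act q y') = b z (act (p ^ r) y')" unfolding b_q[symmetric] z b_act by (simp add: star_p)
    also have "\<dots> = 0" using yk by (simp add: mem_ker)
    finally have 1: "b x' (act q y') = b x (act q y')" by simp
    have "b x (act q (y' - y)) = b (act (p ^ r) x) w" unfolding w b_act by (simp add: star_p)
    also have "\<dots> = 0" using assms(1) by (simp add: mem_ker)
    finally have "b x (act q y') = b x (act q y)" by simp
    then show ?thesis using 1 by (simp only:)
  qed
  show ?thesis
    unfolding induced_form_def act_power
  proof (rule the_equality)
    show "\<forall>x'\<in>coset x. \<forall>y'\<in>coset y. b x' (act q y') = b x (act q y)" using c by blast
    fix e assume "\<forall>x'\<in>coset x. \<forall>y'\<in>coset y. b x' (act q y') = e"
    then have "b x (act q y) = e" using coset_self by simp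
    then show "e = b x (act q y)" by (rule sym)
  qed
qed

text \<open>A polynomial $\<beta>$ whose class is the value at $(x,y)$ of the Hermitian invariant.\<close>

definition represents :: "'v \<Rightarrow> 'v \<Rightarrow> 'f poly \<Rightarrow> bool" where
  "represents x y \<beta> \<longleftrightarrow> (\<forall>f. b x (act (q * f) y) = const_coeff p (\<beta> * f))"

lemma ex_represents:
  assumes "y \<in> ker"
  shows "\<exists>\<beta>. represents x y \<beta>"
proof -
  have "functional (\<lambda>f. b x (act (q * f) y))"
    using functional_mult_left[OF functional_b_act[of x y], of q] .
  moreover have "b x (act (q * (p ^ 1 * f)) y) = 0" for f
  proof -
    have e: "q * (p ^ 1 * f) = f * p ^ r" unfolding p_q[symmetric] by (simp add: mult_ac)
    show ?thesis unfolding e act_mult using assms by (simp add: mem_ker)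
  qed
  moreover have "const_coeff p (p ^ (1 - 1) * 1) \<noteq> 0" using const_coeff_1[OF p_irreducible] by simp
  moreover have "const_coeff p (p ^ 1 * f) = 0" for f by (simp add: const_coeff_mult)
  ultimately show ?thesis
    using functional_duality[OF p_irreducible functional_const_coeff, of p 1 1 "\<lambda>f. b x (act (q * f) y)"]
    unfolding represents_def by metis
qed

lemma represents_unique:
  assumes "represents x y \<beta>" "\<And>f. const_coeff p (\<gamma> * f) = const_coeff p (\<beta> * f)"
  shows "residue_class p \<gamma> = residue_class p \<beta>"
  unfolding residue_class_eq_iff
proof (rule dvd_if_functional_vanishes[OF p_irreducible functional_const_coeff const_coeff_mult])
  show "const_coeff p 1 \<noteq> 0" using const_coeff_1[OF p_irreducible] by simp
  show "const_coeff p ((\<gamma> - \<beta>) * f) = 0" for f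
    unfolding left_diff_distrib functional_diff[OF functional_const_coeff] assms(2) by simp
qed

lemma hermitian_invariant_eq:
  assumes x: "x \<in> ker" and y: "y \<in> ker" and \<beta>: "represents x y \<beta>"
  shows "invariant_form (coset x) (coset y) = residue_class p \<beta>"
proof -
  have form_eq: "coset_form (coset x) (residue_class p f \<odot>\<^bsub>M\<^esub> coset y) = const_coeff p (\<beta> * f)" for f
  proof -
    have "act f y \<in> ker" by (rule invariant_act[OF invariant_ker y])
    then have "coset_form (coset x) (coset (act f y)) = b x (act (q * f) y)"
      unfolding act_mult by (rule induced_form_eq[OF x])
    then show ?thesis using \<beta> unfolding smult_M[OF y] represents_def by simp
  qed
  have rf: "residue_form p (residue_class p f \<otimes>\<^bsub>L\<^esub> residue_class p g) = const_coeff p (g * f)" for f g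
    unfolding residue_field_ops residue_form_class[OF p_irreducible] const_coeff_def by (simp only: mult.commute)
  show ?thesis
    unfolding hermitian_invariant_def
  proof (rule the_equality)
    show "residue_class p \<beta> \<in> carrier L \<and> (\<forall>\<Lambda>\<in>carrier L.
        coset_form (coset x) (\<Lambda> \<odot>\<^bsub>M\<^esub> coset y) = residue_form p (\<Lambda> \<otimes>\<^bsub>L\<^esub> residue_class p \<beta>))"
      unfolding carrier_residue_field by (auto simp: form_eq rf)
    fix \<Gamma> assume \<Gamma>: "\<Gamma> \<in> carrier L \<and> (\<forall>\<Lambda>\<in>carrier L.
        coset_form (coset x) (\<Lambda> \<odot>\<^bsub>M\<^esub> coset y) = residue_form p (\<Lambda> \<otimes>\<^bsub>L\<^esub> \<Gamma>))"
    then obtain \<gamma> where \<gamma>: "\<Gamma> = residue_class p \<gamma>" unfolding carrier_residue_field by blast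
    have "const_coeff p (\<gamma> * f) = const_coeff p (\<beta> * f)" for f
    proof -
      have "residue_class p f \<in> carrier L" unfolding carrier_residue_field by blast
      then have "coset_form (coset x) (residue_class p f \<odot>\<^bsub>M\<^esub> coset y)
          = residue_form p (residue_class p f \<otimes>\<^bsub>L\<^esub> \<Gamma>)" using \<Gamma> by blast
      then show ?thesis unfolding form_eq \<gamma> rf by (rule sym)
    qed
    then show "\<Gamma> = residue_class p \<beta>" unfolding \<gamma> by (rule represents_unique[OF \<beta>])
  qed
qed

lemma hermitian_invariant_eq_0_iff:
  assumes x: "x \<in> ker" and y: "y \<in> ker"
  shows "invariant_form (coset x) (coset y) = \<zero>\<^bsub>L\<^esub> \<longleftrightarrow> (\<forall>f. b x (act (q * f) y) = 0)"
proof -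
  obtain \<beta> where \<beta>: "represents x y \<beta>" using ex_represents[OF y] by blast
  have "invariant_form (coset x) (coset y) = \<zero>\<^bsub>L\<^esub> \<longleftrightarrow> p dvd \<beta>"
    unfolding hermitian_invariant_eq[OF x y \<beta>] residue_field_ops residue_class_eq_iff by simp
  also have "\<dots> \<longleftrightarrow> (\<forall>f. const_coeff p (\<beta> * f) = 0)"
  proof
    assume "p dvd \<beta>"
    then obtain c where "\<beta> = p * c" unfolding dvd_def by blast
    then show "\<forall>f. const_coeff p (\<beta> * f) = 0" by (simp only: mult.assoc const_coeff_mult simp_thms)
  next
    assume "\<forall>f. const_coeff p (\<beta> * f) = 0"
    then show "p dvd \<beta>"
      using dvd_if_functional_vanishes[OF p_irreducible functional_const_coeff const_coeff_mult, of 1 \<beta>]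
        const_coeff_1[OF p_irreducible] by simp
  qed
  finally show ?thesis using \<beta> unfolding represents_def by simp
qed

text \<open>With $h(x,x)$ the class of $\<beta>$, the condition on the right says that $e_p(\<beta>f) = 0$ for even $f$. By lemma
  \<open>const_coeff_odd\<close> this holds for $\<beta> = t s(t^2)$. Conversely it kills the even part of the reduced
  representative of $\<beta>$, which is fixed by the involution because $h$ is Hermitian.\<close>

lemma hermitian_invariant_odd_iff:
  assumes p0: "p \<in> Irr0" and x: "x \<in> ker"
  shows "odd_value (invariant_form (coset x) (coset x))
    \<longleftrightarrow> (\<forall>f. pderiv f = 0 \<longrightarrow> b x (act (q * f) x) = 0)"
proof -
  have dp: "pderiv p = 0" using p0 Irr0_iff by blast
  obtain \<beta> where \<beta>: "represents x x \<beta>" using ex_represents[OF x] by blast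
  note hi = hermitian_invariant_eq[OF x x \<beta>]
  note fc = functional_const_coeff[of p]
  note odd = const_coeff_odd[OF p_irreducible dp]
  let ?X = "monom 1 1 :: 'f poly"
  show ?thesis
  proof
    assume "odd_value (invariant_form (coset x) (coset x))"
    then obtain s where "p dvd \<beta> - ?X * at_t2 s" unfolding hi residue_class_eq_iff by blast
    then obtain c where c: "\<beta> - ?X * at_t2 s = p * c" unfolding dvd_def by blast
    show "\<forall>f. pderiv f = 0 \<longrightarrow> b x (act (q * f) x) = 0"
    proof (intro allI impI)
      fix f :: "'f poly" assume f: "pderiv f = 0"
      have "\<beta> = p * c + ?X * at_t2 s" using c by (simp only: diff_eq_eq)
      then have "\<beta> * f = p * (c * f) + ?X * (at_t2 s * f)" by (simp only: distrib_right mult.assoc)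
      moreover have "pderiv (at_t2 s * f) = 0" unfolding pderiv_mult f by simp
      ultimately have "const_coeff p (\<beta> * f) = 0" by (simp only: functional_add[OF fc] const_coeff_mult odd add_0)
      then show "b x (act (q * f) x) = 0" using \<beta> unfolding represents_def by simp
    qed
  next
    assume ev: "\<forall>f. pderiv f = 0 \<longrightarrow> b x (act (q * f) x) = 0"
    have ev\<beta>: "const_coeff p (\<beta> * f) = 0" if "pderiv f = 0" for f
      using ev that \<beta> unfolding represents_def by simp
    have "const_coeff p (star \<beta> * f) = const_coeff p (\<beta> * f)" for f
    proof -
      have "const_coeff p (star \<beta> * f) = bul (const_coeff p (\<beta> * star f))"
        using const_coeff_star[OF p_irreducible star_p, of "\<beta> * star f"] by simp
      also have "const_coeff p (\<beta> * star f) = b x (act (q * star f) x)" using \<beta> unfolding represents_def by simp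
      also have "bul \<dots> = b x (act (q * f) x)" using b_act_sym[of x "q * f" x] by (simp add: star_p)
      also have "\<dots> = const_coeff p (\<beta> * f)" using \<beta> unfolding represents_def by simp
      finally show ?thesis .
    qed
    then have "residue_class p (star \<beta>) = residue_class p \<beta>" by (rule represents_unique[OF \<beta>])
    then have sym: "p dvd star \<beta> - \<beta>" unfolding residue_class_eq_iff .
    define \<beta>0 where "\<beta>0 = \<beta> mod p"
    have p': "p \<noteq> 0" "degree p > 0" using p_irreducible irreducible_degree_pos by auto
    have \<beta>\<beta>0: "p dvd \<beta> - \<beta>0" unfolding \<beta>0_def by (simp only: dvd_minus_mod)
    have star\<beta>0: "star \<beta>0 = \<beta>0"
    proof -
      \<comment> \<open>The reduced representative is unique, so congruence to its conjugate means equality.\<close>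
      have "p dvd star (\<beta> - \<beta>0)"
        using \<beta>\<beta>0 star_dvd_star[of p "\<beta> - \<beta>0"] unfolding star_p by blast
      from dvd_add[OF dvd_diff[OF \<beta>\<beta>0 this] sym]
      have "p dvd (\<beta> - \<beta>0) - star (\<beta> - \<beta>0) + (star \<beta> - \<beta>)" .
      also have "(\<beta> - \<beta>0) - star (\<beta> - \<beta>0) + (star \<beta> - \<beta>) = star \<beta>0 - \<beta>0"
        unfolding star_diff by (simp add: algebra_simps del: poly_uminus_id)
      finally have d: "p dvd star \<beta>0 - \<beta>0" .
      have "degree \<beta>0 < degree p" using degree_mod_less[OF p'(1), of \<beta>] p'(2) unfolding \<beta>0_def by auto
      then have "degree (star \<beta>0 - \<beta>0) < degree p" using degree_diff_less[of "star \<beta>0" "degree p" \<beta>0] by simp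
      then have "star \<beta>0 - \<beta>0 = 0" using dvd_imp_degree_le[OF d] by linarith
      then show ?thesis by (simp only: right_minus_eq)
    qed
    obtain s where s: "pderiv \<beta>0 = at_t2 s" using pderiv_eq_0_iff_at_t2[of "pderiv \<beta>0"] by auto
    have "at_t2 (star s) = at_t2 s"
      unfolding star_at_t2[symmetric] s[symmetric] pderiv_star[symmetric] star\<beta>0 ..
    then have fs: "s \<in> fixed_polys bul" unfolding at_t2_eq_iff fixed_polys_iff .
    \<comment> \<open>The even part; the aim is that it is divisible by $p$.\<close>
    let ?\<beta>2 = "\<beta>0 - ?X * pderiv \<beta>0"
    have "p dvd ?\<beta>2"
    proof (rule dvd_if_functional_vanishes[OF p_irreducible fc const_coeff_mult])
      show "const_coeff p 1 \<noteq> 0" using const_coeff_1[OF p_irreducible] by simp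
      have e2: "const_coeff p (?\<beta>2 * f) = 0" if f: "pderiv f = 0" for f
      proof -
        obtain c where c: "\<beta> - \<beta>0 = p * c" using \<beta>\<beta>0 unfolding dvd_def by blast
        have "\<beta>0 = \<beta> - p * c" using c by (simp only: algebra_simps)
        then have "?\<beta>2 * f = \<beta> * f - p * (c * f) - ?X * (pderiv \<beta>0 * f)"
          by (simp only: left_diff_distrib mult.assoc)
        moreover have "pderiv (pderiv \<beta>0 * f) = 0" unfolding pderiv_mult f by simp
        ultimately show ?thesis
          by (simp only: functional_diff[OF fc] const_coeff_mult odd ev\<beta>[OF f] diff_zero)
      qed
      show "const_coeff p (?\<beta>2 * f) = 0" for f
      proof -
        have "?\<beta>2 * f = ?\<beta>2 * (f - ?X * pderiv f) + ?X * (?\<beta>2 * pderiv f)" by (simp only: algebra_simps)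
        moreover have "pderiv (?\<beta>2 * pderiv f) = 0" unfolding pderiv_mult even_part by simp
        ultimately show ?thesis
          by (simp only: functional_add[OF fc] e2[OF even_part] odd add_0)
      qed
    qed
    then have "p dvd (\<beta> - \<beta>0) + ?\<beta>2" using \<beta>\<beta>0 by (intro dvd_add)
    also have "(\<beta> - \<beta>0) + ?\<beta>2 = \<beta> - ?X * at_t2 s" unfolding s by (simp only: algebra_simps)
    finally have "invariant_form (coset x) (coset x) = residue_class p (?X * at_t2 s)"
      unfolding hi residue_class_eq_iff .
    then show "odd_value (invariant_form (coset x) (coset x))"
      using fs by blast
  qed
qed

text \<open>A frame gives a generating family of $V_{p,r}$, and a minimal generating subfamily is a basis; passing to
  a subfamily keeps orthogonality and the odd values.\<close>

lemma odd_representable_iff: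
  assumes p0: "p \<in> Irr0"
  shows "odd_representable bul p M (invariant_form) \<longleftrightarrow> (\<exists>E. odd_frame p r UNIV E)"
proof
  assume "odd_representable bul p M invariant_form"
  then obtain E where fin: "finite E" and bas: "VS.basis E"
    and orth: "\<forall>x\<in>E. \<forall>y\<in>E. x \<noteq> y \<longrightarrow> invariant_form x y = \<zero>\<^bsub>L\<^esub>"
    and odd: "\<forall>x\<in>E. odd_value (invariant_form x x)"
    unfolding odd_representable_def by (elim exE conjE)
  have EM: "E \<subseteq> carrier M" and gen: "VS.gen_set E" using bas unfolding VS.basis_def by auto
  have "\<forall>X\<in>E. \<exists>x. x \<in> ker \<and> coset x = X" using EM ex_coset by blast
  from bchoice[OF this] obtain \<rho> where "\<forall>X\<in>E. \<rho> X \<in> ker \<and> coset (\<rho> X) = X" ..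
  then have \<rho>: "\<And>X. X \<in> E \<Longrightarrow> \<rho> X \<in> ker" "\<And>X. X \<in> E \<Longrightarrow> coset (\<rho> X) = X" by simp_all
  have \<rho>k: "\<rho> ` E \<subseteq> ker" using \<rho>(1) by blast
  have "coset ` \<rho> ` E = E" using \<rho>(2) by (simp add: image_image)
  then have "VS.gen_set (coset ` \<rho> ` E)" using gen by simp
  then have g: "\<forall>v\<in>ker. \<exists>w\<in>mspan (\<rho> ` E). v - w \<in> denom" unfolding gen_set_iff[OF \<rho>k] .
  have "odd_frame p r UNIV (\<rho> ` E)"
    unfolding odd_frame_def
  proof (intro conjI ballI allI impI)
    show "finite (\<rho> ` E)" using fin by simp
    show "act (p ^ r) x = 0" if "x \<in> \<rho> ` E" for x using \<rho>k that mem_ker by blast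
    show "b x (act (q * f) y) = 0" if xy: "x \<in> \<rho> ` E" "y \<in> \<rho> ` E" "x \<noteq> y" for x y f
    proof -
      obtain X Y where X: "X \<in> E" "x = \<rho> X" and Y: "Y \<in> E" "y = \<rho> Y" using xy by blast
      have "X \<noteq> Y" using xy(3) X(2) Y(2) by blast
      then have "invariant_form (coset x) (coset y) = \<zero>\<^bsub>L\<^esub>" using orth X Y \<rho>(2) by simp
      then show ?thesis using hermitian_invariant_eq_0_iff[of x y] \<rho>(1) X Y by blast
    qed
    show "b x (act (q * f) x) = 0" if x: "x \<in> \<rho> ` E" "pderiv f = 0" for x f
    proof -
      obtain X where X: "X \<in> E" "x = \<rho> X" using x by blast
      then have "odd_value (invariant_form (coset x) (coset x))"
        using odd \<rho>(2) by simp
      then show ?thesis using hermitian_invariant_odd_iff[OF p0, of x] \<rho>(1) X x(2) by blast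
    qed
    show "\<exists>w\<in>mspan (\<rho> ` E). \<exists>z\<in>UNIV. act q (v - w) = act (p ^ r) z" if "act (p ^ r) v = 0" for v
      using g that mem_ker mem_denom by blast
  qed simp
  then show "\<exists>E. odd_frame p r UNIV E" by blast
next
  assume "\<exists>E. odd_frame p r UNIV E"
  then obtain E where fin: "finite E" and k: "\<forall>x\<in>E. act (p ^ r) x = 0"
    and orth: "\<forall>x\<in>E. \<forall>y\<in>E. x \<noteq> y \<longrightarrow> (\<forall>f. b x (act (q * f) y) = 0)"
    and odd: "\<forall>x\<in>E. \<forall>f. pderiv f = 0 \<longrightarrow> b x (act (q * f) x) = 0"
    and g: "\<forall>v\<in>UNIV. act (p ^ r) v = 0 \<longrightarrow> (\<exists>w\<in>mspan E. \<exists>z\<in>UNIV. act q (v - w) = act (p ^ r) z)"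
    unfolding odd_frame_def by (elim exE conjE)
  have Ek: "E \<subseteq> ker" using k mem_ker by blast
  have mk: "mspan E \<subseteq> ker" by (rule mspan_minimal[OF Ek invariant_ker])
  have "VS.gen_set (coset ` E)"
    unfolding gen_set_iff[OF Ek]
  proof
    fix v assume v: "v \<in> ker"
    then obtain w z where w: "w \<in> mspan E" "act q (v - w) = act (p ^ r) z" using g mem_ker by blast
    have "act (p ^ r) w = 0" using w(1) mk mem_ker by blast
    then have "act (p ^ r) (v - w) = 0" using v by (simp add: mem_ker)
    then show "\<exists>w\<in>mspan E. v - w \<in> denom" using w denomI by blast
  qed
  moreover have "coset ` E \<subseteq> carrier M" using Ek carrier_M by blast
  ultimately obtain B where B: "B \<subseteq> coset ` E" "minimal B (\<lambda>S. S \<subseteq> carrier M \<and> VS.gen_set S)"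
    using minimal_exists[of "coset ` E" "\<lambda>S. S \<subseteq> carrier M \<and> VS.gen_set S"] fin by blast
  have "finite B" using B(1) fin finite_surj by blast
  moreover have "VS.basis B" by (rule VS.min_gen_is_basis[OF B(2)])
  moreover have "invariant_form X Y = \<zero>\<^bsub>L\<^esub>" if XY: "X \<in> B" "Y \<in> B" "X \<noteq> Y" for X Y
  proof -
    obtain x y where x: "x \<in> E" "X = coset x" and y: "y \<in> E" "Y = coset y" using XY B(1) by blast
    have "x \<noteq> y" using XY(3) x y by blast
    then show ?thesis using hermitian_invariant_eq_0_iff[of x y] orth x y Ek by blast
  qed
  moreover have "odd_value (invariant_form X X)" if X: "X \<in> B" for X
  proof -
    obtain x where x: "x \<in> E" "X = coset x" using X B(1) by blast
    then show ?thesis using hermitian_invariant_odd_iff[OF p0, of x] odd Ek by blast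
  qed
  ultimately show "odd_representable bul p M invariant_form" unfolding odd_representable_def by blast
qed

end

context hermitian_pair
begin

lemma no_odd_invariants_iff:
  "no_odd_invariants UNIV \<longleftrightarrow> (\<forall>p\<in>Irr - Irr0. \<forall>r\<ge>1. odd r \<longrightarrow> primary_number scale u p r = 0)"
proof -
  have *: "primary_number scale u p r = 0 \<longleftrightarrow> (\<forall>x. act (p ^ r) x = 0 \<longrightarrow> (\<exists>z. act (p ^ (r - 1)) x = act (p ^ r) z))"
    if "p \<in> Irr" "r \<ge> 1" for p r
  proof -
    interpret primary_quotient scale Basis bul b u p r by unfold_locales (use that in auto)
    show ?thesis unfolding primary_number_eq_0_iff subset_iff mem_ker mem_denom by blast
  qed
  have "r \<ge> 1" if "odd r" for r :: nat using that by (cases r) auto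
  then show ?thesis unfolding no_odd_invariants_def using * by simp blast
qed

lemma odd_framed_iff:
  "odd_framed UNIV \<longleftrightarrow> (\<forall>p\<in>Irr0 \<inter> fixed_polys bul. \<forall>r\<ge>1.
     odd_representable bul p (primary_space scale u p r) (hermitian_invariant scale b u p r))"
proof -
  have "odd_representable bul p (primary_space scale u p r) (hermitian_invariant scale b u p r)
      \<longleftrightarrow> (\<exists>E. odd_frame p r UNIV E)" if pr: "p \<in> Irr0 \<inter> fixed_polys bul" "r \<ge> 1" for p r
  proof -
    interpret hermitian_primary_quotient scale Basis bul b u p r
      by unfold_locales (use pr Irr0_iff fixed_polys_iff in auto)
    show ?thesis by (rule odd_representable_iff) (use pr in blast)
  qed
  then show ?thesis unfolding odd_framed_def by blast
qed

end

section \<open>The characterization\<close>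

theorem theorem6p4:
  fixes scale :: "'f::field \<Rightarrow> 'v::ab_group_add \<Rightarrow> 'v"
    and Basis :: "'v set"
    and bul :: "'f \<Rightarrow> 'f"
    and b :: "'v \<Rightarrow> 'v \<Rightarrow> 'f"
    and u :: "'v \<Rightarrow> 'v"
  assumes "CHAR('f) = 2"
    and "field_involution bul"
    and "finite_dimensional_vector_space scale Basis"
    and "hermitian_form scale bul b"
    and "nondegenerate b"
    and "Vector_Spaces.linear scale scale u"
    and "bij u"
    and "selfadjoint b u"
  shows "(\<exists>a1 a2. Vector_Spaces.linear scale scale a1 \<and> Vector_Spaces.linear scale scale a2 \<and>
            selfadjoint b a1 \<and> selfadjoint b a2 \<and>
            (\<forall>x. a1 (a1 x) = 0) \<and> (\<forall>x. a2 (a2 x) = 0) \<and>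
            (\<forall>x. u x = a1 x + a2 x))
         \<longleftrightarrow>
         (\<forall>p\<in>Irr - Irr0. \<forall>r\<ge>1. odd r \<longrightarrow> primary_number scale u p r = 0) \<and>
         (\<forall>p\<in>Irr0 \<inter> fixed_polys bul. \<forall>r\<ge>1.
            odd_representable bul p (primary_space scale u p r)
              (hermitian_invariant scale b u p r))"
proof -
  have "(1::'f) + 1 = 0" using of_nat_CHAR[where ?'a = 'f] unfolding assms(1) by simp
  then interpret hermitian_pair scale Basis bul b u
    using assms by (intro hermitian_pair.intro char2_involution.intro hermitian_pair_axioms.intro)
  show ?thesis
    using sum_of_two_square_zero_iff unfolding sum_of_two_square_zero_def no_odd_invariants_iff odd_framed_iff .
qed

end
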